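(* Let $V$ be a Kato-decomposable potential (with ground state $\varphi_0$), and let $(\widetilde T_t)_{t\ge 0}$ be the corresponding intrinsic fractional Feynman-Kac semigroup. Let $\Omega=D_{\rm r}(\mathbf{R},\mathbf{R}^d)$, with coordinate process $\widetilde X_t(\omega)=\omega(t)$ and $\sigma$-field $\mathcal{F}$ generated by it, and put $\mathcal{F}_t^+=\sigma(\widetilde X_s:0\le s\le t)$ for $t\ge 0$ and $\mathcal{F}_t^-=\sigma(\widetilde X_s: t\le s\le 0)$ for $t\le 0$. Then for all $x\in\mathbf{R}^d$ there exists a probability measure $\mu^x$ on $(\Omega,\mathcal{F})$ such that the following properties hold: (1) $\mu^x(\widetilde X_0=x)=1$. (2) (Reflection symmetry) Under $\mu^x$, $(\widetilde X_t)_{t\ge 0}$ and $(\widetilde X_t)_{t\le 0}$ are independent, and $\widetilde X_{-t}\stackrel{\rm d}{=}\widetilde X_t$ for $t\in\mathbf{R}$. (3) (Markov property) Under $\mu^x$, $(\widetilde X_t)_{t\ge 0}$ is a Markov process with respect to $(\mathcal{F}_t^+)_{t\ge 0}$, and $(\widetilde X_t)_{t\le 0}$ is a Markov process with respect to $(\mathcal{F}_t^-)_{t\le 0}$. (4) (Shift invariance) Let $-\infty<t_0\le t_1\le\dots\le t_n<\infty$. The finite dimensional distributions with respect to the stationary distribution $\varphi_0^2dx$ are given by $$\int_{\mathbf{R}^d}\mathbf{E}_{\mu^x}\Big[\prod_{j=0}^n f_j(\widetilde X_{t_j})\Big]\varphi_0^2(x)\,dx=\big(f_0,\ \widetilde T_{t_1-t_0}f_1\cdots\widetilde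 T_{t_n-t_{n-1}}f_n\big)_{L^2(\mathbf{R}^d,\varphi_0^2dx)}$$ for $f_j\in L^\infty(\mathbf{R}^d)$, $j=0,\dots,n$, and are shift invariant, i.e. $$\int_{\mathbf{R}^d}\mathbf{E}_{\mu^x}\Big[\prod_{j=0}^n f_j(\widetilde X_{t_j})\Big]\varphi_0^2(x)\,dx=\int_{\mathbf{R}^d}\mathbf{E}_{\mu^x}\Big[\prod_{j=0}^n f_j(\widetilde X_{t_j+s})\Big]\varphi_0^2(x)\,dx,\quad s\in\mathbf{R}.$$
   Context: Let $d\ge 1$, $\alpha\in(0,2)$, and let $(X_t)_{t\ge 0}$ be the rotationally invariant $\alpha$-stable process on $\mathbf{R}^d$ with càdlàg paths, $\mathbf{E}^0[e^{i\xi\cdot X_t}]=e^{-t|\xi|^\alpha}$; $\mathbf{P}^x,\mathbf{E}^x$ are law and expectation for the process started at $x$. A Borel function $W$ on $\mathbf{R}^d$ is in $\mathcal{K}^\alpha$ if $\lim_{t\to 0}\sup_x\int_0^t\mathbf{E}^x[|W(X_s)|]ds=0$, and in $\mathcal{K}^\alpha_{\rm loc}$ if $W\mathbf{1}_B\in\mathcal{K}^\alpha$ for every ball $B$. A Borel function $V:\mathbf{R}^d\to\mathbf{R}$ is a Kato-decomposable potential if its positive and negative parts ($V=V_+-V_-$) satisfy $V_+\in\mathcal{K}^\alpha_{\rm loc}$, $V_-\in\mathcal{K}^\alpha$. The Feynman-Kac semigroup is $T_tf(x)=\mathbf{E}^x[e^{-\int_0^tV(X_s)ds}f(X_t)]$;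 it is a strongly continuous symmetric semigroup on $L^2(\mathbf{R}^d)$, and $H_\alpha$ denotes the self-adjoint operator bounded from below with $e^{-tH_\alpha}=T_t$. For $t>0$, $T_t$ has a bounded, continuous, symmetric, strictly positive integral kernel $u(t,x,y)$. Standing assumption: $\lambda_0=\inf\operatorname{Spec}H_\alpha$ is an isolated eigenvalue; the corresponding eigenfunction with $\|\varphi_0\|_2=1$ is the ground state $\varphi_0$, taken in its strictly positive, bounded, continuous version. Intrinsic kernel: $\widetilde u(t,x,y)=\frac{e^{\lambda_0t}u(t,x,y)}{\varphi_0(x)\varphi_0(y)}$. The intrinsic fractional Feynman-Kac semigroup is $\widetilde T_tf(x)=\int_{\mathbf{R}^d}f(y)\widetilde u(t,x,y)\varphi_0^2(y)dy$ for $t>0$, $\widetilde T_0=\mathrm{Id}$, acting on $L^2(\mathbf{R}^d,\varphi_0^2dx)$. $D_{\rm r}(\mathbf{R},\mathbf{R}^d)$ is the space of right continuous functions $\mathbf{R}\to\mathbf{R}^d$ with left limits. The expression $\widetilde T_{t_1-t_0}f_1\cdots\widetilde T_{t_n-t_{n-1}}f_n$ means $\widetilde T_{t_1-t_0}(f_1\widetilde T_{t_2-t_1}(f_2\cdots\widetilde T_{t_n-t_{n-1}}f_n))$, where each $f_j$ acts by multiplication, and the functions $f_j$ are real-valued, so $(f,g)_{L^2(\mathbf{R}^d,\varphi_0^2dx)}=\int fg\,\varphi_0^2dx$. *)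

theory Defs
  imports "HOL-Probability.Probability" "HOL-Probability.Conditional_Expectation"
    "HOL-Analysis.Isolated"
begin

section \<open>The stable process\<close>

definition cadlag_on :: "real set \<Rightarrow> (real \<Rightarrow> 'a::topological_space) \<Rightarrow> bool" where
  "cadlag_on I w \<longleftrightarrow>
     (\<forall>t\<in>I. (w \<longlongrightarrow> w t) (at t within (I \<inter> {t<..})) \<and>
            (\<exists>l. (w \<longlongrightarrow> l) (at t within (I \<inter> {..<t}))))"

text \<open>
  The rotationally invariant \<open>\<alpha>\<close>-stable process is realised as a process \<open>X\<close> started at the
  origin on a probability space \<open>M\<close>; only times \<open>t \<ge> 0\<close> matter.  The law \<open>P\<^sup>x\<close> of the process
  started at \<open>x\<close> is the law of \<open>x + X\<close> under \<open>M\<close>, so \<open>E\<^sup>x[F(X)]\<close> is written below as an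
  integral of \<open>F(x + X)\<close> over \<open>M\<close>.
\<close>

text \<open>The \<open>\<sigma>\<close>-field on \<open>S\<close> generated by the random variables \<open>Y s\<close> with \<open>s \<in> I\<close>.\<close>

definition process_sigma :: "'w set \<Rightarrow> (real \<Rightarrow> 'w \<Rightarrow> 'a::euclidean_space) \<Rightarrow> real set \<Rightarrow> 'w measure" where
  "process_sigma S Y I = sigma S {{\<omega> \<in> S. Y s \<omega> \<in> A} | s A. s \<in> I \<and> A \<in> sets borel}"

definition levy_process :: "'w measure \<Rightarrow> (real \<Rightarrow> 'w \<Rightarrow> 'a::euclidean_space) \<Rightarrow> bool" where
  "levy_process M X \<longleftrightarrow>
     prob_space M \<and>
     (\<forall>t\<ge>0. X t \<in> borel_measurable M) \<and>
     (AE \<omega> in M. X 0 \<omega> = 0) \<and>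
     (\<forall>\<omega>\<in>space M. cadlag_on {0..} (\<lambda>t. X t \<omega>)) \<and>
     (\<forall>s t. 0 \<le> s \<and> s \<le> t \<longrightarrow>
        distr M borel (\<lambda>\<omega>. X t \<omega> - X s \<omega>) = distr M borel (X (t - s))) \<and>
     (\<forall>s t. 0 \<le> s \<and> s \<le> t \<longrightarrow>
        prob_space.indep_set M
          (sets (process_sigma (space M) X {0..s}))
          (sets (vimage_algebra (space M) (\<lambda>\<omega>. X t \<omega> - X s \<omega>) borel)))"

definition stable_process :: "real \<Rightarrow> 'w measure \<Rightarrow> (real \<Rightarrow> 'w \<Rightarrow> 'a::euclidean_space) \<Rightarrow> bool" where
  "stable_process \<alpha> M X \<longleftrightarrow>
     levy_process M X \<and>
     (\<forall>t\<ge>0. \<forall>\<xi>. (CLINT \<omega>|M. iexp (\<xi> \<bullet> X t \<omega>)) = exp (- complex_of_real (t * norm \<xi> powr \<alpha>)))"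

section \<open>Kato-decomposable potentials\<close>

definition kato_class :: "'w measure \<Rightarrow> (real \<Rightarrow> 'w \<Rightarrow> 'a::euclidean_space) \<Rightarrow> ('a \<Rightarrow> real) \<Rightarrow> bool" where
  "kato_class M X W \<longleftrightarrow>
     W \<in> borel_measurable borel \<and>
     ((\<lambda>t. SUP x. \<integral>\<^sup>+s\<in>{0..t}. (\<integral>\<^sup>+\<omega>. ennreal \<bar>W (x + X s \<omega>)\<bar> \<partial>M) \<partial>lborel) \<longlongrightarrow> 0) (at_right 0)"

definition kato_class_loc :: "'w measure \<Rightarrow> (real \<Rightarrow> 'w \<Rightarrow> 'a::euclidean_space) \<Rightarrow> ('a \<Rightarrow> real) \<Rightarrow> bool" where
  "kato_class_loc M X W \<longleftrightarrow>
     W \<in> borel_measurable borel \<and>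
     (\<forall>c r. kato_class M X (\<lambda>x. W x * indicator (ball c r) x))"

definition kato_decomposable :: "'w measure \<Rightarrow> (real \<Rightarrow> 'w \<Rightarrow> 'a::euclidean_space) \<Rightarrow> ('a \<Rightarrow> real) \<Rightarrow> bool" where
  "kato_decomposable M X V \<longleftrightarrow>
     V \<in> borel_measurable borel \<and>
     kato_class_loc M X (\<lambda>x. max (V x) 0) \<and>
     kato_class M X (\<lambda>x. max (- V x) 0)"

section \<open>Unbounded operators on \<open>L\<^sup>2\<close>\<close>

text \<open>
  Elements of the real Hilbert space \<open>L\<^sup>2(R\<^sup>d)\<close> are represented by Borel functions, and an
  unbounded operator by its graph, a relation between such functions.
\<close>

definition l2_norm_sq :: "('a::euclidean_space \<Rightarrow> real) \<Rightarrow> ennreal" where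
  "l2_norm_sq f = (\<integral>\<^sup>+x. ennreal ((f x)\<^sup>2) \<partial>lborel)"

definition L2_space :: "('a::euclidean_space \<Rightarrow> real) set" where
  "L2_space = {f \<in> borel_measurable borel. l2_norm_sq f < \<infinity>}"

text \<open>
  The operator \<open>H\<close> with \<open>T\<^sub>t = e\<^bsup>-tH\<^esup>\<close>, that is, \<open>-H\<close> is the infinitesimal generator of the strongly
  continuous semigroup \<open>T\<close> on \<open>L\<^sup>2\<close>: \<open>f\<close> is in the domain with \<open>H f = g\<close> iff
  \<open>(f - T\<^sub>t f) / t\<close> converges to \<open>g\<close> in \<open>L\<^sup>2\<close> as \<open>t\<close> tends to 0.
\<close>

definition semigroup_hamiltonian ::
    "(real \<Rightarrow> ('a::euclidean_space \<Rightarrow> real) \<Rightarrow> ('a \<Rightarrow> real)) \<Rightarrow> (('a \<Rightarrow> real) \<times> ('a \<Rightarrow> real)) set" where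
  "semigroup_hamiltonian T =
     {(f, g). f \<in> L2_space \<and> g \<in> L2_space \<and>
        ((\<lambda>t. l2_norm_sq (\<lambda>x. (f x - T t f x) / t - g x)) \<longlongrightarrow> 0) (at_right 0)}"

text \<open>
  \<open>l\<close> is in the resolvent set iff \<open>H - l\<close> maps its domain bijectively onto \<open>L\<^sup>2\<close> with bounded
  inverse; the norm estimate contains injectivity.  Only real \<open>l\<close> are considered, since \<open>H\<close> is
  self-adjoint; as \<open>H\<close> maps real functions to real functions, the real and the complex
  \<open>L\<^sup>2\<close> space give the same spectrum.
\<close>

definition op_resolvent_set :: "(('a::euclidean_space \<Rightarrow> real) \<times> ('a \<Rightarrow> real)) set \<Rightarrow> real set" where
  "op_resolvent_set H = {l.
     (\<exists>C::real. \<forall>(f, h)\<in>H. l2_norm_sq f \<le> ennreal C * l2_norm_sq (\<lambda>x. h x - l * f x)) \<and>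
     (\<forall>g\<in>L2_space. \<exists>(f, h)\<in>H. AE x in lborel. h x - l * f x = g x)}"

definition op_spectrum :: "(('a::euclidean_space \<Rightarrow> real) \<times> ('a \<Rightarrow> real)) set \<Rightarrow> real set" where
  "op_spectrum H = - op_resolvent_set H"

section \<open>Feynman-Kac semigroup and ground state\<close>

definition fk_semigroup :: "'w measure \<Rightarrow> (real \<Rightarrow> 'w \<Rightarrow> 'a::euclidean_space) \<Rightarrow> ('a \<Rightarrow> real) \<Rightarrow>
    real \<Rightarrow> ('a \<Rightarrow> real) \<Rightarrow> 'a \<Rightarrow> real" where
  "fk_semigroup M X V t f x =
     (LINT \<omega>|M. exp (- (LINT s:{0..t}|lborel. V (x + X s \<omega>))) * f (x + X t \<omega>))"

definition fk_hamiltonian :: "'w measure \<Rightarrow> (real \<Rightarrow> 'w \<Rightarrow> 'a::euclidean_space) \<Rightarrow> ('a \<Rightarrow> real) \<Rightarrow>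
    (('a \<Rightarrow> real) \<times> ('a \<Rightarrow> real)) set" where
  "fk_hamiltonian M X V = semigroup_hamiltonian (fk_semigroup M X V)"

text \<open>The kernel is determined by the following conditions, being continuous.\<close>

definition fk_kernel :: "'w measure \<Rightarrow> (real \<Rightarrow> 'w \<Rightarrow> 'a::euclidean_space) \<Rightarrow> ('a \<Rightarrow> real) \<Rightarrow>
    (real \<Rightarrow> 'a \<Rightarrow> 'a \<Rightarrow> real) \<Rightarrow> bool" where
  "fk_kernel M X V u \<longleftrightarrow>
     (\<forall>t>0.
        bounded (range (\<lambda>(x, y). u t x y)) \<and>
        continuous_on UNIV (\<lambda>(x, y). u t x y) \<and>
        (\<forall>x y. u t x y = u t y x) \<and>
        (\<forall>x y. 0 < u t x y) \<and>
        (\<forall>f\<in>L2_space. \<forall>x. fk_semigroup M X V t f x = (LINT y|lborel. u t x y * f y)))"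

definition ground_state :: "(('a::euclidean_space \<Rightarrow> real) \<times> ('a \<Rightarrow> real)) set \<Rightarrow> real \<Rightarrow> ('a \<Rightarrow> real) \<Rightarrow> bool" where
  "ground_state H l \<phi> \<longleftrightarrow>
     (\<phi>, \<lambda>x. l * \<phi> x) \<in> H \<and> l2_norm_sq \<phi> = 1 \<and>
     (\<forall>x. 0 < \<phi> x) \<and> bounded (range \<phi>) \<and> continuous_on UNIV \<phi>"

definition intrinsic_kernel :: "real \<Rightarrow> ('a \<Rightarrow> real) \<Rightarrow> (real \<Rightarrow> 'a \<Rightarrow> 'a \<Rightarrow> real) \<Rightarrow>
    real \<Rightarrow> 'a \<Rightarrow> 'a \<Rightarrow> real" where
  "intrinsic_kernel l \<phi> u t x y = exp (l * t) * u t x y / (\<phi> x * \<phi> y)"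

definition intrinsic_semigroup :: "real \<Rightarrow> ('a::euclidean_space \<Rightarrow> real) \<Rightarrow> (real \<Rightarrow> 'a \<Rightarrow> 'a \<Rightarrow> real) \<Rightarrow>
    real \<Rightarrow> ('a \<Rightarrow> real) \<Rightarrow> 'a \<Rightarrow> real" where
  "intrinsic_semigroup l \<phi> u t f x =
     (if t = 0 then f x else LINT y|lborel. f y * intrinsic_kernel l \<phi> u t x y * (\<phi> y)\<^sup>2)"

definition stationary_measure :: "('a::euclidean_space \<Rightarrow> real) \<Rightarrow> 'a measure" where
  "stationary_measure \<phi> = density lborel (\<lambda>x. ennreal ((\<phi> x)\<^sup>2))"

text \<open>
  \<open>semigroup_chain T t f k m\<close> is
  \<open>T\<^bsub>t(k+1)-t(k)\<^esub> (f(k+1) T\<^bsub>t(k+2)-t(k+1)\<^esub> (f(k+2) \<dots> T\<^bsub>t(k+m)-t(k+m-1)\<^esub> f(k+m)))\<close>;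
  the empty expression is the constant function 1.
\<close>

primrec semigroup_chain :: "(real \<Rightarrow> ('a \<Rightarrow> real) \<Rightarrow> 'a \<Rightarrow> real) \<Rightarrow> (nat \<Rightarrow> real) \<Rightarrow>
    (nat \<Rightarrow> 'a \<Rightarrow> real) \<Rightarrow> nat \<Rightarrow> nat \<Rightarrow> 'a \<Rightarrow> real" where
  "semigroup_chain T t f k 0 = (\<lambda>x. 1)"
| "semigroup_chain T t f k (Suc m) =
     T (t (Suc k) - t k) (\<lambda>x. f (Suc k) x * semigroup_chain T t f (Suc k) m x)"

text \<open>Borel representatives of elements of \<open>L\<^sup>\<infinity>(R\<^sup>d)\<close>.\<close>

definition Linf_space :: "('a::euclidean_space \<Rightarrow> real) set" where
  "Linf_space = {f \<in> borel_measurable borel. \<exists>C. AE x in lborel. \<bar>f x\<bar> \<le> C}"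

section \<open>Path space and Markov processes\<close>

definition cadlag_paths :: "(real \<Rightarrow> 'a::euclidean_space) set" where
  "cadlag_paths = {w. cadlag_on UNIV w}"

definition path_sigma :: "real set \<Rightarrow> (real \<Rightarrow> 'a::euclidean_space) measure" where
  "path_sigma I = process_sigma cadlag_paths (\<lambda>t w. w t) I"

definition markov_process :: "'w measure \<Rightarrow> (real \<Rightarrow> 'w measure) \<Rightarrow> (real \<Rightarrow> 'w \<Rightarrow> 'a::euclidean_space) \<Rightarrow> bool" where
  "markov_process M F Y \<longleftrightarrow>
     (\<forall>t\<ge>0. subalgebra M (F t)) \<and>
     (\<forall>s t. 0 \<le> s \<and> s \<le> t \<longrightarrow> sets (F s) \<subseteq> sets (F t)) \<and>
     (\<forall>t\<ge>0. Y t \<in> borel_measurable (F t)) \<and>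
     (\<forall>s t. \<forall>f\<in>borel_measurable borel. 0 \<le> s \<and> s \<le> t \<and> bounded (range f) \<longrightarrow>
        (AE \<omega> in M. real_cond_exp M (F s) (\<lambda>\<omega>. f (Y t \<omega>)) \<omega> =
                     real_cond_exp M (vimage_algebra (space M) (Y s) borel) (\<lambda>\<omega>. f (Y t \<omega>)) \<omega>))"

end

theory Submission
  imports Defs
begin

text \<open>
The measures are obtained from a Doob transform. Write \<open>l\<close> for the ground state energy, \<open>\<phi>\<close> for
the ground state and \<open>T\<^sub>t\<close> for the Feynman-Kac semigroup. Since \<open>e\<^bsup>lt\<^esup> T\<^sub>t \<phi> = \<phi>\<close> at every point
(\<open>ground_state_fixed\<close>), the weight \<open>e\<^bsup>lt\<^esup> \<phi>(X\<^sub>t) / \<phi>(x) exp(- \<integral>\<^sub>0\<^sup>t V(X\<^sub>s) ds)\<close> has mean 1 under the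
stable process started at \<open>x\<close>. Under the law with this density on \<open>[0, t]\<close> the process is
Markovian with transition kernels \<open>\<phi>(y)\<^sup>2\<close> times the intrinsic kernel, because the exponential of
an integral over time is multiplicative (\<open>segment_law_markov\<close>).

The densities for different \<open>t\<close> are consistent, but do not come from one density on the whole
half-line. The theorem of Ionescu-Tulcea replaces the projective limit: paths over unit time
intervals are drawn one after another, each with the above law started where its
predecessor ended, and are concatenated (\<open>one_sided_process\<close>). In this way the paths have left
limits and are right continuous by construction, without any regularisation of a process given
by its finite dimensional distributions. Two independent copies, one of them run backwards and
replaced by its left limits, give the two-sided process (\<open>two_sided_law_exists\<close>). Passing to left
limits is harmless, as at a fixed time a Levy process almost surely does not jump
(\<open>no_fixed_jump\<close>).

The eigenvalue equation has to be extracted from the hypothesis that \<open>\<phi>\<close> is an eigenfunction of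
the generator in \<open>L\<^sup>2\<close>. Khasminskii's lemma bounds \<open>T\<^sub>t 1\<close> uniformly on bounded time intervals
(\<open>fk_op_one_bounded\<close>). In the telescoping sum of \<open>\<phi> - e\<^bsup>lt\<^esup> T\<^sub>t \<phi>\<close> over \<open>n\<close> time steps
each term is \<open>e\<^bsup>lkt/n\<^esup> T\<^bsub>kt/n\<^esub>\<close> applied to a function of \<open>L\<^sup>2\<close> norm \<open>o(1/n)\<close>, so that the sum is
small after integration over any bounded set, which yields equality almost everywhere
(\<open>scaled_eq_AE\<close>). Two applications of Fatou's lemma, one on path space as \<open>t\<close> tends to 0 and one
for the continuous kernel, lift this to every point.

The formula for the finite dimensional distributions is algebra with the transition operators
\<open>P\<^sub>t\<close>: given the starting point, nonnegative and nonpositive times contribute independent factors,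
each an iterated product of operators (\<open>forward_expectation\<close>, \<open>backward_expectation\<close>), and
symmetry of \<open>P\<^sub>t\<close> with respect to \<open>\<phi>\<^sup>2 dx\<close> moves the operators of the backward factor over to the
forward one (\<open>chain_pairing\<close>). The result depends on differences of times only, whence shift
invariance.
\<close>

section \<open>Right continuous paths with left limits\<close>

text \<open>
Right continuity makes the process a pointwise limit of the processes which are constant in time
between consecutive points of a grid, each evaluated at the right end point. Clipping the time
to \<open>[0, s]\<close> means that only the values up to \<open>s\<close> enter, so the lemma also gives progressive
measurability.
\<close>

lemma borel_measurable_right_continuous_process:
  fixes Y :: "real \<Rightarrow> 'w \<Rightarrow> 'a::euclidean_space"
  assumes s: "0 \<le> s"
    and meas: "\<And>q. 0 \<le> q \<Longrightarrow> q \<le> s \<Longrightarrow> Y q \<in> borel_measurable N"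
    and rc: "\<And>\<omega> q. \<omega> \<in> space N \<Longrightarrow> 0 \<le> q \<Longrightarrow> q < s \<Longrightarrow> ((\<lambda>r. Y r \<omega>) \<longlongrightarrow> Y q \<omega>) (at_right q)"
  shows "(\<lambda>(q, \<omega>). Y (max 0 (min q s)) \<omega>) \<in> borel_measurable (borel \<Otimes>\<^sub>M N)"
proof -
  define c where "c q = max 0 (min q s)" for q
  define T where "T k q = max 0 (min s ((of_int \<lfloor>real (Suc k) * c q\<rfloor> + 1) / real (Suc k)))" for k :: nat and q
  have c01: "0 \<le> c q" "c q \<le> s" for q using s by (auto simp: c_def)
  have T01: "0 \<le> T k q" "T k q \<le> s" for k q using s by (auto simp: T_def)
  have Tge: "c q \<le> T k q" for k and q :: real
  proof -
    have "real (Suc k) * c q \<le> of_int \<lfloor>real (Suc k) * c q\<rfloor> + 1" by linarith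
    then have "c q \<le> (of_int \<lfloor>real (Suc k) * c q\<rfloor> + 1) / real (Suc k)"
      by (simp add: field_simps)
    then show ?thesis using c01[of q] by (auto simp: T_def)
  qed
  have Tgt: "c q < T k q" if "c q < s" for k and q :: real
  proof -
    have "real (Suc k) * c q < of_int \<lfloor>real (Suc k) * c q\<rfloor> + 1" by linarith
    then have "c q < (of_int \<lfloor>real (Suc k) * c q\<rfloor> + 1) / real (Suc k)"
      by (simp add: field_simps)
    then show ?thesis using that by (auto simp: T_def)
  qed
  have Tle: "T k q \<le> c q + 1 / real (Suc k)" for k and q :: real
  proof -
    have "of_int \<lfloor>real (Suc k) * c q\<rfloor> + 1 \<le> real (Suc k) * c q + 1" by linarith
    then have "(of_int \<lfloor>real (Suc k) * c q\<rfloor> + 1) / real (Suc k) \<le> (real (Suc k) * c q + 1) / real (Suc k)"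
      by (rule divide_right_mono) simp
    also have "\<dots> = c q + 1 / real (Suc k)" by (simp add: field_simps)
    finally show ?thesis using c01[of q] unfolding T_def
      by (intro max.boundedI min.coboundedI2) auto
  qed
  have Tlim: "(\<lambda>k. T k q) \<longlonglongrightarrow> c q" for q :: real
  proof (rule tendsto_sandwich[of "\<lambda>_. c q" _ _ "\<lambda>k. c q + 1 / real (Suc k)"])
    have "(\<lambda>k. c q + 1 / real (Suc k)) \<longlonglongrightarrow> c q + 0"
      by (intro tendsto_intros LIMSEQ_Suc lim_1_over_n)
    then show "(\<lambda>k. c q + 1 / real (Suc k)) \<longlonglongrightarrow> c q" by simp
  qed (use Tge Tle in auto)
  \<comment> \<open>The grid time takes countably many values, so each approximation is a countable case distinction.\<close>
  show ?thesis
  proof (rule borel_measurable_LIMSEQ_metric[where f="\<lambda>k (q, \<omega>). Y (T k q) \<omega>"])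
    fix k :: nat
    have "(\<lambda>z. (\<lambda>i z. Y (max 0 (min s ((of_int i + 1) / real (Suc k)))) (snd z))
             \<lfloor>real (Suc k) * c (fst z)\<rfloor> z) \<in> borel_measurable (borel \<Otimes>\<^sub>M N)"
    proof (rule measurable_compose_countable[where f="\<lambda>i z. Y (max 0 (min s ((of_int i + 1) / real (Suc k)))) (snd z)" and g="\<lambda>z. \<lfloor>real (Suc k) * c (fst z)\<rfloor>"])
      fix i :: int
      have [measurable]: "Y (max 0 (min s ((of_int i + 1) / real (Suc k)))) \<in> borel_measurable N"
        using s by (intro meas) auto
      show "(\<lambda>z. Y (max 0 (min s ((of_int i + 1) / real (Suc k)))) (snd z)) \<in> borel_measurable (borel \<Otimes>\<^sub>M N)"
        by measurable
    next
      show "(\<lambda>z. \<lfloor>real (Suc k) * c (fst z)\<rfloor>) \<in> (borel \<Otimes>\<^sub>M N) \<rightarrow>\<^sub>M count_space UNIV"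
        unfolding c_def by measurable
    qed
    then show "(\<lambda>(q, \<omega>). Y (T k q) \<omega>) \<in> borel_measurable (borel \<Otimes>\<^sub>M N)"
      by (simp add: T_def split_beta')
  next
    fix z assume "z \<in> space ((borel :: real measure) \<Otimes>\<^sub>M N)"
    then obtain q \<omega> where z: "z = (q, \<omega>)" "\<omega> \<in> space N" by (auto simp: space_pair_measure)
    have "(\<lambda>k. Y (T k q) \<omega>) \<longlonglongrightarrow> Y (c q) \<omega>"
    proof (cases "c q < s")
      case True
      have "filterlim (\<lambda>k. T k q) (at_right (c q)) sequentially"
        proof (unfold filterlim_at, intro conjI always_eventually allI)
        show "T k q \<in> {c q<..}" "T k q \<noteq> c q" for k
          using Tgt[OF True, of k] by auto
      qed (rule Tlim)
      from filterlim_compose[OF rc[OF z(2) c01(1) True] this] show ?thesis .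
    next
      case False
      then have "T k q = c q" for k using T01[of k q] Tge[of q k] c01[of q] by linarith
      then show ?thesis by simp
    qed
    then show "(\<lambda>k. case z of (q, \<omega>) \<Rightarrow> Y (T k q) \<omega>) \<longlonglongrightarrow> (case z of (q, \<omega>) \<Rightarrow> Y (max 0 (min q s)) \<omega>)"
      by (simp add: z c_def)
  qed
qed

lemma cadlag_right: "cadlag_on {0..} w \<Longrightarrow> 0 \<le> t \<Longrightarrow> (w \<longlongrightarrow> w t) (at_right t)"
  for w :: "real \<Rightarrow> 'a::topological_space"
proof -
  assume "cadlag_on {0..} w" "0 \<le> t"
  moreover from \<open>0 \<le> t\<close> have "{0..} \<inter> {t<..} = {t<..}" by auto
  ultimately show ?thesis unfolding cadlag_on_def by (metis atLeast_iff)
qed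

lemma at_left_nonneg: "0 < t \<Longrightarrow> at t within ({0..} \<inter> {..<t}) = at_left (t::real)"
  by (rule at_within_nhd[of _ "{0<..}"]) auto

definition left_lim :: "(real \<Rightarrow> 'a::t2_space) \<Rightarrow> real \<Rightarrow> 'a" where
  "left_lim w t = Lim (at_left t) w"

lemma cadlag_left:
  fixes w :: "real \<Rightarrow> 'a::t2_space"
  assumes "cadlag_on {0..} w" "0 < t"
  shows "(w \<longlongrightarrow> left_lim w t) (at_left t)"
proof -
  obtain l where "(w \<longlongrightarrow> l) (at_left t)"
    using assms at_left_nonneg[of t] unfolding cadlag_on_def by (metis atLeast_iff less_imp_le)
  moreover from this have "Lim (at_left t) w = l" by (intro tendsto_Lim) auto
  ultimately show ?thesis by (simp add: left_lim_def)
qed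

lemma left_lim_eqI: "(w \<longlongrightarrow> l) (at_left t) \<Longrightarrow> left_lim w t = l"
  unfolding left_lim_def by (intro tendsto_Lim) auto

text \<open>
Each time has a neighbourhood on which the path is bounded, by right continuity on one side and
the existence of a left limit on the other; compactness does the rest.
\<close>

lemma cadlag_bounded:
  fixes w :: "real \<Rightarrow> 'a::real_normed_vector"
  assumes "cadlag_on {0..} w"
  shows "bounded (w ` {0..t})"
proof -
  have *: "\<exists>U. open U \<and> q \<in> U \<and> bounded (w ` (U \<inter> {0..t}))" if q: "q \<in> {0..t}" for q
  proof -
    have "\<forall>\<^sub>F r in at_right q. dist (w r) (w q) < 1"
      using cadlag_right[OF assms, of q] q by (auto simp: tendsto_iff)
    then obtain b where b: "b > q" "\<And>r. q < r \<Longrightarrow> r < b \<Longrightarrow> dist (w r) (w q) < 1"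
      unfolding eventually_at_right_field by auto
    have "\<exists>a<q. \<exists>l. \<forall>r. a < r \<longrightarrow> r < q \<longrightarrow> 0 \<le> r \<longrightarrow> dist (w r) l < 1"
    proof (cases "q = 0")
      case True
      then show ?thesis by (intro exI[of _ "-1"]) auto
    next
      case False
      then have "\<forall>\<^sub>F r in at_left q. dist (w r) (left_lim w q) < 1"
        using cadlag_left[OF assms, of q] q by (auto simp: tendsto_iff)
      then obtain a where "a < q" "\<And>r. a < r \<Longrightarrow> r < q \<Longrightarrow> dist (w r) (left_lim w q) < 1"
        unfolding eventually_at_left_field by auto
      then show ?thesis by blast
    qed
    then obtain a l where a: "a < q" "\<And>r. a < r \<Longrightarrow> r < q \<Longrightarrow> 0 \<le> r \<Longrightarrow> dist (w r) l < 1" by blast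
    have "w ` ({a<..<b} \<inter> {0..t}) \<subseteq> ball l 1 \<union> ball (w q) 1"
    proof safe
      fix r assume "r \<in> {a<..<b}" "r \<in> {0..t}" "w r \<notin> ball (w q) 1"
      then show "w r \<in> ball l 1"
        using a(2)[of r] b(2)[of r] by (cases r q rule: linorder_cases) (auto simp: dist_commute)
    qed
    then have "bounded (w ` ({a<..<b} \<inter> {0..t}))"
      by (rule bounded_subset[rotated]) (simp add: bounded_Un)
    then show ?thesis using a(1) b(1) by (intro exI[of _ "{a<..<b}"]) auto
  qed
  then obtain U where U: "\<And>q. q \<in> {0..t} \<Longrightarrow> open (U q) \<and> q \<in> U q \<and> bounded (w ` (U q \<inter> {0..t}))"
    by metis
  have "compact {0..t}" by simp
  then obtain C where C: "C \<subseteq> {0..t}" "finite C" "{0..t} \<subseteq> (\<Union>c\<in>C. U c)"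
    using U by (elim compactE_image[of "{0..t}" "{0..t}" U]) auto
  have "w ` {0..t} \<subseteq> (\<Union>c\<in>C. w ` (U c \<inter> {0..t}))" using C(3) by blast
  moreover have "bounded (\<Union>c\<in>C. w ` (U c \<inter> {0..t}))"
    using C U by (intro bounded_UN) auto
  ultimately show ?thesis by (rule bounded_subset[rotated])
qed

text \<open>
A left limit inherits, up to closure, any bound that holds on an interval to its left. This is what
makes the function of left limits again regular: \<open>left_lim_left\<close> and \<open>left_lim_right\<close> follow.
\<close>

lemma left_lim_near:
  fixes w :: "real \<Rightarrow> 'a::metric_space"
  assumes "cadlag_on {0..} w" "0 \<le> a" "a < s" "s \<le> b" and "\<And>r. a < r \<Longrightarrow> r < b \<Longrightarrow> dist (w r) l < e"
  shows "dist (left_lim w s) l \<le> e"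
proof -
  have "(w \<longlongrightarrow> left_lim w s) (at_left s)" using cadlag_left[OF assms(1), of s] assms by auto
  then have "((\<lambda>r. dist (w r) l) \<longlongrightarrow> dist (left_lim w s) l) (at_left s)" by (intro tendsto_intros)
  moreover have "\<forall>\<^sub>F r in at_left s. dist (w r) l \<le> e"
    unfolding eventually_at_left_field using assms by (intro exI[of _ a]) (auto intro: less_imp_le)
  ultimately show ?thesis by (rule tendsto_upperbound) simp
qed

lemma left_lim_left:
  fixes w :: "real \<Rightarrow> 'a::metric_space"
  assumes "cadlag_on {0..} w" "0 < t"
  shows "(left_lim w \<longlongrightarrow> left_lim w t) (at_left t)"
proof (rule tendstoI)
  fix e :: real assume "e > 0"
  then have "\<forall>\<^sub>F r in at_left t. dist (w r) (left_lim w t) < e / 2"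
    using tendstoD[OF cadlag_left[OF assms], of "e / 2"] by simp
  then obtain a where a: "a < t" "\<And>r. a < r \<Longrightarrow> r < t \<Longrightarrow> dist (w r) (left_lim w t) < e / 2"
    unfolding eventually_at_left_field by auto
  have "dist (left_lim w s) (left_lim w t) < e" if "max a 0 < s" "s < t" for s
    using left_lim_near[of w "max a 0" s t "left_lim w t" "e/2", OF assms(1)] that a \<open>e > 0\<close> by auto
  then show "\<forall>\<^sub>F s in at_left t. dist (left_lim w s) (left_lim w t) < e"
    unfolding eventually_at_left_field using a assms by (intro exI[of _ "max a 0"]) auto
qed

lemma left_lim_right:
  fixes w :: "real \<Rightarrow> 'a::metric_space"
  assumes "cadlag_on {0..} w" "0 \<le> t"
  shows "(left_lim w \<longlongrightarrow> w t) (at_right t)"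
proof (rule tendstoI)
  fix e :: real assume "e > 0"
  then have "\<forall>\<^sub>F r in at_right t. dist (w r) (w t) < e / 2"
    using tendstoD[OF cadlag_right[OF assms], of "e / 2"] by simp
  then obtain b where b: "t < b" "\<And>r. t < r \<Longrightarrow> r < b \<Longrightarrow> dist (w r) (w t) < e / 2"
    unfolding eventually_at_right_field by auto
  have "dist (left_lim w s) (w t) < e" if "t < s" "s < b" for s
    using left_lim_near[of w t s b "w t" "e/2", OF assms(1)] that b assms \<open>e > 0\<close> by auto
  then show "\<forall>\<^sub>F s in at_right t. dist (left_lim w s) (w t) < e"
    unfolding eventually_at_right_field using b by (intro exI[of _ b]) auto
qed

lemma filterlim_uminus_at_right: "filterlim uminus (at_left (- t)) (at_right (t::real))"
  unfolding filterlim_at by (auto intro!: tendsto_intros simp: eventually_at_filter)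

lemma filterlim_uminus_at_left: "filterlim uminus (at_right (- t)) (at_left (t::real))"
  unfolding filterlim_at by (auto intro!: tendsto_intros simp: eventually_at_filter)

text \<open>
On the negative half-line the left limits of \<open>q\<close> are used, since reversing time turns left
continuity into right continuity.
\<close>

definition two_sided :: "(real \<Rightarrow> 'a) \<Rightarrow> (real \<Rightarrow> 'a::t2_space) \<Rightarrow> real \<Rightarrow> 'a" where
  "two_sided p q t = (if 0 \<le> t then p t else left_lim q (- t))"

lemma cadlag_two_sided:
  fixes p q :: "real \<Rightarrow> 'a::metric_space"
  assumes p: "cadlag_on {0..} p" and q: "cadlag_on {0..} q" and eq: "q 0 = p 0"
  shows "cadlag_on UNIV (two_sided p q)"
  unfolding cadlag_on_def
proof (intro ballI conjI)
  fix t :: real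
  show "(two_sided p q \<longlongrightarrow> two_sided p q t) (at t within UNIV \<inter> {t<..})"
  proof (cases "0 \<le> t")
    case True
    have "(p \<longlongrightarrow> two_sided p q t) (at_right t)"
      using cadlag_right[OF p True] True by (simp add: two_sided_def)
    moreover have "\<forall>\<^sub>F r in at_right t. p r = two_sided p q r"
      using True by (auto simp: eventually_at_filter two_sided_def)
    ultimately show ?thesis by (auto elim: Lim_transform_eventually)
  next
    case False
    have "((\<lambda>r. left_lim q (- r)) \<longlongrightarrow> left_lim q (- t)) (at_right t)"
      using filterlim_compose[OF left_lim_left[OF q, of "- t"] filterlim_uminus_at_right] False by simp
    moreover have "\<forall>\<^sub>F r in at_right t. left_lim q (- r) = two_sided p q r"
      unfolding eventually_at_right_field using False by (intro exI[of _ 0]) (auto simp: two_sided_def)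
    ultimately show ?thesis using False by (auto elim!: Lim_transform_eventually simp: two_sided_def)
  qed
  show "\<exists>l. (two_sided p q \<longlongrightarrow> l) (at t within UNIV \<inter> {..<t})"
  proof (cases "0 < t")
    case True
    have "\<forall>\<^sub>F r in at_left t. p r = two_sided p q r"
      unfolding eventually_at_left_field using True by (intro exI[of _ 0]) (auto simp: two_sided_def)
    with cadlag_left[OF p True] show ?thesis by (auto elim!: Lim_transform_eventually)
  next
    case False
    have "((\<lambda>r. left_lim q (- r)) \<longlongrightarrow> q (- t)) (at_left t)"
      using filterlim_compose[OF left_lim_right[OF q, of "- t"] filterlim_uminus_at_left] False by simp
    moreover have "\<forall>\<^sub>F r in at_left t. left_lim q (- r) = two_sided p q r"
      using False by (auto simp: eventually_at_filter two_sided_def)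
    ultimately show ?thesis by (auto elim!: Lim_transform_eventually)
  qed
qed

text \<open>
The segment \<open>p n\<close> is used on \<open>[n, n + 1)\<close> and is displaced by \<open>y n\<close>.
\<close>

definition concat_path :: "(nat \<Rightarrow> 'a::real_normed_vector) \<Rightarrow> (nat \<Rightarrow> real \<Rightarrow> 'a) \<Rightarrow> real \<Rightarrow> 'a" where
  "concat_path y p t = y (nat \<lfloor>t\<rfloor>) + p (nat \<lfloor>t\<rfloor>) (t - real (nat \<lfloor>t\<rfloor>))"

lemma concat_path_eq:
  "real n \<le> t \<Longrightarrow> t < real n + 1 \<Longrightarrow> concat_path y p t = y n + p n (t - real n)"
proof -
  assume "real n \<le> t" "t < real n + 1"
  then have "nat \<lfloor>t\<rfloor> = n" by (simp add: floor_eq_iff nat_eq_iff)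
  then show ?thesis by (simp add: concat_path_def)
qed

lemma filterlim_minus_at_right: "filterlim (\<lambda>r. r - c) (at_right (t - c)) (at_right (t::real))"
  unfolding filterlim_at by (auto intro!: tendsto_intros simp: eventually_at_filter)

lemma filterlim_minus_at_left: "filterlim (\<lambda>r. r - c) (at_left (t - c)) (at_left (t::real))"
  unfolding filterlim_at by (auto intro!: tendsto_intros simp: eventually_at_filter)

lemma tendsto_concat_path_left:
  assumes "real n < t" "t \<le> real n + 1" "(p n \<longlongrightarrow> l) (at_left (t - real n))"
  shows "(concat_path y p \<longlongrightarrow> y n + l) (at_left t)"
proof -
  have "((\<lambda>r. y n + p n (r - real n)) \<longlongrightarrow> y n + l) (at_left t)"
    by (intro tendsto_intros filterlim_compose[OF assms(3) filterlim_minus_at_left])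
  moreover have "\<forall>\<^sub>F r in at_left t. y n + p n (r - real n) = concat_path y p r"
    unfolding eventually_at_left_field using assms
    by (intro exI[of _ "real n"] conjI allI impI) (auto intro!: concat_path_eq[symmetric])
  ultimately show ?thesis by (auto elim: Lim_transform_eventually)
qed

lemma cadlag_concat_path:
  fixes p :: "nat \<Rightarrow> real \<Rightarrow> 'a::real_normed_vector"
  assumes p: "\<And>n. cadlag_on {0..} (p n)"
  shows "cadlag_on {0..} (concat_path y p)"
  unfolding cadlag_on_def
proof (intro ballI conjI)
  fix t :: real assume t: "t \<in> {0..}"
  define n where "n = nat \<lfloor>t\<rfloor>"
  have n: "real n \<le> t" "t < real n + 1" using t by (auto simp: n_def)
  have "{0..} \<inter> {t<..} = {t<..}" using t by auto
  moreover have "((\<lambda>r. y n + p n (r - real n)) \<longlongrightarrow> y n + p n (t - real n)) (at_right t)"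
    using n by (intro tendsto_intros filterlim_compose[OF cadlag_right[OF p] filterlim_minus_at_right]) auto
  moreover have "\<forall>\<^sub>F r in at_right t. y n + p n (r - real n) = concat_path y p r"
    unfolding eventually_at_right_field using n
    by (intro exI[of _ "real n + 1"] conjI allI impI) (auto intro!: concat_path_eq[symmetric])
  ultimately show "(concat_path y p \<longlongrightarrow> concat_path y p t) (at t within {0..} \<inter> {t<..})"
    unfolding concat_path_eq[OF n] by (metis Lim_transform_eventually)
  show "\<exists>l. (concat_path y p \<longlongrightarrow> l) (at t within {0..} \<inter> {..<t})"
  proof (cases "t = 0")
    case True
    then have "{0..} \<inter> {..<t} = {}" by auto
    then show ?thesis by simp
  next
    case False
    define m where "m = nat (\<lceil>t\<rceil> - 1)"
    have m: "real m < t" "t \<le> real m + 1"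
    proof -
      have "\<lceil>t\<rceil> \<ge> 1" using False t by (simp add: one_le_ceiling)
      then have "real m = of_int \<lceil>t\<rceil> - 1" by (simp add: m_def)
      then show "real m < t" "t \<le> real m + 1" by linarith+
    qed
    then have "(p m \<longlongrightarrow> left_lim (p m) (t - real m)) (at_left (t - real m))"
      by (intro cadlag_left[OF p]) auto
    from tendsto_concat_path_left[where p=p and y=y, OF m this] show ?thesis
      using False t by (auto simp: at_left_nonneg)
  qed
qed

section \<open>Levy processes and their Markov property\<close>

lemma space_process_sigma [simp]: "space (process_sigma S Y I) = S"
  unfolding process_sigma_def by (rule space_measure_of) auto

lemma sets_process_sigma:
  "sets (process_sigma S Y I) = sigma_sets S {{\<omega> \<in> S. Y s \<omega> \<in> A} | s A. s \<in> I \<and> A \<in> sets borel}"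
  unfolding process_sigma_def by (rule sets_measure_of) auto

lemma measurable_process_sigma_component:
  "s \<in> I \<Longrightarrow> Y s \<in> borel_measurable (process_sigma S Y I)"
  by (rule measurableI)
     (auto simp: sets_process_sigma vimage_def Int_def conj_commute intro!: sigma_sets.Basic)

lemma measurable_process_sigma:
  assumes "\<And>\<omega>. \<omega> \<in> space N \<Longrightarrow> f \<omega> \<in> S" "\<And>s. s \<in> I \<Longrightarrow> (\<lambda>\<omega>. Y s (f \<omega>)) \<in> borel_measurable N"
  shows "f \<in> N \<rightarrow>\<^sub>M process_sigma S Y I"
  unfolding process_sigma_def
proof (rule measurable_measure_of)
  fix B assume "B \<in> {{\<omega> \<in> S. Y s \<omega> \<in> A} | s A. s \<in> I \<and> A \<in> sets borel}"
  then obtain s A where B: "B = {\<omega> \<in> S. Y s \<omega> \<in> A}" "s \<in> I" "A \<in> sets borel" by auto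
  then have "f -` B \<inter> space N = (\<lambda>\<omega>. Y s (f \<omega>)) -` A \<inter> space N" using assms(1) by auto
  then show "f -` B \<inter> space N \<in> sets N" using B(3) measurable_sets[OF assms(2)[OF B(2)]] by simp
qed (use assms in auto)

text \<open>
Minimality of the generated \<open>\<sigma>\<close>-field, in the form in which it is used throughout.
\<close>

lemma sets_process_sigma_subset:
  assumes "space N = S" "\<And>s. s \<in> I \<Longrightarrow> Y s \<in> borel_measurable N"
  shows "sets (process_sigma S Y I) \<subseteq> sets N"
proof -
  have "(\<lambda>\<omega>. \<omega>) \<in> N \<rightarrow>\<^sub>M process_sigma S Y I"
    using assms by (intro measurable_process_sigma) auto
  then show ?thesis
    using assms(1) by (auto dest!: measurable_sets simp: sets.sets_into_space[THEN Int_absorb2]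
        dest: sets.sets_into_space)
       (metis Int_absorb2 sets.sets_into_space space_process_sigma)
qed

lemma process_sigma_mono: "I \<subseteq> J \<Longrightarrow> sets (process_sigma S Y I) \<subseteq> sets (process_sigma S Y J)"
  by (intro sets_process_sigma_subset) (auto intro: measurable_process_sigma_component)

text \<open>
If \<open>T\<close> is independent of \<open>G\<close> and \<open>T'\<close> has the same law as \<open>T\<close>, then \<open>T\<close> may be replaced by an
independent copy of \<open>T'\<close>: both sides integrate \<open>H\<close> against the product of the two laws.
\<close>

lemma (in prob_space) nn_integral_independent:
  assumes sub: "subalgebra M G"
    and [measurable]: "T \<in> M \<rightarrow>\<^sub>M N" "T' \<in> M \<rightarrow>\<^sub>M N"
    and indep: "\<And>A B. A \<in> sets G \<Longrightarrow> B \<in> sets N \<Longrightarrow>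
        emeasure M (A \<inter> (T -` B \<inter> space M)) = emeasure M A * emeasure M (T' -` B \<inter> space M)"
    and H: "H \<in> borel_measurable (G \<Otimes>\<^sub>M N)"
  shows "(\<integral>\<^sup>+\<omega>. H (\<omega>, T \<omega>) \<partial>M) = (\<integral>\<^sup>+\<omega>. (\<integral>\<^sup>+\<omega>'. H (\<omega>, T' \<omega>') \<partial>M) \<partial>M)"
proof -
  let ?G = "restr_to_subalg M G"
  have setsG[measurable_cong]: "sets ?G = sets G" and spG: "space ?G = space M" "space G = space M"
    using sub by (auto simp: sets_restr_to_subalg space_restr_to_subalg subalgebra_def)
  have [measurable]: "(\<lambda>\<omega>. \<omega>) \<in> M \<rightarrow>\<^sub>M G"
    using sub by (auto intro!: measurableI simp: subalgebra_def sets.sets_into_space Int_absorb2 subset_eq)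
  have H'[measurable]: "H \<in> borel_measurable (?G \<Otimes>\<^sub>M N)"
    using H by (simp add: measurable_cong_sets[OF sets_pair_measure_cong[OF setsG refl] refl])
  note H[measurable]
  interpret G: prob_space ?G
    by (rule prob_spaceI) (use sub in \<open>simp add: emeasure_restr_to_subalg spG subalgebra_def emeasure_space_1\<close>, 
        metis emeasure_restr_to_subalg[OF sub] emeasure_space_1 sets.top spG(2))
  interpret T': prob_space "distr M N T'" by (rule prob_space_distr) simp
  have eq: "?G \<Otimes>\<^sub>M distr M N T' = distr M (G \<Otimes>\<^sub>M N) (\<lambda>\<omega>. (\<omega>, T \<omega>))"
  proof (rule pair_measure_eqI)
    show "sigma_finite_measure ?G" "sigma_finite_measure (distr M N T')" by unfold_locales
    show "sets (?G \<Otimes>\<^sub>M distr M N T') = sets (distr M (G \<Otimes>\<^sub>M N) (\<lambda>\<omega>. (\<omega>, T \<omega>)))"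
      using setsG by (simp cong: sets_pair_measure_cong)
    fix A B assume A: "A \<in> sets ?G" and B: "B \<in> sets (distr M N T')"
    then have A': "A \<in> sets G" and B': "B \<in> sets N" using setsG by auto
    then have "A \<subseteq> space M" using spG sets.sets_into_space by metis
    then have *: "(\<lambda>\<omega>. (\<omega>, T \<omega>)) -` (A \<times> B) \<inter> space M = A \<inter> (T -` B \<inter> space M)" by auto
    show "emeasure ?G A * emeasure (distr M N T') B = emeasure (distr M (G \<Otimes>\<^sub>M N) (\<lambda>\<omega>. (\<omega>, T \<omega>))) (A \<times> B)"
      using A' B' by (simp add: emeasure_distr * indep emeasure_restr_to_subalg[OF sub])
  qed
  have "(\<integral>\<^sup>+\<omega>. H (\<omega>, T \<omega>) \<partial>M) = (\<integral>\<^sup>+z. H z \<partial>distr M (G \<Otimes>\<^sub>M N) (\<lambda>\<omega>. (\<omega>, T \<omega>)))"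
    by (subst nn_integral_distr) auto
  also have "\<dots> = (\<integral>\<^sup>+\<omega>. (\<integral>\<^sup>+p. H (\<omega>, p) \<partial>distr M N T') \<partial>?G)"
    unfolding eq[symmetric] by (subst T'.nn_integral_fst[symmetric]) auto
  also have "\<dots> = (\<integral>\<^sup>+\<omega>. (\<integral>\<^sup>+p. H (\<omega>, p) \<partial>distr M N T') \<partial>M)"
    by (rule nn_integral_subalgebra2[OF sub]) measurable
  also have "\<dots> = (\<integral>\<^sup>+\<omega>. (\<integral>\<^sup>+\<omega>'. H (\<omega>, T' \<omega>') \<partial>M) \<partial>M)"
    by (intro nn_integral_cong, subst nn_integral_distr) (auto simp: spG intro: measurable_compose_Pair1)
  finally show ?thesis .
qed

text \<open>
The space carries the increments of a process after a fixed time, which is why its paths start at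
0. Regularity of the paths is part of the space because additive functionals such as
\<open>\<integral>\<^sub>0\<^sup>t W(p\<^sub>s) ds\<close> are not measurable on the space of all functions.
\<close>

definition path_space0 :: "(real \<Rightarrow> 'a::euclidean_space) measure" where
  "path_space0 = process_sigma {w. cadlag_on {0..} w \<and> w 0 = 0} (\<lambda>t w. w t) {0..}"

definition shift_increments :: "real \<Rightarrow> (real \<Rightarrow> 'a::ab_group_add) \<Rightarrow> real \<Rightarrow> 'a" where
  "shift_increments s w t = w (s + t) - w s"

lemma measurable_path_space0_component:
  "0 \<le> t \<Longrightarrow> (\<lambda>w. w t) \<in> borel_measurable path_space0"
  unfolding path_space0_def by (rule measurable_process_sigma_component) auto

text \<open>
Including the time 0 in every cylinder costs nothing and gives each cylinder a latest and an
earliest time.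
\<close>

lemma path_space0_generator:
  fixes Om defines "Om \<equiv> {w::real \<Rightarrow> 'a::euclidean_space. cadlag_on {0..} w \<and> w 0 = 0}"
  defines "E \<equiv> {{w\<in>Om. \<forall>j\<in>J. w j \<in> A j} | J A. finite J \<and> J \<subseteq> {0..} \<and> 0 \<in> J \<and> (\<forall>j. A j \<in> sets borel)}"
  shows "Int_stable E" "sets path_space0 = sigma_sets Om E" "E \<subseteq> Pow Om" "Om \<in> E"
proof -
  show "Int_stable E"
    unfolding Int_stable_def
  proof (intro ballI)
    fix a b assume "a \<in> E" "b \<in> E"
    then obtain J A J' A' where a: "a = {w\<in>Om. \<forall>j\<in>J. w j \<in> A j}" "finite J" "J \<subseteq> {0..}" "0 \<in> J" "\<And>j. A j \<in> sets borel"
      and b: "b = {w\<in>Om. \<forall>j\<in>J'. w j \<in> A' j}" "finite J'" "J' \<subseteq> {0..}" "0 \<in> J'" "\<And>j. A' j \<in> sets borel"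
      unfolding E_def by blast
    define A'' where "A'' j = (if j \<in> J then A j else UNIV) \<inter> (if j \<in> J' then A' j else UNIV)" for j
    have "a \<inter> b = {w\<in>Om. \<forall>j\<in>J \<union> J'. w j \<in> A'' j}"
      unfolding a b A''_def by (auto split: if_splits)
    then show "a \<inter> b \<in> E"
      unfolding E_def using a b by (intro CollectI exI[of _ "J \<union> J'"] exI[of _ A'']) (auto simp: A''_def)
  qed
  show "E \<subseteq> Pow Om" by (auto simp: E_def)
  show "Om \<in> E"
    unfolding E_def by (intro CollectI exI[of _ "{0}"] exI[of _ "\<lambda>_. UNIV"]) auto
  show "sets path_space0 = sigma_sets Om E"
    unfolding path_space0_def sets_process_sigma Om_def[symmetric]
  proof (rule sigma_sets_eqI)
    fix a assume "a \<in> {{\<omega> \<in> Om. \<omega> s \<in> A} |s A. s \<in> {0..} \<and> A \<in> sets borel}"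
    then obtain s A where a: "a = {\<omega> \<in> Om. \<omega> s \<in> A}" "0 \<le> s" "A \<in> sets borel" by auto
    have "a \<in> E"
      unfolding E_def using a
      by (intro CollectI exI[of _ "{0, s}"] exI[of _ "\<lambda>j. if j = s then A else UNIV"]) auto
    then show "a \<in> sigma_sets Om E" by auto
  next
    let ?S = "sigma_sets Om {{\<omega> \<in> Om. \<omega> s \<in> A} |s A. s \<in> {0..} \<and> A \<in> sets borel}"
    fix b assume "b \<in> E"
    then obtain J A where b: "b = {w\<in>Om. \<forall>j\<in>J. w j \<in> A j}" "finite J" "J \<subseteq> {0..}" "0 \<in> J" "\<And>j. A j \<in> sets borel"
      unfolding E_def by blast
    interpret sigma_algebra Om ?S by (rule sigma_algebra_sigma_sets) auto
    have "b = (\<Inter>j\<in>J. {w\<in>Om. w j \<in> A j})" using b by auto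
    also have "\<dots> \<in> ?S"
      using b by (intro finite_INT) (auto intro!: sigma_sets.Basic)
    finally show "b \<in> ?S" .
  qed
qed

text \<open>
The process starts at 0 for every \<open>\<omega>\<close>, so that the concatenated paths below agree with their segments
also at integer times; \<open>levy_process_start_zero\<close> reduces the general case to this one.
\<close>

locale levy = prob_space M for M :: "'w measure" +
  fixes X :: "real \<Rightarrow> 'w \<Rightarrow> 'a::euclidean_space"
  assumes levy: "levy_process M X" and X0: "\<And>\<omega>. \<omega> \<in> space M \<Longrightarrow> X 0 \<omega> = 0"
begin

definition past :: "real \<Rightarrow> 'w measure" where
  "past s = process_sigma (space M) X {0..s}"

lemma X_measurable [measurable]: "0 \<le> t \<Longrightarrow> X t \<in> borel_measurable M"
  using levy by (simp add: levy_process_def)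

lemma cadlag_X: "\<omega> \<in> space M \<Longrightarrow> cadlag_on {0..} (\<lambda>t. X t \<omega>)"
  using levy by (simp add: levy_process_def)

lemma space_past [simp]: "space (past s) = space M"
  by (simp add: past_def)

lemma X_past: "0 \<le> r \<Longrightarrow> r \<le> s \<Longrightarrow> X r \<in> borel_measurable (past s)"
  unfolding past_def by (intro measurable_process_sigma_component) auto

lemma sets_past_subset: "sets (past s) \<subseteq> sets M"
  unfolding past_def by (intro sets_process_sigma_subset) auto

lemma past_mono: "s \<le> t \<Longrightarrow> sets (past s) \<subseteq> sets (past t)"
  unfolding past_def by (intro process_sigma_mono) auto

lemma subalgebra_past: "subalgebra M (past s)"
  using sets_past_subset by (simp add: subalgebra_def)

lemma subalgebra_past_mono: "s \<le> t \<Longrightarrow> subalgebra (past t) (past s)"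
  using past_mono by (simp add: subalgebra_def)

lemma measurable_past_M: "f \<in> borel_measurable (past s) \<Longrightarrow> f \<in> borel_measurable M"
  using measurable_from_subalg[OF subalgebra_past] .

lemma measurable_past_mono: "s \<le> t \<Longrightarrow> f \<in> borel_measurable (past s) \<Longrightarrow> f \<in> borel_measurable (past t)"
  using measurable_from_subalg[OF subalgebra_past_mono] .

text \<open>
The defining independence of one increment from the past, with a functional of both.
\<close>

lemma increment_independent:
  assumes st: "0 \<le> s" "s \<le> t" and H: "H \<in> borel_measurable (past s \<Otimes>\<^sub>M borel)"
  shows "(\<integral>\<^sup>+\<omega>. H (\<omega>, X t \<omega> - X s \<omega>) \<partial>M) = (\<integral>\<^sup>+\<omega>. (\<integral>\<^sup>+\<omega>'. H (\<omega>, X (t - s) \<omega>') \<partial>M) \<partial>M)"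
proof (rule nn_integral_independent[OF subalgebra_past _ _ _ H])
  have [measurable]: "(\<lambda>\<omega>. X t \<omega> - X s \<omega>) \<in> borel_measurable M" "X (t - s) \<in> borel_measurable M"
    using st by auto
  show "(\<lambda>\<omega>. X t \<omega> - X s \<omega>) \<in> borel_measurable M" "X (t - s) \<in> borel_measurable M" by simp_all
  fix A and B :: "'a set" assume A: "A \<in> sets (past s)" and B: "B \<in> sets borel"
  let ?D = "\<lambda>\<omega>. X t \<omega> - X s \<omega>"
  have "indep_set (sets (past s)) (sets (vimage_algebra (space M) ?D borel))"
    using levy st unfolding levy_process_def past_def by blast
  from indep_setD[OF this A, of "?D -` B \<inter> space M"] B
  have "prob (A \<inter> (?D -` B \<inter> space M)) = prob A * prob (?D -` B \<inter> space M)"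
    by (auto intro: in_vimage_algebra)
  moreover have "prob (?D -` B \<inter> space M) = prob (X (t - s) -` B \<inter> space M)"
  proof -
    have "distr M borel ?D = distr M borel (X (t - s))"
      using levy st unfolding levy_process_def by blast
    from arg_cong[OF this, of "\<lambda>N. measure N B"] show ?thesis
      using B by (simp add: measure_distr)
  qed
  ultimately show "emeasure M (A \<inter> (?D -` B \<inter> space M)) = emeasure M A * emeasure M (X (t - s) -` B \<inter> space M)"
    by (simp add: emeasure_eq_measure ennreal_mult)
qed

text \<open>
The process observed from time \<open>s\<close> on at finitely many times is independent of the past and
distributed like the original one. The induction removes the latest time: its increment is
independent of everything before, so integrating it out modifies only the factor at the preceding
time, and both sides change in the same way.
\<close>

lemma cylinder_independent:
  assumes "finite A" "A \<subseteq> {0<..}" "0 \<le> s"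
    and "F \<in> borel_measurable (past s)" "\<And>j. g j \<in> borel_measurable borel"
  shows "(\<integral>\<^sup>+\<omega>. F \<omega> * (\<Prod>j\<in>insert 0 A. g j (X (s + j) \<omega> - X s \<omega>)) \<partial>M)
       = (\<integral>\<^sup>+\<omega>. F \<omega> \<partial>M) * (\<integral>\<^sup>+\<omega>. (\<Prod>j\<in>insert 0 A. g j (X j \<omega>)) \<partial>M)"
  using assms
proof (induction A arbitrary: g rule: finite_linorder_max_induct)
  case empty
  note [measurable] = measurable_past_M[OF empty(3)] and empty(4)[measurable]
  have "(\<integral>\<^sup>+\<omega>. F \<omega> * g 0 0 \<partial>M) = (\<integral>\<^sup>+\<omega>. F \<omega> \<partial>M) * g 0 0"
    by (rule nn_integral_multc) measurable
  moreover have "(\<integral>\<^sup>+\<omega>. g 0 (X 0 \<omega>) \<partial>M) = (\<integral>\<^sup>+\<omega>. g 0 0 \<partial>M)"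
    by (intro nn_integral_cong) (simp add: X0)
  ultimately show ?case by (simp add: emeasure_space_1)
next
  case (insert b A)
  define m where "m = Max (insert 0 A)"
  have fin: "finite (insert 0 A)" using insert by simp
  have m: "0 \<le> m" "m \<in> insert 0 A" "\<And>j. j \<in> insert 0 A \<Longrightarrow> j \<le> m"
    using fin Max_in[OF fin] Max_ge[OF fin] by (auto simp: m_def)
  have b: "m < b" "b \<notin> insert 0 A" using m(2) insert by auto
  have pos: "\<And>j. j \<in> insert 0 A \<Longrightarrow> 0 \<le> j" using insert.prems by (auto intro: less_imp_le)
  note g[measurable] = insert.prems(4)
  have [measurable]: "X (b - m) \<in> borel_measurable M" using b by simp
  define h where "h y = (\<integral>\<^sup>+\<omega>'. g b (y + X (b - m) \<omega>') \<partial>M)" for y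
  have [measurable]: "h \<in> borel_measurable borel" unfolding h_def by measurable
  define g' where "g' = g(m := \<lambda>y. g m y * h y)"
  \<comment> \<open>Integrating out the last increment replaces the factor at the last time by a factor at the
    time before.\<close>
  have peel: "(\<integral>\<^sup>+\<omega>. G \<omega> * (\<Prod>j\<in>insert 0 (insert b A). g j (X (r + j) \<omega> - X r \<omega>)) \<partial>M)
      = (\<integral>\<^sup>+\<omega>. G \<omega> * (\<Prod>j\<in>insert 0 A. g' j (X (r + j) \<omega> - X r \<omega>)) \<partial>M)"
    if r: "0 \<le> r" and G: "G \<in> borel_measurable (past r)" for r and G :: "'w \<Rightarrow> ennreal"
  proof -
    have [measurable]: "X (r + j) \<in> borel_measurable (past (r + m))" if "j \<in> insert 0 A" for j
      using m(3)[OF that] pos[OF that] r by (intro X_past) auto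
    have [measurable]: "X r \<in> borel_measurable (past (r + m))" using r m by (intro X_past) auto
    have [measurable]: "X (r + m) \<in> borel_measurable (past (r + m))" using r m by (intro X_past) auto
    have [measurable]: "G \<in> borel_measurable (past (r + m))"
      using m G by (intro measurable_past_mono[of r "r + m"]) auto
    let ?P = "\<lambda>\<omega>. G \<omega> * (\<Prod>j\<in>insert 0 A. g j (X (r + j) \<omega> - X r \<omega>))"
    have [measurable]: "?P \<in> borel_measurable (past (r + m))"
      by (intro borel_measurable_times_ennreal borel_measurable_prod_ennreal) measurable
    have "(\<integral>\<^sup>+\<omega>. G \<omega> * (\<Prod>j\<in>insert 0 (insert b A). g j (X (r + j) \<omega> - X r \<omega>)) \<partial>M)
        = (\<integral>\<^sup>+\<omega>. (\<lambda>(\<omega>, z). ?P \<omega> * g b (X (r + m) \<omega> - X r \<omega> + z)) (\<omega>, X (r + b) \<omega> - X (r + m) \<omega>) \<partial>M)"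
      using b fin by (intro nn_integral_cong) (simp add: insert_commute[of 0] mult.assoc mult.left_commute mult.commute[of "g b _"])
    also have "\<dots> = (\<integral>\<^sup>+\<omega>. (\<integral>\<^sup>+\<omega>'. (\<lambda>(\<omega>, z). ?P \<omega> * g b (X (r + m) \<omega> - X r \<omega> + z)) (\<omega>, X (r + b - (r + m)) \<omega>') \<partial>M) \<partial>M)"
      using r m b by (intro increment_independent) auto
    also have "\<dots> = (\<integral>\<^sup>+\<omega>. ?P \<omega> * h (X (r + m) \<omega> - X r \<omega>) \<partial>M)"
      unfolding h_def by (intro nn_integral_cong) (simp add: nn_integral_cmult)
    also have "\<dots> = (\<integral>\<^sup>+\<omega>. G \<omega> * (\<Prod>j\<in>insert 0 A. g' j (X (r + j) \<omega> - X r \<omega>)) \<partial>M)"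
      by (intro nn_integral_cong, subst (1 2) prod.remove[OF fin m(2)]) (simp add: g'_def ac_simps)
    finally show ?thesis .
  qed
  have [measurable]: "g' j \<in> borel_measurable borel" for j unfolding g'_def by auto
  have one: "(\<integral>\<^sup>+\<omega>. 1 * (\<Prod>j\<in>J. k j (X (0 + j) \<omega> - X 0 \<omega>)) \<partial>M) = (\<integral>\<^sup>+\<omega>. (\<Prod>j\<in>J. k j (X j \<omega>)) \<partial>M)"
    for J and k :: "real \<Rightarrow> 'a \<Rightarrow> ennreal"
    by (intro nn_integral_cong) (simp add: X0)
  have "(\<integral>\<^sup>+\<omega>. F \<omega> * (\<Prod>j\<in>insert 0 A. g' j (X (s + j) \<omega> - X s \<omega>)) \<partial>M)
       = (\<integral>\<^sup>+\<omega>. F \<omega> \<partial>M) * (\<integral>\<^sup>+\<omega>. (\<Prod>j\<in>insert 0 A. g' j (X j \<omega>)) \<partial>M)"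
    using insert.prems by (intro insert.IH) auto
  also have "(\<integral>\<^sup>+\<omega>. (\<Prod>j\<in>insert 0 A. g' j (X j \<omega>)) \<partial>M) = (\<integral>\<^sup>+\<omega>. (\<Prod>j\<in>insert 0 (insert b A). g j (X j \<omega>)) \<partial>M)"
    using peel[of 0 "\<lambda>_. 1"] by (simp only: one) simp
  finally show ?case using peel[OF insert.prems(2,3)] by simp
qed

lemma shift_increments_measurable [measurable]:
  assumes s: "0 \<le> s"
  shows "(\<lambda>\<omega>. shift_increments s (\<lambda>t. X t \<omega>)) \<in> M \<rightarrow>\<^sub>M path_space0"
  unfolding path_space0_def
proof (rule measurable_process_sigma)
  fix \<omega> assume \<omega>: "\<omega> \<in> space M"
  have "cadlag_on {0..} (shift_increments s (\<lambda>t. X t \<omega>))"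
    unfolding cadlag_on_def
  proof (intro ballI conjI)
    fix t :: real assume t: "t \<in> {0..}"
    have "filterlim (\<lambda>r. s + r) (at_right (s + t)) (at_right t)"
      unfolding filterlim_at by (auto intro!: tendsto_intros simp: eventually_at_filter)
    from filterlim_compose[OF cadlag_right[OF cadlag_X[OF \<omega>]] this] s t
    have "(shift_increments s (\<lambda>t. X t \<omega>) \<longlongrightarrow> shift_increments s (\<lambda>t. X t \<omega>) t) (at_right t)"
      unfolding shift_increments_def by (intro tendsto_intros) auto
    moreover have "{0..} \<inter> {t<..} = {t<..}" using t by auto
    ultimately show "(shift_increments s (\<lambda>t. X t \<omega>) \<longlongrightarrow> shift_increments s (\<lambda>t. X t \<omega>) t) (at t within {0..} \<inter> {t<..})"
      by simp
    show "\<exists>l. (shift_increments s (\<lambda>t. X t \<omega>) \<longlongrightarrow> l) (at t within {0..} \<inter> {..<t})"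
    proof (cases "t = 0")
      case True
      then have "{0..} \<inter> {..<t} = {}" by auto
      then show ?thesis by simp
    next
      case False
      have "filterlim (\<lambda>r. s + r) (at_left (s + t)) (at_left t)"
        unfolding filterlim_at by (auto intro!: tendsto_intros simp: eventually_at_filter)
      from filterlim_compose[OF cadlag_left[OF cadlag_X[OF \<omega>]] this] s t False
      have "(shift_increments s (\<lambda>t. X t \<omega>) \<longlongrightarrow> left_lim (\<lambda>t. X t \<omega>) (s + t) - X s \<omega>) (at_left t)"
        unfolding shift_increments_def by (intro tendsto_intros) auto
      then show ?thesis using False t by (auto simp: at_left_nonneg)
    qed
  qed
  then show "shift_increments s (\<lambda>t. X t \<omega>) \<in> {w. cadlag_on {0..} w \<and> w 0 = 0}"
    by (simp add: shift_increments_def)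
next
  fix t :: real assume "t \<in> {0..}"
  then have "X (s + t) \<in> borel_measurable M" "X s \<in> borel_measurable M" using s by auto
  then show "(\<lambda>\<omega>. shift_increments s (\<lambda>t. X t \<omega>) t) \<in> borel_measurable M"
    by (simp add: shift_increments_def)
qed

lemma path_measurable [measurable]: "(\<lambda>\<omega> t. X t \<omega>) \<in> M \<rightarrow>\<^sub>M path_space0"
  unfolding path_space0_def
  by (rule measurable_process_sigma) (auto simp: cadlag_X X0)

text \<open>
Cylinders form a generator of the path space that is stable under intersections, so the
independence of finitely many increments extends to the whole shifted path.
\<close>

lemma shifted_path_independent:
  assumes s: "0 \<le> s" and H: "H \<in> borel_measurable (past s \<Otimes>\<^sub>M path_space0)"
  shows "(\<integral>\<^sup>+\<omega>. H (\<omega>, shift_increments s (\<lambda>t. X t \<omega>)) \<partial>M)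
       = (\<integral>\<^sup>+\<omega>. (\<integral>\<^sup>+\<omega>'. H (\<omega>, \<lambda>t. X t \<omega>') \<partial>M) \<partial>M)"
proof (rule nn_integral_independent[OF subalgebra_past _ _ _ H])
  show "(\<lambda>\<omega>. shift_increments s (\<lambda>t. X t \<omega>)) \<in> M \<rightarrow>\<^sub>M path_space0"
    "(\<lambda>\<omega> t. X t \<omega>) \<in> M \<rightarrow>\<^sub>M path_space0" using s by measurable
  let ?Om = "{w::real \<Rightarrow> 'a. cadlag_on {0..} w \<and> w 0 = 0}"
  let ?E = "{{w\<in>?Om. \<forall>j\<in>J. w j \<in> A j} | J A. finite J \<and> J \<subseteq> {0..} \<and> 0 \<in> J \<and> (\<forall>j. A j \<in> sets borel)}"
  note gen = path_space0_generator[where 'a='a]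
  fix A and B :: "(real \<Rightarrow> 'a) set" assume A: "A \<in> sets (past s)" and B: "B \<in> sets path_space0"
  let ?\<theta> = "\<lambda>\<omega>. shift_increments s (\<lambda>t. X t \<omega>)"
  have AM[measurable]: "A \<in> sets M" using A sets_past_subset by auto
  define \<mu>1 where "\<mu>1 = distr (density M (indicator A)) path_space0 ?\<theta>"
  define \<mu>2 where "\<mu>2 = scale_measure (emeasure M A) (distr M path_space0 (\<lambda>\<omega> t. X t \<omega>))"
  have em1: "emeasure \<mu>1 C = emeasure M (A \<inter> (?\<theta> -` C \<inter> space M))" if C: "C \<in> sets path_space0" for C
  proof -
    have [measurable]: "?\<theta> -` C \<inter> space M \<in> sets M" using C s by measurable
    have "emeasure \<mu>1 C = (\<integral>\<^sup>+\<omega>. indicator A \<omega> * indicator (?\<theta> -` C \<inter> space M) \<omega> \<partial>M)"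
      unfolding \<mu>1_def using C s by (simp add: emeasure_distr emeasure_density)
    also have "\<dots> = (\<integral>\<^sup>+\<omega>. indicator (A \<inter> (?\<theta> -` C \<inter> space M)) \<omega> \<partial>M)"
      by (intro nn_integral_cong) (auto split: split_indicator)
    finally show ?thesis by simp
  qed
  have em2: "emeasure \<mu>2 C = emeasure M A * emeasure M ((\<lambda>\<omega> t. X t \<omega>) -` C \<inter> space M)" if C: "C \<in> sets path_space0" for C
    unfolding \<mu>2_def using C by (simp add: emeasure_distr)
  have "\<mu>1 = \<mu>2"
  proof (rule measure_eqI_generator_eq[where E="?E" and \<Omega>="?Om" and A="\<lambda>_. ?Om"])
    show "Int_stable ?E" "?E \<subseteq> Pow ?Om" using gen by auto
    show "sets \<mu>1 = sigma_sets ?Om ?E" "sets \<mu>2 = sigma_sets ?Om ?E"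
      using gen by (auto simp: \<mu>1_def \<mu>2_def)
    show "range (\<lambda>_. ?Om) \<subseteq> ?E" "(\<Union>i. ?Om) = ?Om" using gen by auto
    have "emeasure \<mu>1 ?Om \<le> emeasure M (A \<inter> (?\<theta> -` ?Om \<inter> space M))"
      using gen by (subst em1) auto
    also have "\<dots> < \<infinity>" by (simp add: emeasure_eq_measure)
    finally show "emeasure \<mu>1 ?Om \<noteq> \<infinity>" by auto
  next
    fix C assume C: "C \<in> ?E"
    then obtain J B where J: "C = {w\<in>?Om. \<forall>j\<in>J. w j \<in> B j}" "finite J" "J \<subseteq> {0..}" "0 \<in> J" "\<And>j. B j \<in> sets borel"
      by blast
    have Cs: "C \<in> sets path_space0" using C gen by auto
    have spO: "space path_space0 = ?Om" by (simp add: path_space0_def)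
    have J': "insert 0 (J - {0}) = J" "J - {0} \<subseteq> {0<..}" using J by auto
    have ind: "(\<Prod>j\<in>J. indicator (B j) (w j)) = (indicator C w :: ennreal)" if "w \<in> ?Om" for w
      using that J by (auto simp: indicator_def prod_zero_iff)
    have \<theta>Om: "?\<theta> \<omega> \<in> ?Om" "(\<lambda>t. X t \<omega>) \<in> ?Om" if "\<omega> \<in> space M" for \<omega>
      using measurable_space[OF shift_increments_measurable[OF s] that]
        measurable_space[OF path_measurable that] spO by auto
    have "emeasure \<mu>1 C = (\<integral>\<^sup>+\<omega>. indicator (A \<inter> (?\<theta> -` C \<inter> space M)) \<omega> \<partial>M)"
      using Cs s by (subst em1) (auto intro!: nn_integral_indicator[symmetric] sets.Int measurable_sets[of _ M path_space0])
    also have "\<dots> = (\<integral>\<^sup>+\<omega>. indicator A \<omega> * (\<Prod>j\<in>J. indicator (B j) (X (s + j) \<omega> - X s \<omega>)) \<partial>M)"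
      using ind[OF \<theta>Om(1)] by (intro nn_integral_cong) (simp add: shift_increments_def indicator_def)
    also have "\<dots> = (\<integral>\<^sup>+\<omega>. indicator A \<omega> \<partial>M) * (\<integral>\<^sup>+\<omega>. (\<Prod>j\<in>J. indicator (B j) (X j \<omega>)) \<partial>M)"
      using cylinder_independent[of "J - {0}" s "indicator A" "\<lambda>j. indicator (B j)"] J J' s A by simp
    also have "(\<integral>\<^sup>+\<omega>. (\<Prod>j\<in>J. indicator (B j) (X j \<omega>)) \<partial>M) = (\<integral>\<^sup>+\<omega>. indicator ((\<lambda>\<omega> t. X t \<omega>) -` C \<inter> space M) \<omega> \<partial>M)"
      using ind[OF \<theta>Om(2)] by (intro nn_integral_cong) (simp add: indicator_def)
    also have "(\<integral>\<^sup>+\<omega>. indicator A \<omega> \<partial>M) * \<dots> = emeasure \<mu>2 C"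
      using Cs by (subst em2) (auto intro!: nn_integral_indicator arg_cong2[where f="(*)"] measurable_sets[of _ M path_space0] AM)
    finally show "emeasure \<mu>1 C = emeasure \<mu>2 C" .
  qed
  then show "emeasure M (A \<inter> (?\<theta> -` B \<inter> space M)) = emeasure M A * emeasure M ((\<lambda>\<omega> t. X t \<omega>) -` B \<inter> space M)"
    using em1[OF B] em2[OF B] by simp
qed

text \<open>
The functional of the future may depend on the present position through its first argument. That
is how integrals of a potential along the path from time \<open>s\<close> on are expressed.
\<close>

lemma markov_property:
  assumes s: "0 \<le> s" and F: "F \<in> borel_measurable (past s)"
    and J: "J \<in> borel_measurable (borel \<Otimes>\<^sub>M path_space0)"
  shows "(\<integral>\<^sup>+\<omega>. F \<omega> * J (x + X s \<omega>, shift_increments s (\<lambda>t. X t \<omega>)) \<partial>M)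
       = (\<integral>\<^sup>+\<omega>. F \<omega> * (\<integral>\<^sup>+\<omega>'. J (x + X s \<omega>, \<lambda>t. X t \<omega>') \<partial>M) \<partial>M)"
proof -
  note [measurable] = F J X_past[OF s order_refl]
  have "(\<integral>\<^sup>+\<omega>. F \<omega> * J (x + X s \<omega>, shift_increments s (\<lambda>t. X t \<omega>)) \<partial>M)
    = (\<integral>\<^sup>+\<omega>. (\<lambda>(\<omega>, p). F \<omega> * J (x + X s \<omega>, p)) (\<omega>, shift_increments s (\<lambda>t. X t \<omega>)) \<partial>M)" by simp
  also have "\<dots> = (\<integral>\<^sup>+\<omega>. (\<integral>\<^sup>+\<omega>'. (\<lambda>(\<omega>, p). F \<omega> * J (x + X s \<omega>, p)) (\<omega>, \<lambda>t. X t \<omega>') \<partial>M) \<partial>M)"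
    by (rule shifted_path_independent[OF s]) measurable
  also have "\<dots> = (\<integral>\<^sup>+\<omega>. F \<omega> * (\<integral>\<^sup>+\<omega>'. J (x + X s \<omega>, \<lambda>t. X t \<omega>') \<partial>M) \<partial>M)"
  proof (intro nn_integral_cong, simp)
    fix \<omega> assume "\<omega> \<in> space M"
    have "(\<lambda>p. J (x + X s \<omega>, p)) \<in> borel_measurable path_space0" by measurable
    then have "(\<lambda>\<omega>'. J (x + X s \<omega>, \<lambda>t. X t \<omega>')) \<in> borel_measurable M"
      using measurable_compose[OF path_measurable] by simp
    then show "(\<integral>\<^sup>+\<omega>'. F \<omega> * J (x + X s \<omega>, \<lambda>t. X t \<omega>') \<partial>M) = F \<omega> * (\<integral>\<^sup>+\<omega>'. J (x + X s \<omega>, \<lambda>t. X t \<omega>') \<partial>M)"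
      by (rule nn_integral_cmult)
  qed
  finally show ?thesis .
qed

text \<open>
The increment over \<open>[t - h, t]\<close> has the law of \<open>X h\<close>, which tends to 0 by right continuity at
time 0. It also tends to the jump at time \<open>t\<close>, which is therefore 0.
\<close>

lemma no_fixed_jump:
  assumes t: "0 < t"
  shows "AE \<omega> in M. ((\<lambda>r. X r \<omega>) \<longlongrightarrow> X t \<omega>) (at_left t)"
proof -
  define h where "h n = t / (real n + 1)" for n :: nat
  have h: "0 < h n" "h n \<le> t" for n using t by (auto simp: h_def field_simps)
  have h0: "h \<longlonglongrightarrow> 0"
    unfolding h_def using tendsto_mult_right_zero[OF LIMSEQ_Suc[OF lim_1_over_n], of t] by (simp add: field_simps)
  define L where "L \<omega> = left_lim (\<lambda>r. X r \<omega>) t" for \<omega>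
  have lim: "(\<lambda>n. X (t - h n) \<omega>) \<longlonglongrightarrow> L \<omega>" if "\<omega> \<in> space M" for \<omega>
  proof -
    have "filterlim (\<lambda>n. t - h n) (at_left t) sequentially"
      unfolding filterlim_at using h tendsto_diff[OF tendsto_const h0, of t]
      by (auto intro!: always_eventually simp: less_imp_neq[OF h(1), symmetric])
    from filterlim_compose[OF cadlag_left[OF cadlag_X[OF that] t] this] show ?thesis by (simp add: L_def)
  qed
  have lim0: "(\<lambda>n. X (h n) \<omega>) \<longlonglongrightarrow> 0" if "\<omega> \<in> space M" for \<omega>
  proof -
    have "filterlim h (at_right 0) sequentially"
      unfolding filterlim_at using h h0 by (auto intro!: always_eventually simp: less_imp_neq[OF h(1), symmetric])
    from filterlim_compose[OF cadlag_right[OF cadlag_X[OF that], of 0] this] show ?thesis by (simp add: X0 that)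
  qed
  have [measurable]: "X (t - h n) \<in> borel_measurable M" "X (h n) \<in> borel_measurable M" "X t \<in> borel_measurable M" for n
    using h[of n] t by auto
  have [measurable]: "L \<in> borel_measurable M"
    by (rule borel_measurable_LIMSEQ_metric[OF _ lim]) measurable
  let ?g = "\<lambda>z::'a. min 1 (norm z)"
  have "(\<lambda>n. \<integral>\<omega>. ?g (X t \<omega> - X (t - h n) \<omega>) \<partial>M) \<longlonglongrightarrow> (\<integral>\<omega>. ?g (X t \<omega> - L \<omega>) \<partial>M)"
    by (rule integral_dominated_convergence[where w="\<lambda>_. 1"]) (auto intro!: tendsto_intros lim)
  moreover have "(\<integral>\<omega>. ?g (X t \<omega> - X (t - h n) \<omega>) \<partial>M) = (\<integral>\<omega>. ?g (X (h n) \<omega>) \<partial>M)" for n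
  proof -
    have "distr M borel (\<lambda>\<omega>. X t \<omega> - X (t - h n) \<omega>) = distr M borel (X (t - (t - h n)))"
      using levy h[of n] unfolding levy_process_def by (metis diff_ge_0_iff_ge diff_le_eq le_add_same_cancel1 less_imp_le)
    from arg_cong[OF this, of "\<lambda>N. \<integral>z. ?g z \<partial>N"] show ?thesis by (simp add: integral_distr)
  qed
  moreover have "(\<lambda>n. \<integral>\<omega>. ?g (X (h n) \<omega>) \<partial>M) \<longlonglongrightarrow> (\<integral>\<omega>. ?g 0 \<partial>M)"
  proof (rule integral_dominated_convergence[where w="\<lambda>_. 1"])
    have "(\<lambda>n. ?g (X (h n) \<omega>)) \<longlonglongrightarrow> ?g 0" if "\<omega> \<in> space M" for \<omega>
      by (intro tendsto_intros lim0 that)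
    then show "AE \<omega> in M. (\<lambda>n. ?g (X (h n) \<omega>)) \<longlonglongrightarrow> ?g 0" by (rule AE_I2)
  qed auto
  ultimately have "(\<integral>\<omega>. ?g (X t \<omega> - L \<omega>) \<partial>M) = 0"
    using LIMSEQ_unique by fastforce
  moreover have "integrable M (\<lambda>\<omega>. ?g (X t \<omega> - L \<omega>))"
    by (rule integrable_const_bound[where B=1]) auto
  ultimately have "AE \<omega> in M. ?g (X t \<omega> - L \<omega>) = 0"
    by (subst (asm) integral_nonneg_eq_0_iff_AE) auto
  then show ?thesis
  proof (rule AE_mp, intro AE_I2 impI)
    fix \<omega> assume \<omega>: "\<omega> \<in> space M" "?g (X t \<omega> - L \<omega>) = 0"
    then have "X t \<omega> = L \<omega>" by (auto simp: min_def split: if_splits)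
    then show "((\<lambda>r. X r \<omega>) \<longlongrightarrow> X t \<omega>) (at_left t)"
      using cadlag_left[OF cadlag_X[OF \<omega>(1)] t] by (simp add: L_def)
  qed
qed

end

section \<open>The Feynman-Kac functional\<close>

text \<open>
The exponent of the Feynman-Kac weight along the path \<open>x + p\<close>. Its companion \<open>abs_action\<close> takes
values in \<open>[0, \<infinity>]\<close> and decides whether the integral converges; where it diverges, \<open>action\<close> is 0
by convention and additivity is lost.
\<close>

definition action :: "('a::euclidean_space \<Rightarrow> real) \<Rightarrow> real \<Rightarrow> 'a \<Rightarrow> (real \<Rightarrow> 'a) \<Rightarrow> real" where
  "action W t x p = (LINT q:{0..t}|lborel. W (x + p q))"

definition abs_action :: "('a::euclidean_space \<Rightarrow> real) \<Rightarrow> real \<Rightarrow> 'a \<Rightarrow> (real \<Rightarrow> 'a) \<Rightarrow> ennreal" where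
  "abs_action W t x p = (\<integral>\<^sup>+q\<in>{0..t}. ennreal \<bar>W (x + p q)\<bar> \<partial>lborel)"

lemma measurable_action_process:
  fixes Y :: "real \<Rightarrow> 'w \<Rightarrow> 'a::euclidean_space"
  assumes t: "0 \<le> t"
    and meas: "\<And>q. 0 \<le> q \<Longrightarrow> q \<le> t \<Longrightarrow> Y q \<in> borel_measurable N"
    and rc: "\<And>\<omega> q. \<omega> \<in> space N \<Longrightarrow> 0 \<le> q \<Longrightarrow> q < t \<Longrightarrow> ((\<lambda>r. Y r \<omega>) \<longlongrightarrow> Y q \<omega>) (at_right q)"
    and W[measurable]: "W \<in> borel_measurable borel"
  shows "(\<lambda>(x, \<omega>). action W t x (\<lambda>q. Y q \<omega>)) \<in> borel_measurable (borel \<Otimes>\<^sub>M N)"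
    and "(\<lambda>(x, \<omega>). abs_action W t x (\<lambda>q. Y q \<omega>)) \<in> borel_measurable (borel \<Otimes>\<^sub>M N)"
proof -
  have "(\<lambda>(q, \<omega>). Y (max 0 (min q t)) \<omega>) \<in> borel_measurable (borel \<Otimes>\<^sub>M N)"
    by (rule borel_measurable_right_continuous_process[OF t meas rc])
  from measurable_compose[OF _ this, of "\<lambda>z. (snd z, snd (fst z))" "(borel \<Otimes>\<^sub>M N) \<Otimes>\<^sub>M lborel"]
  have Y [measurable]: "(\<lambda>z. Y (max 0 (min (snd z) t)) (snd (fst z))) \<in> borel_measurable ((borel \<Otimes>\<^sub>M N) \<Otimes>\<^sub>M lborel)"
    by simp
  have WY [measurable]: "(\<lambda>z. W (fst (fst z) + Y (max 0 (min (snd z) t)) (snd (fst z)))) \<in> borel_measurable ((borel \<Otimes>\<^sub>M N) \<Otimes>\<^sub>M (lborel :: real measure))"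
    by measurable
  have clip: "q \<in> {0..t} \<Longrightarrow> max 0 (min q t) = q" for q by auto
  have "(\<lambda>z. LINT q|lborel. indicator {0..t} q *\<^sub>R W (fst z + Y (max 0 (min q t)) (snd z))) \<in> borel_measurable (borel \<Otimes>\<^sub>M N)"
    by (rule lborel.borel_measurable_lebesgue_integral) (simp add: split_beta')
  moreover have "action W t x (\<lambda>q. Y q \<omega>) = (LINT q|lborel. indicator {0..t} q *\<^sub>R W (x + Y (max 0 (min q t)) \<omega>))" for x \<omega>
    unfolding action_def set_lebesgue_integral_def by (intro Bochner_Integration.integral_cong) (auto simp: indicator_def)
  ultimately show "(\<lambda>(x, \<omega>). action W t x (\<lambda>q. Y q \<omega>)) \<in> borel_measurable (borel \<Otimes>\<^sub>M N)"
    by (simp add: split_beta')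
  have "(\<lambda>z. \<integral>\<^sup>+q. ennreal \<bar>W (fst z + Y (max 0 (min q t)) (snd z))\<bar> * indicator {0..t} q \<partial>lborel) \<in> borel_measurable (borel \<Otimes>\<^sub>M N)"
    by (rule lborel.borel_measurable_nn_integral) (simp add: split_beta')
  moreover have "abs_action W t x (\<lambda>q. Y q \<omega>) = (\<integral>\<^sup>+q. ennreal \<bar>W (x + Y (max 0 (min q t)) \<omega>)\<bar> * indicator {0..t} q \<partial>lborel)" for x \<omega>
    unfolding abs_action_def by (intro nn_integral_cong) (auto simp: indicator_def)
  ultimately show "(\<lambda>(x, \<omega>). abs_action W t x (\<lambda>q. Y q \<omega>)) \<in> borel_measurable (borel \<Otimes>\<^sub>M N)"
    by (simp add: split_beta')
qed

lemma path_space0_right: "p \<in> space path_space0 \<Longrightarrow> 0 \<le> q \<Longrightarrow> (p \<longlongrightarrow> p q) (at_right q)"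
  by (auto simp: path_space0_def intro: cadlag_right)

lemma measurable_action_path [measurable]:
  assumes "0 \<le> t" "W \<in> borel_measurable borel"
  shows "(\<lambda>(x, p). action W t x p) \<in> borel_measurable (borel \<Otimes>\<^sub>M path_space0)"
    and "(\<lambda>(x, p). abs_action W t x p) \<in> borel_measurable (borel \<Otimes>\<^sub>M path_space0)"
  by (rule measurable_action_process[of t "\<lambda>q p. p q" path_space0 W];
      simp add: assms path_space0_right measurable_path_space0_component)+

lemma borel_measurable_path:
  assumes p: "p \<in> space path_space0" and t: "0 \<le> t"
  shows "(\<lambda>q. p (max 0 (min q t))) \<in> borel_measurable borel"
proof -
  have "(\<lambda>(q, \<omega>). p (max 0 (min q t))) \<in> borel_measurable (borel \<Otimes>\<^sub>M count_space {()})"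
    using p t by (intro borel_measurable_right_continuous_process) (auto intro: path_space0_right)
  from measurable_compose[OF _ this, of "\<lambda>q. (q, ())" borel] show ?thesis by simp
qed

lemma set_borel_measurable_action:
  fixes W :: "'a::euclidean_space \<Rightarrow> real"
  assumes p: "p \<in> space path_space0" and t: "0 \<le> t" and [measurable]: "W \<in> borel_measurable borel"
  shows "set_borel_measurable lborel {0..t} (\<lambda>q. W (x + p q))"
proof -
  define P where "P q = p (max 0 (min q t))" for q
  have [measurable]: "P \<in> borel_measurable borel"
    using borel_measurable_path[OF p t] by (simp add: P_def[abs_def])
  have "(\<lambda>q. indicator {0..t} q *\<^sub>R W (x + P q)) \<in> borel_measurable lborel" by measurable
  also have "(\<lambda>q. indicator {0..t} q *\<^sub>R W (x + P q)) = (\<lambda>q. indicator {0..t} q *\<^sub>R W (x + p q))"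
    by (auto simp: indicator_def P_def)
  finally show ?thesis unfolding set_borel_measurable_def .
qed

lemma set_integrable_action:
  assumes p: "p \<in> space path_space0" and t: "0 \<le> t" and W: "W \<in> borel_measurable borel"
    and fin: "abs_action W t x p < \<infinity>"
  shows "set_integrable lborel {0..t} (\<lambda>q. W (x + p q))"
  unfolding set_integrable_def
proof (rule integrableI_bounded)
  show "(\<lambda>q. indicator {0..t} q *\<^sub>R W (x + p q)) \<in> borel_measurable lborel"
    using set_borel_measurable_action[OF p t W] unfolding set_borel_measurable_def .
  have "(\<integral>\<^sup>+q. ennreal (norm (indicator {0..t} q *\<^sub>R W (x + p q))) \<partial>lborel) = abs_action W t x p"
    unfolding abs_action_def by (intro nn_integral_cong) (auto simp: indicator_def)
  then show "(\<integral>\<^sup>+q. ennreal (norm (indicator {0..t} q *\<^sub>R W (x + p q))) \<partial>lborel) < \<infinity>" using fin by simp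
qed

lemma action_add:
  assumes s: "0 \<le> s" and t: "0 \<le> t" and int: "set_integrable lborel {0..s + t} (\<lambda>q. W (x + p q))"
  shows "action W (s + t) x p = action W s x p + action W t (x + p s) (shift_increments s p)"
proof -
  let ?f = "\<lambda>q. W (x + p q)"
  have i1: "set_integrable lborel {0..s} ?f" and i2: "set_integrable lborel {s<..s + t} ?f"
    using s t by (auto intro!: set_integrable_subset[OF int])
  have "{0..s + t} = {0..s} \<union> {s<..s + t}" using s t by auto
  then have "action W (s + t) x p = action W s x p + (LINT q:{s<..s + t}|lborel. ?f q)"
    unfolding action_def using set_integral_Un[OF _ i1 i2] by (simp add: ivl_disj_int)
  also have "(LINT q:{s<..s + t}|lborel. ?f q) = (LINT q|lborel. indicator {s<..s+t} (s + 1 * q) *\<^sub>R ?f (s + 1 * q))"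
    unfolding set_lebesgue_integral_def by (subst lborel_integral_real_affine[of 1 _ s]) auto
  also have "\<dots> = (LINT q|lborel. indicator {0..t} q *\<^sub>R W (x + p s + shift_increments s p q))"
  proof (rule integral_discrete_difference[of "{0}"])
    fix q :: real assume "q \<notin> {0}"
    then show "indicator {s<..s+t} (s + 1 * q) *\<^sub>R ?f (s + 1 * q) = indicator {0..t} q *\<^sub>R W (x + p s + shift_increments s p q)"
      by (auto simp: indicator_def shift_increments_def)
  qed auto
  finally show ?thesis by (simp add: action_def set_lebesgue_integral_def)
qed

lemma abs_action_add:
  assumes s: "0 \<le> s" and t: "0 \<le> t" and W: "W \<in> borel_measurable borel" and p: "p \<in> space path_space0"
  shows "abs_action W (s + t) x p \<le> abs_action W s x p + abs_action W t (x + p s) (shift_increments s p)"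
proof -
  note [measurable] = W
  define P where "P q = p (max 0 (min q (s + t)))" for q
  have [measurable]: "P \<in> borel_measurable borel"
    using borel_measurable_path[OF p, of "s + t"] s t by (simp add: P_def[abs_def])
  have "abs_action W (s + t) x p = (\<integral>\<^sup>+q. ennreal \<bar>W (x + P q)\<bar> * indicator {0..s+t} q \<partial>lborel)"
    unfolding abs_action_def by (intro nn_integral_cong) (auto simp: indicator_def P_def)
  also have "\<dots> \<le> (\<integral>\<^sup>+q. ennreal \<bar>W (x + P q)\<bar> * indicator {0..s} q + ennreal \<bar>W (x + P q)\<bar> * indicator {s..s+t} q \<partial>lborel)"
    by (intro nn_integral_mono) (auto simp: indicator_def P_def)
  also have "\<dots> = (\<integral>\<^sup>+q. ennreal \<bar>W (x + P q)\<bar> * indicator {0..s} q \<partial>lborel) + (\<integral>\<^sup>+q. ennreal \<bar>W (x + P q)\<bar> * indicator {s..s+t} q \<partial>lborel)"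
    by (rule nn_integral_add) measurable
  also have "(\<integral>\<^sup>+q. ennreal \<bar>W (x + P q)\<bar> * indicator {0..s} q \<partial>lborel) = abs_action W s x p"
    unfolding abs_action_def using t by (intro nn_integral_cong) (auto simp: indicator_def P_def)
  also have "(\<integral>\<^sup>+q. ennreal \<bar>W (x + P q)\<bar> * indicator {s..s+t} q \<partial>lborel)
      = (\<integral>\<^sup>+q. ennreal \<bar>W (x + P (s + 1 * q))\<bar> * indicator {s..s+t} (s + 1 * q) \<partial>lborel)"
    by (subst nn_integral_real_affine[of _ 1 s]) auto
  also have "\<dots> = abs_action W t (x + p s) (shift_increments s p)"
    unfolding abs_action_def using s t by (intro nn_integral_cong) (auto simp: indicator_def shift_increments_def P_def)
  finally show ?thesis .
qed

context levy
begin

lemma path_in_space [simp]: "\<omega> \<in> space M \<Longrightarrow> (\<lambda>t. X t \<omega>) \<in> space path_space0"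
  using measurable_space[OF path_measurable] .

lemma measurable_action_past:
  assumes "0 \<le> t" "t \<le> s" "W \<in> borel_measurable borel"
  shows "(\<lambda>\<omega>. action W t x (\<lambda>q. X q \<omega>)) \<in> borel_measurable (past s)"
proof -
  have "(\<lambda>(x, \<omega>). action W t x (\<lambda>q. X q \<omega>)) \<in> borel_measurable (borel \<Otimes>\<^sub>M past s)"
    using assms by (intro measurable_action_process) (auto intro: X_past cadlag_right[OF cadlag_X])
  from measurable_compose[OF _ this, of "\<lambda>\<omega>. (x, \<omega>)" "past s"] show ?thesis by simp
qed

lemma measurable_action_M [measurable]:
  assumes "0 \<le> t" "W \<in> borel_measurable borel"
  shows "(\<lambda>(x, \<omega>). action W t x (\<lambda>q. X q \<omega>)) \<in> borel_measurable (borel \<Otimes>\<^sub>M M)"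
    and "(\<lambda>(x, \<omega>). abs_action W t x (\<lambda>q. X q \<omega>)) \<in> borel_measurable (borel \<Otimes>\<^sub>M M)"
  using assms measurable_action_process[of t X M W] by (auto intro: cadlag_right[OF cadlag_X])

lemma measurable_action_M1 [measurable]:
  assumes "0 \<le> t" "W \<in> borel_measurable borel"
  shows "(\<lambda>\<omega>. action W t x (\<lambda>q. X q \<omega>)) \<in> borel_measurable M"
    and "(\<lambda>\<omega>. abs_action W t x (\<lambda>q. X q \<omega>)) \<in> borel_measurable M"
  using measurable_compose_Pair1[OF _ measurable_action_M(1)[OF assms], of x]
    measurable_compose_Pair1[OF _ measurable_action_M(2)[OF assms], of x] by simp_all

lemma nn_integral_abs_action:
  assumes t: "0 \<le> t" and W[measurable]: "W \<in> borel_measurable borel"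
  shows "(\<integral>\<^sup>+\<omega>. abs_action W t x (\<lambda>q. X q \<omega>) \<partial>M) = (\<integral>\<^sup>+q\<in>{0..t}. (\<integral>\<^sup>+\<omega>. ennreal \<bar>W (x + X q \<omega>)\<bar> \<partial>M) \<partial>lborel)"
proof -
  have "(\<lambda>(q, \<omega>). X (max 0 (min q t)) \<omega>) \<in> borel_measurable (borel \<Otimes>\<^sub>M M)"
    using t by (intro borel_measurable_right_continuous_process) (auto intro: cadlag_right[OF cadlag_X])
  then have [measurable]: "(\<lambda>z. X (max 0 (min (fst z) t)) (snd z)) \<in> borel_measurable (lborel \<Otimes>\<^sub>M M)"
    by (simp add: split_beta')
  interpret pair_sigma_finite lborel M by unfold_locales
  have "(\<integral>\<^sup>+\<omega>. abs_action W t x (\<lambda>q. X q \<omega>) \<partial>M)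
     = (\<integral>\<^sup>+\<omega>. (\<integral>\<^sup>+q. ennreal \<bar>W (x + X (max 0 (min q t)) \<omega>)\<bar> * indicator {0..t} q \<partial>lborel) \<partial>M)"
    unfolding abs_action_def by (intro nn_integral_cong) (auto simp: indicator_def)
  also have "\<dots> = (\<integral>\<^sup>+q. (\<integral>\<^sup>+\<omega>. ennreal \<bar>W (x + X (max 0 (min q t)) \<omega>)\<bar> * indicator {0..t} q \<partial>M) \<partial>lborel)"
    by (rule Fubini') (simp add: split_beta')
  also have "\<dots> = (\<integral>\<^sup>+q\<in>{0..t}. (\<integral>\<^sup>+\<omega>. ennreal \<bar>W (x + X q \<omega>)\<bar> \<partial>M) \<partial>lborel)"
    using t by (intro nn_integral_cong) (auto simp: indicator_def)
  finally show ?thesis .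
qed

text \<open>
By the Markov property at time \<open>s\<close>, the expectation over the later piece of the path is an average
of expectations over \<open>[0, t]\<close> with other starting points.
\<close>

lemma nn_integral_abs_action_add:
  assumes s: "0 \<le> s" and t: "0 \<le> t" and W[measurable]: "W \<in> borel_measurable borel"
    and C: "\<And>z. (\<integral>\<^sup>+\<omega>. abs_action W t z (\<lambda>q. X q \<omega>) \<partial>M) \<le> C"
  shows "(\<integral>\<^sup>+\<omega>. abs_action W (s + t) x (\<lambda>q. X q \<omega>) \<partial>M) \<le> (\<integral>\<^sup>+\<omega>. abs_action W s x (\<lambda>q. X q \<omega>) \<partial>M) + C"
proof -
  let ?J = "\<lambda>(x, p). abs_action W t x p"
  have J[measurable]: "?J \<in> borel_measurable (borel \<Otimes>\<^sub>M path_space0)" using t by measurable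
  have [measurable]: "X s \<in> borel_measurable M" using s by simp
  have [measurable]: "(\<lambda>\<omega>. ?J (x + X s \<omega>, shift_increments s (\<lambda>q. X q \<omega>))) \<in> borel_measurable M"
    by (rule measurable_compose[OF _ J]) (use s in measurable)
  have "(\<integral>\<^sup>+\<omega>. abs_action W (s + t) x (\<lambda>q. X q \<omega>) \<partial>M)
     \<le> (\<integral>\<^sup>+\<omega>. abs_action W s x (\<lambda>q. X q \<omega>) + ?J (x + X s \<omega>, shift_increments s (\<lambda>q. X q \<omega>)) \<partial>M)"
    using abs_action_add[OF s t W path_in_space] by (intro nn_integral_mono) simp
  also have "\<dots> = (\<integral>\<^sup>+\<omega>. abs_action W s x (\<lambda>q. X q \<omega>) \<partial>M) + (\<integral>\<^sup>+\<omega>. ?J (x + X s \<omega>, shift_increments s (\<lambda>q. X q \<omega>)) \<partial>M)"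
    using s by (intro nn_integral_add) measurable
  also have "(\<integral>\<^sup>+\<omega>. ?J (x + X s \<omega>, shift_increments s (\<lambda>q. X q \<omega>)) \<partial>M)
     = (\<integral>\<^sup>+\<omega>. (\<integral>\<^sup>+\<omega>'. ?J (x + X s \<omega>, \<lambda>q. X q \<omega>') \<partial>M) \<partial>M)"
    using markov_property[OF s _ J, of "\<lambda>_. 1" x] by simp
  also have "\<dots> \<le> (\<integral>\<^sup>+\<omega>. C \<partial>M)"
    using C by (intro nn_integral_mono) simp
  finally show ?thesis by (simp add: emeasure_space_1 add_left_mono)
qed

lemma kato_small:
  assumes W: "kato_class M X W" and e: "0 < e"
  obtains t0 where "0 < t0" "\<And>t x. 0 \<le> t \<Longrightarrow> t \<le> t0 \<Longrightarrow> (\<integral>\<^sup>+\<omega>. abs_action W t x (\<lambda>q. X q \<omega>) \<partial>M) \<le> e"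
proof -
  have Wm: "W \<in> borel_measurable borel" using W by (simp add: kato_class_def)
  have "((\<lambda>t. SUP x. \<integral>\<^sup>+s\<in>{0..t}. (\<integral>\<^sup>+\<omega>. ennreal \<bar>W (x + X s \<omega>)\<bar> \<partial>M) \<partial>lborel) \<longlongrightarrow> 0) (at_right 0)"
    using W by (simp add: kato_class_def)
  then have "\<forall>\<^sub>F t in at_right 0. (SUP x. \<integral>\<^sup>+s\<in>{0..t}. (\<integral>\<^sup>+\<omega>. ennreal \<bar>W (x + X s \<omega>)\<bar> \<partial>M) \<partial>lborel) < e"
    using e by (auto simp: order_tendsto_iff)
  then obtain b where b: "b > 0" "\<And>t. 0 < t \<Longrightarrow> t < b \<Longrightarrow>
      (SUP x. \<integral>\<^sup>+s\<in>{0..t}. (\<integral>\<^sup>+\<omega>. ennreal \<bar>W (x + X s \<omega>)\<bar> \<partial>M) \<partial>lborel) < e"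
    unfolding eventually_at_right_field by auto
  show thesis
  proof (rule that[of "b / 2"])
    show "0 < b / 2" using b by simp
    fix t x assume t: "0 \<le> t" "t \<le> b / 2"
    have "(\<integral>\<^sup>+\<omega>. abs_action W t x (\<lambda>q. X q \<omega>) \<partial>M) \<le> (\<integral>\<^sup>+s\<in>{0..b/2}. (\<integral>\<^sup>+\<omega>. ennreal \<bar>W (x + X s \<omega>)\<bar> \<partial>M) \<partial>lborel)"
      using t by (subst nn_integral_abs_action[OF t(1) Wm]) (auto intro!: nn_integral_mono simp: indicator_def)
    also have "\<dots> \<le> e"
      using b(2)[of "b/2"] b(1) by (intro order_trans[OF SUP_upper less_imp_le]) auto
    finally show "(\<integral>\<^sup>+\<omega>. abs_action W t x (\<lambda>q. X q \<omega>) \<partial>M) \<le> e" .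
  qed
qed

text \<open>
The Kato condition bounds the expectation on a short interval uniformly in the starting point, so
that it can be added up over finitely many short intervals.
\<close>

lemma kato_finite:
  assumes W: "kato_class M X W" and t: "0 \<le> t"
  shows "AE \<omega> in M. abs_action W t x (\<lambda>q. X q \<omega>) < \<infinity>"
proof -
  have Wm[measurable]: "W \<in> borel_measurable borel" using W by (simp add: kato_class_def)
  obtain t0 where t0: "0 < t0" "\<And>t x. 0 \<le> t \<Longrightarrow> t \<le> t0 \<Longrightarrow> (\<integral>\<^sup>+\<omega>. abs_action W t x (\<lambda>q. X q \<omega>) \<partial>M) \<le> 1"
    using kato_small[OF W, of 1] by auto
  have n: "(\<integral>\<^sup>+\<omega>. abs_action W (real n * t0) x (\<lambda>q. X q \<omega>) \<partial>M) \<le> of_nat n" for n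
  proof (induction n)
    case 0
    have "abs_action W 0 x p = 0" for p
      unfolding abs_action_def by (rule nn_integral_null_set) auto
    then show ?case by simp
  next
    case (Suc n)
    have "(\<integral>\<^sup>+\<omega>. abs_action W (real n * t0 + t0) x (\<lambda>q. X q \<omega>) \<partial>M) \<le> (\<integral>\<^sup>+\<omega>. abs_action W (real n * t0) x (\<lambda>q. X q \<omega>) \<partial>M) + 1"
      using t0 by (intro nn_integral_abs_action_add) auto
    also have "\<dots> \<le> of_nat n + 1" by (intro add_right_mono Suc)
    finally show ?case by (simp add: algebra_simps)
  qed
  obtain n :: nat where nt: "t \<le> real n * t0"
    using t0 real_arch_simple[of "t / t0"] by (auto simp: field_simps)
  have "(\<integral>\<^sup>+\<omega>. abs_action W t x (\<lambda>q. X q \<omega>) \<partial>M) \<le> (\<integral>\<^sup>+\<omega>. abs_action W (real n * t0) x (\<lambda>q. X q \<omega>) \<partial>M)"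
    using nt unfolding abs_action_def by (intro nn_integral_mono) (auto simp: indicator_def)
  also have "\<dots> \<le> of_nat n" by (rule n)
  also have "\<dots> < \<infinity>" by (simp add: of_nat_less_top)
  finally have "(\<integral>\<^sup>+\<omega>. abs_action W t x (\<lambda>q. X q \<omega>) \<partial>M) \<noteq> \<infinity>" by simp
  then have "AE \<omega> in M. abs_action W t x (\<lambda>q. X q \<omega>) \<noteq> \<infinity>"
    using t by (intro nn_integral_PInf_AE) measurable
  then show ?thesis by (simp add: top.not_eq_extremum)
qed

end

locale feynman_kac = levy M X for M :: "'w measure" and X :: "real \<Rightarrow> 'w \<Rightarrow> 'a::euclidean_space" +
  fixes V :: "'a \<Rightarrow> real"
  assumes kato: "kato_decomposable M X V"
begin

lemma V_measurable [measurable]: "V \<in> borel_measurable borel"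
  using kato by (simp add: kato_decomposable_def)

text \<open>
The negative part of \<open>V\<close> is in the Kato class. The positive part is so only after restriction to a
ball, but on a bounded time interval each path stays in some ball of integer radius, and countably
many exceptional sets are negligible together.
\<close>

lemma AE_abs_action_finite:
  assumes t: "0 \<le> t"
  shows "AE \<omega> in M. abs_action V t x (\<lambda>q. X q \<omega>) < \<infinity>"
proof -
  define Vm where "Vm y = max (- V y) 0" for y
  define Vp where "Vp n y = max (V y) 0 * indicator (ball 0 (real n)) y" for n :: nat and y
  have "kato_class M X Vm" "\<And>n. kato_class M X (Vp n)"
    using kato by (auto simp: kato_decomposable_def kato_class_loc_def Vm_def[abs_def] Vp_def[abs_def])
  then have fin1: "AE \<omega> in M. abs_action Vm t x (\<lambda>q. X q \<omega>) < \<infinity>"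
    and fin2: "AE \<omega> in M. \<forall>n. abs_action (Vp n) t x (\<lambda>q. X q \<omega>) < \<infinity>"
    unfolding AE_all_countable using kato_finite[OF _ t] by blast+
  from AE_space fin1 fin2 show ?thesis
  proof eventually_elim
    case (elim \<omega>)
    then have \<omega>: "\<omega> \<in> space M" and fin: "abs_action Vm t x (\<lambda>q. X q \<omega>) < \<infinity>"
      "\<forall>n. abs_action (Vp n) t x (\<lambda>q. X q \<omega>) < \<infinity>" by auto
    have "bounded ((\<lambda>t. X t \<omega>) ` {0..t})" by (rule cadlag_bounded[OF cadlag_X[OF \<omega>]])
    then obtain B where B: "\<And>q. q \<in> {0..t} \<Longrightarrow> norm (X q \<omega>) \<le> B" unfolding bounded_iff by (metis imageI)
    obtain n :: nat where n: "norm x + B < real n" using reals_Archimedean2 by blast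
    have inb: "x + X q \<omega> \<in> ball 0 (real n)" if "q \<in> {0..t}" for q
      using norm_triangle_ineq[of x "X q \<omega>"] B[OF that] n by simp
    note [measurable] = borel_measurable_path[OF path_in_space[OF \<omega>] t]
    let ?P = "\<lambda>q. X (max 0 (min q t)) \<omega>"
    have [measurable]: "Vm \<in> borel_measurable borel" "Vp n \<in> borel_measurable borel"
      unfolding Vm_def[abs_def] Vp_def[abs_def]
      by (auto intro!: borel_measurable_times borel_measurable_max borel_measurable_indicator)
    have "abs_action V t x (\<lambda>q. X q \<omega>) \<le> (\<integral>\<^sup>+q. ennreal \<bar>Vm (x + ?P q)\<bar> * indicator {0..t} q + ennreal \<bar>Vp n (x + ?P q)\<bar> * indicator {0..t} q \<partial>lborel)"
      unfolding abs_action_def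
      using inb by (intro nn_integral_mono) (auto simp: indicator_def Vm_def Vp_def max_def simp flip: ennreal_plus)
    also have "\<dots> = (\<integral>\<^sup>+q. ennreal \<bar>Vm (x + ?P q)\<bar> * indicator {0..t} q \<partial>lborel) + (\<integral>\<^sup>+q. ennreal \<bar>Vp n (x + ?P q)\<bar> * indicator {0..t} q \<partial>lborel)"
      by (rule nn_integral_add) measurable
    also have "\<dots> = abs_action Vm t x (\<lambda>q. X q \<omega>) + abs_action (Vp n) t x (\<lambda>q. X q \<omega>)"
      unfolding abs_action_def by (intro arg_cong2[where f="(+)"] nn_integral_cong) (auto simp: indicator_def)
    also have "\<dots> < \<infinity>" using fin by simp
    finally show "abs_action V t x (\<lambda>q. X q \<omega>) < \<infinity>" .
  qed
qed

lemma AE_action_add: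
  assumes s: "0 \<le> s" and t: "0 \<le> t"
  shows "AE \<omega> in M. action V (s + t) x (\<lambda>q. X q \<omega>)
    = action V s x (\<lambda>q. X q \<omega>) + action V t (x + X s \<omega>) (shift_increments s (\<lambda>q. X q \<omega>))"
proof (rule AE_mp[OF AE_abs_action_finite[of "s + t" x]], goal_cases)
  case 2
  show ?case
    using s t by (intro AE_I2 impI action_add set_integrable_action) auto
qed (use s t in simp)

text \<open>
The Feynman-Kac semigroup on functions with values in \<open>[0, \<infinity>]\<close>, where no integrability has to be
known in advance.
\<close>

definition fk_op :: "real \<Rightarrow> ('a \<Rightarrow> ennreal) \<Rightarrow> 'a \<Rightarrow> ennreal" where
  "fk_op t f x = (\<integral>\<^sup>+\<omega>. ennreal (exp (- action V t x (\<lambda>q. X q \<omega>))) * f (x + X t \<omega>) \<partial>M)"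

lemma fk_op_measurable [measurable]:
  assumes t: "0 \<le> t" and [measurable]: "f \<in> borel_measurable borel"
  shows "fk_op t f \<in> borel_measurable borel"
proof -
  have [measurable]: "X t \<in> borel_measurable M" using t by simp
  have A: "(\<lambda>z. action V t (fst z) (\<lambda>q. X q (snd z))) \<in> borel_measurable (borel \<Otimes>\<^sub>M M)"
    using measurable_action_M(1)[OF t V_measurable] by (simp add: split_beta')
  have "(\<lambda>z. ennreal (exp (- action V t (fst z) (\<lambda>q. X q (snd z)))) * f (fst z + X t (snd z))) \<in> borel_measurable (borel \<Otimes>\<^sub>M M)"
    using A by measurable
  then show ?thesis
    unfolding fk_op_def[abs_def] by (intro borel_measurable_nn_integral) (simp add: split_beta')
qed

lemma fk_op_mono: "(\<And>y. f y \<le> g y) \<Longrightarrow> fk_op t f x \<le> fk_op t g x"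
  unfolding fk_op_def by (intro nn_integral_mono mult_left_mono) auto

lemma fk_op_cmult:
  assumes t: "0 \<le> t" and [measurable]: "f \<in> borel_measurable borel"
  shows "fk_op t (\<lambda>y. c * f y) x = c * fk_op t f x"
proof -
  have [measurable]: "X t \<in> borel_measurable M" using t by simp
  have "fk_op t (\<lambda>y. c * f y) x = (\<integral>\<^sup>+\<omega>. c * (ennreal (exp (- action V t x (\<lambda>q. X q \<omega>))) * f (x + X t \<omega>)) \<partial>M)"
    unfolding fk_op_def by (simp add: ac_simps)
  also have "\<dots> = c * fk_op t f x"
    unfolding fk_op_def using t by (intro nn_integral_cmult) measurable
  finally show ?thesis .
qed

lemma fk_op_0: "fk_op 0 f x = f x"
proof -
  have "action V 0 x p = 0" for p
    unfolding action_def set_lebesgue_integral_def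
    by (rule integral_eq_zero_AE, rule AE_mp[OF AE_lborel_singleton[of 0]]) (auto simp: indicator_def)
  then have "fk_op 0 f x = (\<integral>\<^sup>+\<omega>. f x \<partial>M)"
    unfolding fk_op_def by (intro nn_integral_cong) (simp add: X0)
  then show ?thesis by (simp add: emeasure_space_1)
qed

text \<open>
The weight up to time \<open>s + r\<close> is the weight up to \<open>s\<close> times the weight of the shifted path up to
\<open>r\<close>; the Markov property integrates out the second factor.
\<close>

lemma fk_markov:
  assumes s: "0 \<le> s" and r: "0 \<le> r" and F: "F \<in> borel_measurable (past s)" and f[measurable]: "f \<in> borel_measurable borel"
  shows "(\<integral>\<^sup>+\<omega>. F \<omega> * (ennreal (exp (- action V (s + r) x (\<lambda>q. X q \<omega>))) * f (x + X (s + r) \<omega>)) \<partial>M)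
       = (\<integral>\<^sup>+\<omega>. F \<omega> * (ennreal (exp (- action V s x (\<lambda>q. X q \<omega>))) * fk_op r f (x + X s \<omega>)) \<partial>M)"
proof -
  let ?J = "\<lambda>(x, p). ennreal (exp (- action V r x p)) * f (x + p r)"
  have J: "?J \<in> borel_measurable (borel \<Otimes>\<^sub>M path_space0)"
  proof -
    have A: "(\<lambda>z. action V r (fst z) (snd z)) \<in> borel_measurable (borel \<Otimes>\<^sub>M path_space0)"
      using measurable_action_path(1)[OF r V_measurable] by (simp add: split_beta')
    have [measurable]: "(\<lambda>z. snd z r) \<in> borel_measurable (borel \<Otimes>\<^sub>M path_space0)"
      by (rule measurable_compose[OF measurable_snd measurable_path_space0_component[OF r]])
    show ?thesis using A by (simp add: split_beta') measurable
  qed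
  have F': "(\<lambda>\<omega>. F \<omega> * ennreal (exp (- action V s x (\<lambda>q. X q \<omega>)))) \<in> borel_measurable (past s)"
  proof -
    note [measurable] = F measurable_action_past[OF s order_refl V_measurable, of x]
    show ?thesis by measurable
  qed
  have "(\<integral>\<^sup>+\<omega>. F \<omega> * (ennreal (exp (- action V (s + r) x (\<lambda>q. X q \<omega>))) * f (x + X (s + r) \<omega>)) \<partial>M)
     = (\<integral>\<^sup>+\<omega>. (F \<omega> * ennreal (exp (- action V s x (\<lambda>q. X q \<omega>)))) * ?J (x + X s \<omega>, shift_increments s (\<lambda>t. X t \<omega>)) \<partial>M)"
    using AE_action_add[OF s r, of x]
    by (intro nn_integral_cong_AE) (auto simp: exp_add exp_diff shift_increments_def ennreal_mult' ac_simps exp_minus divide_inverse)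
  also have "\<dots> = (\<integral>\<^sup>+\<omega>. (F \<omega> * ennreal (exp (- action V s x (\<lambda>q. X q \<omega>)))) * (\<integral>\<^sup>+\<omega>'. ?J (x + X s \<omega>, \<lambda>t. X t \<omega>') \<partial>M) \<partial>M)"
    by (rule markov_property[OF s F' J])
  also have "\<dots> = (\<integral>\<^sup>+\<omega>. F \<omega> * (ennreal (exp (- action V s x (\<lambda>q. X q \<omega>))) * fk_op r f (x + X s \<omega>)) \<partial>M)"
    unfolding fk_op_def by (simp add: ac_simps)
  finally show ?thesis .
qed

lemma fk_op_add:
  assumes "0 \<le> s" "0 \<le> r" "f \<in> borel_measurable borel"
  shows "fk_op (s + r) f x = fk_op s (fk_op r f) x"
  using fk_markov[OF assms(1,2) _ assms(3), of "\<lambda>_. 1" x] by (simp add: fk_op_def[of "s + r"] fk_op_def[of s])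

end

section \<open>Exponential moments of the potential\<close>

lemma exp_le_one_plus_double: "0 \<le> d \<Longrightarrow> d \<le> 1 \<Longrightarrow> exp d - 1 \<le> 2 * (d::real)"
  using exp_bound[of d] mult_left_mono[of d 1 d] by (auto simp: power2_eq_square)

lemma abs_action_le_bound:
  fixes W :: "'a::euclidean_space \<Rightarrow> real"
  assumes "0 \<le> t" "\<And>y. \<bar>W y\<bar> \<le> B"
  shows "abs_action W t x p \<le> ennreal (B * t)"
proof -
  have B: "0 \<le> B" using assms(2)[of undefined] by linarith
  have "abs_action W t x p \<le> (\<integral>\<^sup>+q. ennreal B * indicator {0..t} q \<partial>lborel)"
    unfolding abs_action_def using assms(2) by (intro nn_integral_mono mult_right_mono ennreal_leI) auto
  also have "\<dots> = ennreal (B * t)"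
    using assms(1) B by (simp add: nn_integral_cmult_indicator ennreal_mult)
  finally show ?thesis .
qed

lemma abs_action_nonneg_eq:
  fixes W :: "'a::euclidean_space \<Rightarrow> real"
  assumes "\<And>y. 0 \<le> W y" "set_integrable lborel {0..t} (\<lambda>q. W (x + p q))"
  shows "abs_action W t x p = ennreal (action W t x p)" "0 \<le> action W t x p"
proof -
  have "abs_action W t x p = (\<integral>\<^sup>+q. ennreal (indicator {0..t} q *\<^sub>R W (x + p q)) \<partial>lborel)"
    unfolding abs_action_def using assms(1) by (intro nn_integral_cong) (auto simp: indicator_def)
  also have "\<dots> = ennreal (action W t x p)"
    unfolding action_def set_lebesgue_integral_def
    using assms by (intro nn_integral_eq_integral) (auto simp: set_integrable_def)
  finally show "abs_action W t x p = ennreal (action W t x p)" .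
  show "0 \<le> action W t x p"
    unfolding action_def set_lebesgue_integral_def using assms(1) by (intro Bochner_Integration.integral_nonneg) auto
qed

context levy
begin

text \<open>
Khasminskii's lemma for bounded potentials. Let \<open>m\<close> be the supremum over all starting points and all
times up to \<open>t\<close> of the exponential moment \<open>e\<close>. A fine partition of the time interval expands
\<open>exp a - 1\<close> into terms that are at most twice the action over one cell times the exponential of the
action over the remaining time. The Markov property bounds the expectation of the latter
by \<open>m\<close>, whence \<open>m \<le> 1 + m/2\<close>. Boundedness of the potential makes \<open>m\<close> finite, so that this
can be solved for \<open>m\<close>.
\<close>

lemma khasminskii_bounded:
  fixes W :: "'a \<Rightarrow> real"
  assumes W[measurable]: "W \<in> borel_measurable borel" and W01: "\<And>y. 0 \<le> W y" "\<And>y. W y \<le> B"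
    and t: "0 \<le> t"
    and small: "\<And>x. (\<integral>\<^sup>+\<omega>. abs_action W t x (\<lambda>q. X q \<omega>) \<partial>M) \<le> ennreal (1 / 4)"
  shows "(\<integral>\<^sup>+\<omega>. ennreal (exp (action W t x (\<lambda>q. X q \<omega>))) \<partial>M) \<le> 2"
proof -
  have B: "0 \<le> B" using W01[of undefined] by linarith
  have absW: "\<bar>W y\<bar> \<le> B" for y using W01[of y] by simp
  have int: "set_integrable lborel {0..r} (\<lambda>q. W (z + p q))" if "0 \<le> r" "p \<in> space path_space0" for r z p
    using that abs_action_le_bound[of r W B z p, OF that(1) absW]
    by (intro set_integrable_action) (auto intro: order.strict_trans1)
  have nn: "0 \<le> action W r z p" and eq: "abs_action W r z p = ennreal (action W r z p)"
    and le: "action W r z p \<le> B * r" if "0 \<le> r" "p \<in> space path_space0" for r z p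
  proof -
    show a: "0 \<le> action W r z p" "abs_action W r z p = ennreal (action W r z p)"
      using abs_action_nonneg_eq[OF W01(1) int[OF that]] by auto
    show "action W r z p \<le> B * r"
      using abs_action_le_bound[of r W B z p, OF that(1) absW] a that B by (simp add: ennreal_le_iff)
  qed
  have sp: "shift_increments s (\<lambda>q. X q \<omega>) \<in> space path_space0" if "\<omega> \<in> space M" "0 \<le> s" for s \<omega>
    using measurable_space[OF shift_increments_measurable] that by auto
  define e where "e r z = (\<integral>\<^sup>+\<omega>. ennreal (exp (action W r z (\<lambda>q. X q \<omega>))) \<partial>M)" for r z
  define m where "m = (SUP z\<in>{0..t} \<times> UNIV. e (fst z) (snd z))"
  have e_le: "e r z \<le> ennreal (exp (B * t))" if r: "0 \<le> r" "r \<le> t" for r z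
  proof -
    have "e r z \<le> (\<integral>\<^sup>+\<omega>. ennreal (exp (B * t)) \<partial>M)"
      unfolding e_def
    proof (intro nn_integral_mono ennreal_leI)
      fix \<omega> assume "\<omega> \<in> space M"
      then have "action W r z (\<lambda>q. X q \<omega>) \<le> B * r" using r by (intro le) auto
      also have "\<dots> \<le> B * t" using r B by (intro mult_left_mono)
      finally show "exp (action W r z (\<lambda>q. X q \<omega>)) \<le> exp (B * t)" by simp
    qed
    then show ?thesis by (simp add: emeasure_space_1)
  qed
  have e_m: "e r z \<le> m" if "0 \<le> r" "r \<le> t" for r z
    unfolding m_def using that by (intro SUP_upper2[of "(r, z)"]) auto
  have m_fin: "m \<le> ennreal (exp (B * t))"
    unfolding m_def using e_le by (intro SUP_least) auto
  \<comment> \<open>Telescoping \<open>exp (a n) - 1\<close> over a fine partition bounds \<open>e\<close> by its own supremum.\<close>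
  have step: "e r x \<le> 1 + ennreal (1 / 2) * m" if r: "0 \<le> r" "r \<le> t" for r x
  proof -
    \<comment> \<open>The partition is so fine that the action over one cell is at most 1.\<close>
    obtain N0 :: nat where "B * r \<le> real N0" using real_arch_simple by blast
    define N where "N = Suc N0"
    have N: "0 < N" "B * (r / N) \<le> 1" using \<open>B * r \<le> real N0\<close> by (auto simp: N_def field_simps)
    define s where "s k = real k * (r / N)" for k
    have s: "0 \<le> s k" "s k \<le> s (Suc k)" "s (Suc k) = s k + r / N" for k
      using r N by (auto simp: s_def field_simps)
    have sN: "s N = r" using N by (simp add: s_def)
    have s_le: "s k \<le> r" if "k \<le> N" for k
      using that r N by (simp add: s_def field_simps mult_left_mono)
    define a where "a k \<omega> = action W (s k) x (\<lambda>q. X q \<omega>)" for k \<omega>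
    have a_meas[measurable]: "a k \<in> borel_measurable M" for k
      unfolding a_def[abs_def] using s(1) by simp
    have d: "a (Suc k) \<omega> - a k \<omega> = action W (r / N) (x + X (s k) \<omega>) (shift_increments (s k) (\<lambda>q. X q \<omega>))"
      if "\<omega> \<in> space M" for k \<omega>
    proof -
      have "0 \<le> r / N" using r by simp
      moreover from this have "set_integrable lborel {0..s k + r / N} (\<lambda>q. W (x + X q \<omega>))"
        using int[of "s k + r / N" "\<lambda>q. X q \<omega>" x] that s(1)[of k] by simp
      ultimately show ?thesis
        unfolding a_def s(3) using action_add[of "s k" "r / N" W x "\<lambda>q. X q \<omega>"] s(1)[of k] by simp
    qed
    have d01: "0 \<le> a (Suc k) \<omega> - a k \<omega>" "a (Suc k) \<omega> - a k \<omega> \<le> 1" if \<omega>: "\<omega> \<in> space M" for k \<omega>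
    proof -
      have rN: "0 \<le> r / N" using r by simp
      show "0 \<le> a (Suc k) \<omega> - a k \<omega>" "a (Suc k) \<omega> - a k \<omega> \<le> 1"
        unfolding d[OF \<omega>] using nn[OF rN sp[OF \<omega> s(1)]] le[OF rN sp[OF \<omega> s(1)]] N(2)
        by (blast intro: order_trans)+
    qed
    have aN: "a N \<omega> = a k \<omega> + action W (r - s k) (x + X (s k) \<omega>) (shift_increments (s k) (\<lambda>q. X q \<omega>))"
      if "\<omega> \<in> space M" "k \<le> N" for k \<omega>
      unfolding a_def sN using action_add[OF s(1)[of k], of "r - s k" W x "\<lambda>q. X q \<omega>"]
        int[of r "\<lambda>q. X q \<omega>" x] r s_le[of k] that by simp
    have a0: "a 0 \<omega> = 0" for \<omega>
      unfolding a_def s_def action_def set_lebesgue_integral_def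
      by (rule integral_eq_zero_AE, rule AE_mp[OF AE_lborel_singleton[of 0]]) (auto simp: indicator_def)
    \<comment> \<open>Here \<open>a k\<close> is the action up to the partition point \<open>s k\<close>.\<close>
    have tele: "exp (a N \<omega>) \<le> 1 + (\<Sum>k<N. 2 * (a (Suc k) \<omega> - a k \<omega>) * exp (a N \<omega> - a (Suc k) \<omega>))"
      if \<omega>: "\<omega> \<in> space M" for \<omega>
    proof -
      have "exp (a N \<omega>) - 1 = (\<Sum>k<N. exp (a N \<omega> - a k \<omega>) - exp (a N \<omega> - a (Suc k) \<omega>))"
        by (subst sum_lessThan_telescope') (simp add: a0)
      also have "\<dots> \<le> (\<Sum>k<N. 2 * (a (Suc k) \<omega> - a k \<omega>) * exp (a N \<omega> - a (Suc k) \<omega>))"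
      proof (rule sum_mono)
        fix k
        have "exp (a N \<omega> - a k \<omega>) - exp (a N \<omega> - a (Suc k) \<omega>)
            = (exp (a (Suc k) \<omega> - a k \<omega>) - 1) * exp (a N \<omega> - a (Suc k) \<omega>)"
          by (simp add: algebra_simps flip: exp_add)
        also have "\<dots> \<le> 2 * (a (Suc k) \<omega> - a k \<omega>) * exp (a N \<omega> - a (Suc k) \<omega>)"
          using exp_le_one_plus_double[OF d01[OF \<omega>]] by (intro mult_right_mono) auto
        finally show "exp (a N \<omega> - a k \<omega>) - exp (a N \<omega> - a (Suc k) \<omega>)
            \<le> 2 * (a (Suc k) \<omega> - a k \<omega>) * exp (a N \<omega> - a (Suc k) \<omega>)" .
      qed
      finally show ?thesis by simp
    qed
    have summand: "(\<integral>\<^sup>+\<omega>. ennreal (a (Suc k) \<omega> - a k \<omega>) * ennreal (exp (a N \<omega> - a (Suc k) \<omega>)) \<partial>M)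
        \<le> m * (\<integral>\<^sup>+\<omega>. ennreal (a (Suc k) \<omega> - a k \<omega>) \<partial>M)" if k: "k < N" for k
    proof -
      let ?s = "s (Suc k)"
      let ?J = "\<lambda>(z, p). ennreal (exp (action W (r - ?s) z p))"
      have rs: "0 \<le> r - ?s" using s_le[of "Suc k"] k by simp
      have J: "?J \<in> borel_measurable (borel \<Otimes>\<^sub>M path_space0)"
        using measurable_action_path(1)[OF rs W] by (simp add: split_beta')
      have F: "(\<lambda>\<omega>. ennreal (a (Suc k) \<omega> - a k \<omega>)) \<in> borel_measurable (past ?s)"
        unfolding a_def
        using measurable_action_past[OF s(1) order_refl W] measurable_action_past[OF s(1) s(2) W] by measurable
      have "(\<integral>\<^sup>+\<omega>. ennreal (a (Suc k) \<omega> - a k \<omega>) * ennreal (exp (a N \<omega> - a (Suc k) \<omega>)) \<partial>M)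
        = (\<integral>\<^sup>+\<omega>. ennreal (a (Suc k) \<omega> - a k \<omega>) * ?J (x + X ?s \<omega>, shift_increments ?s (\<lambda>t. X t \<omega>)) \<partial>M)"
        using k by (intro nn_integral_cong) (simp add: aN[of _ "Suc k"])
      also have "\<dots> = (\<integral>\<^sup>+\<omega>. ennreal (a (Suc k) \<omega> - a k \<omega>) * (\<integral>\<^sup>+\<omega>'. ?J (x + X ?s \<omega>, \<lambda>t. X t \<omega>') \<partial>M) \<partial>M)"
        by (rule markov_property[OF s(1) F J])
      also have "\<dots> = (\<integral>\<^sup>+\<omega>. ennreal (a (Suc k) \<omega> - a k \<omega>) * e (r - ?s) (x + X ?s \<omega>) \<partial>M)"
        by (simp add: e_def)
      also have "\<dots> \<le> (\<integral>\<^sup>+\<omega>. m * ennreal (a (Suc k) \<omega> - a k \<omega>) \<partial>M)"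
        using rs s(1)[of "Suc k"] r by (subst mult.commute, intro nn_integral_mono mult_right_mono e_m) auto
      also have "\<dots> = m * (\<integral>\<^sup>+\<omega>. ennreal (a (Suc k) \<omega> - a k \<omega>) \<partial>M)"
        by (rule nn_integral_cmult) measurable
      finally show ?thesis .
    qed
    have "e r x \<le> (\<integral>\<^sup>+\<omega>. 1 + (\<Sum>k<N. 2 * (ennreal (a (Suc k) \<omega> - a k \<omega>) * ennreal (exp (a N \<omega> - a (Suc k) \<omega>)))) \<partial>M)"
      unfolding e_def
    proof (rule nn_integral_mono)
      fix \<omega> assume \<omega>: "\<omega> \<in> space M"
      have "ennreal (exp (action W r x (\<lambda>q. X q \<omega>))) \<le> ennreal (1 + (\<Sum>k<N. 2 * (a (Suc k) \<omega> - a k \<omega>) * exp (a N \<omega> - a (Suc k) \<omega>)))"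
        using tele[OF \<omega>] sN by (intro ennreal_leI) (simp add: a_def)
      also have "\<dots> = 1 + (\<Sum>k<N. 2 * (ennreal (a (Suc k) \<omega> - a k \<omega>) * ennreal (exp (a N \<omega> - a (Suc k) \<omega>))))"
      proof -
        have "ennreal (2 * (a (Suc k) \<omega> - a k \<omega>) * exp (a N \<omega> - a (Suc k) \<omega>))
          = 2 * (ennreal (a (Suc k) \<omega> - a k \<omega>) * ennreal (exp (a N \<omega> - a (Suc k) \<omega>)))" for k
          using d01(1)[OF \<omega>, of k] by (simp add: ennreal_mult mult.assoc del: right_diff_distrib_numeral)
        moreover have "ennreal (\<Sum>k<N. 2 * (a (Suc k) \<omega> - a k \<omega>) * exp (a N \<omega> - a (Suc k) \<omega>))
          = (\<Sum>k<N. ennreal (2 * (a (Suc k) \<omega> - a k \<omega>) * exp (a N \<omega> - a (Suc k) \<omega>)))"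
          using d01(1)[OF \<omega>] by (intro sum_ennreal[symmetric] mult_nonneg_nonneg) auto
        ultimately show ?thesis
          using d01(1)[OF \<omega>] by (subst ennreal_plus) (auto intro!: sum_nonneg mult_nonneg_nonneg)
      qed
      finally show "ennreal (exp (action W r x (\<lambda>q. X q \<omega>)))
          \<le> 1 + (\<Sum>k<N. 2 * (ennreal (a (Suc k) \<omega> - a k \<omega>) * ennreal (exp (a N \<omega> - a (Suc k) \<omega>))))" .
    qed
    also have "\<dots> = 1 + (\<Sum>k<N. 2 * (\<integral>\<^sup>+\<omega>. ennreal (a (Suc k) \<omega> - a k \<omega>) * ennreal (exp (a N \<omega> - a (Suc k) \<omega>)) \<partial>M))"
      by (simp add: nn_integral_add nn_integral_sum nn_integral_cmult emeasure_space_1)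
    also have "\<dots> \<le> 1 + (\<Sum>k<N. 2 * (m * (\<integral>\<^sup>+\<omega>. ennreal (a (Suc k) \<omega> - a k \<omega>) \<partial>M)))"
      using summand by (intro add_left_mono sum_mono mult_left_mono) auto
    also have "(\<Sum>k<N. 2 * (m * (\<integral>\<^sup>+\<omega>. ennreal (a (Suc k) \<omega> - a k \<omega>) \<partial>M)))
        = 2 * m * (\<integral>\<^sup>+\<omega>. (\<Sum>k<N. ennreal (a (Suc k) \<omega> - a k \<omega>)) \<partial>M)"
      by (simp add: nn_integral_sum sum_distrib_left mult.assoc)
    also have "(\<integral>\<^sup>+\<omega>. (\<Sum>k<N. ennreal (a (Suc k) \<omega> - a k \<omega>)) \<partial>M) \<le> (\<integral>\<^sup>+\<omega>. abs_action W t x (\<lambda>q. X q \<omega>) \<partial>M)"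
    proof (rule nn_integral_mono)
      fix \<omega> assume \<omega>: "\<omega> \<in> space M"
      have "(\<Sum>k<N. ennreal (a (Suc k) \<omega> - a k \<omega>)) = ennreal (\<Sum>k<N. a (Suc k) \<omega> - a k \<omega>)"
        using d01[OF \<omega>] by (intro sum_ennreal) auto
      also have "\<dots> = abs_action W r x (\<lambda>q. X q \<omega>)"
        unfolding sum_lessThan_telescope[of "\<lambda>k. a k \<omega>"] a0 using eq[OF r(1) path_in_space[OF \<omega>]] by (simp add: a_def sN)
      also have "\<dots> \<le> abs_action W t x (\<lambda>q. X q \<omega>)"
        using r unfolding abs_action_def by (intro nn_integral_mono) (auto simp: indicator_def)
      finally show "(\<Sum>k<N. ennreal (a (Suc k) \<omega> - a k \<omega>)) \<le> abs_action W t x (\<lambda>q. X q \<omega>)" .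
    qed
    also have "\<dots> \<le> ennreal (1 / 4)" by (rule small)
    finally have "e r x \<le> 1 + 2 * m * ennreal (1 / 4)" by (simp add: add_left_mono mult_left_mono)
    also have "2 * m * ennreal (1 / 4) = ennreal (1 / 2) * m"
    proof -
      have "2 * ennreal (1 / 4) = ennreal (1/2)"
        using ennreal_mult[of 2 "1/4"] by simp
      then show ?thesis by (simp add: ac_simps)
    qed
    finally show ?thesis .
  qed
  obtain c where c: "0 \<le> c" "m = ennreal c"
    using m_fin by (cases m) (auto simp: top_unique)
  have "m \<le> 1 + ennreal (1 / 2) * m"
    using step by (subst (1) m_def, intro SUP_least) auto
  also have "\<dots> = ennreal 1 + ennreal (1 / 2 * c)"
    unfolding c(2) by (subst ennreal_mult) (use c in auto)
  also have "\<dots> = ennreal (1 + 1 / 2 * c)"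
    using c by (subst ennreal_plus) auto
  finally have le: "ennreal c \<le> ennreal (1 + 1 / 2 * c)" unfolding c(2) .
  have "c \<le> 1 + 1 / 2 * c"
    by (rule iffD1[OF ennreal_le_iff le]) (use c in simp)
  then have "c \<le> 2" by simp
  then have "m \<le> 2" using c by (metis ennreal_leI ennreal_numeral zero_le_numeral)
  then show ?thesis using e_m[of t x] t by (auto simp: e_def)
qed

end

context feynman_kac
begin

text \<open>
Khasminskii's lemma is applied to truncations of the negative part of \<open>V\<close>, whose moments are bounded
independently of the truncation; Fatou's lemma removes the truncation.
\<close>

lemma fk_op_one_small: "\<exists>t0>0. \<forall>t x. 0 \<le> t \<longrightarrow> t \<le> t0 \<longrightarrow> fk_op t (\<lambda>_. 1) x \<le> 2"
proof -
  define Vm where "Vm y = max (- V y) 0" for y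
  define W where "W n y = min (Vm y) (real n)" for n :: nat and y
  have "kato_class M X Vm" using kato by (simp add: kato_decomposable_def Vm_def[abs_def])
  from kato_small[OF this, of "ennreal (1/4)"]
  obtain t0 where t0: "0 < t0" "\<And>t x. 0 \<le> t \<Longrightarrow> t \<le> t0 \<Longrightarrow> (\<integral>\<^sup>+\<omega>. abs_action Vm t x (\<lambda>q. X q \<omega>) \<partial>M) \<le> ennreal (1/4)"
    by auto
  have [measurable]: "Vm \<in> borel_measurable borel" unfolding Vm_def[abs_def] by measurable
  have [measurable]: "W n \<in> borel_measurable borel" for n unfolding W_def[abs_def] by measurable
  have "fk_op t (\<lambda>_. 1) x \<le> 2" if t: "0 \<le> t" "t \<le> t0" for t x
  proof -
    have Wle: "(\<integral>\<^sup>+\<omega>. ennreal (exp (action (W n) t x (\<lambda>q. X q \<omega>))) \<partial>M) \<le> 2" for n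
    proof (rule khasminskii_bounded[where B="real n"])
      fix x
      have "(\<integral>\<^sup>+\<omega>. abs_action (W n) t x (\<lambda>q. X q \<omega>) \<partial>M) \<le> (\<integral>\<^sup>+\<omega>. abs_action Vm t x (\<lambda>q. X q \<omega>) \<partial>M)"
        unfolding abs_action_def
        by (intro nn_integral_mono mult_right_mono ennreal_leI) (auto simp: W_def Vm_def)
      also have "\<dots> \<le> ennreal (1/4)" using t0 t by blast
      finally show "(\<integral>\<^sup>+\<omega>. abs_action (W n) t x (\<lambda>q. X q \<omega>) \<partial>M) \<le> ennreal (1/4)" .
    qed (use t in \<open>auto simp: W_def Vm_def\<close>)
    have "AE \<omega> in M. ennreal (exp (- action V t x (\<lambda>q. X q \<omega>))) * 1
        \<le> liminf (\<lambda>n. ennreal (exp (action (W n) t x (\<lambda>q. X q \<omega>))))"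
      using AE_space AE_abs_action_finite[OF t(1), of x]
    proof eventually_elim
      case (elim \<omega>)
      let ?p = "\<lambda>q. X q \<omega>"
      have iV: "set_integrable lborel {0..t} (\<lambda>q. V (x + ?p q))"
        using elim t by (intro set_integrable_action) auto
      have "abs_action Vm t x ?p \<le> abs_action V t x ?p"
        unfolding abs_action_def by (intro nn_integral_mono mult_right_mono ennreal_leI) (auto simp: Vm_def)
      then have iVm: "set_integrable lborel {0..t} (\<lambda>q. Vm (x + ?p q))"
        using elim t by (intro set_integrable_action) (auto intro: order.strict_trans1)
      have "- action V t x ?p = (LINT q:{0..t}|lborel. - V (x + ?p q))"
        by (simp add: action_def set_lebesgue_integral_def)
      also have "\<dots> \<le> action Vm t x ?p"
        unfolding action_def using iV iVm
        by (intro set_integral_mono) (auto simp: Vm_def set_integrable_def)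
      finally have le: "- action V t x ?p \<le> action Vm t x ?p" .
      have "(\<lambda>n. action (W n) t x ?p) \<longlonglongrightarrow> action Vm t x ?p"
        unfolding action_def set_lebesgue_integral_def
      proof (rule integral_dominated_convergence[where w="\<lambda>q. indicator {0..t} q *\<^sub>R Vm (x + ?p q)"])
        show "(\<lambda>q. indicator {0..t} q *\<^sub>R Vm (x + ?p q)) \<in> borel_measurable lborel"
          "(\<lambda>q. indicator {0..t} q *\<^sub>R W n (x + ?p q)) \<in> borel_measurable lborel" for n
          using set_borel_measurable_action[of ?p t Vm x] set_borel_measurable_action[of ?p t "W n" x] elim t
          by (auto simp: set_borel_measurable_def)
        show "integrable lborel (\<lambda>q. indicator {0..t} q *\<^sub>R Vm (x + ?p q))"
          using iVm by (simp add: set_integrable_def)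
        show "AE q in lborel. (\<lambda>n. indicator {0..t} q *\<^sub>R W n (x + ?p q)) \<longlonglongrightarrow> indicator {0..t} q *\<^sub>R Vm (x + ?p q)"
        proof (intro AE_I2 tendsto_intros)
          fix q
          obtain N :: nat where "Vm (x + ?p q) \<le> real N" using real_arch_simple by blast
          then have "\<forall>\<^sub>F n in sequentially. W n (x + ?p q) = Vm (x + ?p q)"
            by (auto simp: eventually_sequentially W_def min_def intro!: exI[of _ N])
          then show "(\<lambda>n. W n (x + ?p q)) \<longlonglongrightarrow> Vm (x + ?p q)" by (rule tendsto_eventually)
        qed
        show "AE q in lborel. norm (indicator {0..t} q *\<^sub>R W n (x + ?p q)) \<le> indicator {0..t} q *\<^sub>R Vm (x + ?p q)" for n
          by (intro AE_I2) (auto simp: indicator_def W_def Vm_def)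
      qed
      then have "(\<lambda>n. ennreal (exp (action (W n) t x ?p))) \<longlonglongrightarrow> ennreal (exp (action Vm t x ?p))"
        by (intro tendsto_intros)
      then have "liminf (\<lambda>n. ennreal (exp (action (W n) t x ?p))) = ennreal (exp (action Vm t x ?p))"
        by (rule lim_imp_Liminf[rotated]) simp
      then show ?case using le by (simp add: ennreal_leI)
    qed
    then have "fk_op t (\<lambda>_. 1) x \<le> (\<integral>\<^sup>+\<omega>. liminf (\<lambda>n. ennreal (exp (action (W n) t x (\<lambda>q. X q \<omega>)))) \<partial>M)"
      unfolding fk_op_def by (rule nn_integral_mono_AE)
    also have "\<dots> \<le> liminf (\<lambda>n. \<integral>\<^sup>+\<omega>. ennreal (exp (action (W n) t x (\<lambda>q. X q \<omega>))) \<partial>M)"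
      using t by (intro nn_integral_liminf) measurable
    also have "\<dots> \<le> liminf (\<lambda>n. 2)"
      using Wle by (intro Liminf_mono) auto
    finally show ?thesis by (simp add: Liminf_const)
  qed
  then show ?thesis using t0 by blast
qed

text \<open>
The semigroup property multiplies the bounds for short times.
\<close>

lemma fk_op_one_bounded: "\<exists>C\<ge>0. \<forall>t x. 0 \<le> t \<longrightarrow> t \<le> T \<longrightarrow> fk_op t (\<lambda>_. 1) x \<le> ennreal C"
proof -
  obtain t0 where t0: "0 < t0" "\<And>t x. 0 \<le> t \<Longrightarrow> t \<le> t0 \<Longrightarrow> fk_op t (\<lambda>_. 1) x \<le> 2"
    using fk_op_one_small by auto
  have "\<forall>t x. 0 \<le> t \<longrightarrow> t \<le> real (Suc n) * t0 \<longrightarrow> fk_op t (\<lambda>_. 1) x \<le> 2 ^ Suc n" for n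
  proof (induction n)
    case 0
    then show ?case using t0 by simp
  next
    case (Suc n)
    show ?case
    proof (intro allI impI)
      fix t x assume t: "0 \<le> t" "t \<le> real (Suc (Suc n)) * t0"
      show "fk_op t (\<lambda>_. 1) x \<le> 2 ^ Suc (Suc n)"
      proof (cases "t \<le> t0")
        case True
        have "fk_op t (\<lambda>_. 1) x \<le> 2 ^ 1" using t0(2)[OF t(1) True] by simp
        also have "\<dots> \<le> (2 ^ Suc (Suc n) :: ennreal)" by (rule power_increasing) auto
        finally show ?thesis .
      next
        case False
        have "fk_op t (\<lambda>_. 1) x = fk_op t0 (fk_op (t - t0) (\<lambda>_. 1)) x"
          using fk_op_add[of t0 "t - t0" "\<lambda>_. 1" x] False t0 by simp
        also have "\<dots> \<le> fk_op t0 (\<lambda>_. 2 ^ Suc n * 1) x"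
        proof (rule fk_op_mono)
          fix y
          have "t - t0 \<le> real (Suc n) * t0" using t by (simp add: algebra_simps)
          then show "fk_op (t - t0) (\<lambda>_. 1) y \<le> 2 ^ Suc n * 1" using Suc False by simp
        qed
        also have "\<dots> = 2 ^ Suc n * fk_op t0 (\<lambda>_. 1) x"
          using t0 by (intro fk_op_cmult) auto
        also have "\<dots> \<le> 2 ^ Suc n * 2" using t0 by (intro mult_left_mono) auto
        finally show ?thesis by (simp add: mult.commute)
      qed
    qed
  qed
  moreover obtain n :: nat where "T / t0 \<le> real n" using real_arch_simple by blast
  then have "T \<le> real (Suc n) * t0" using t0 by (simp add: field_simps)
  ultimately have "\<forall>t x. 0 \<le> t \<longrightarrow> t \<le> T \<longrightarrow> fk_op t (\<lambda>_. 1) x \<le> ennreal (2 ^ Suc n)"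
    by (auto intro: order_trans simp: ennreal_power[symmetric] simp del: power_Suc)
  then show ?thesis by (intro exI[of _ "2 ^ Suc n"]) auto
qed

lemma fk_op_one_finite: "0 \<le> t \<Longrightarrow> fk_op t (\<lambda>_. 1) x < \<top>"
  using fk_op_one_bounded[of t] by (metis ennreal_less_top order.refl order.strict_trans1)

end

section \<open>Kernel and ground state\<close>

text \<open>
A substitute for the Cauchy-Schwarz inequality that avoids square roots; the weight \<open>c\<close> is optimised
where it is used.
\<close>

lemma ennreal_mult_le_weighted_squares:
  fixes a b :: ennreal
  assumes "0 < c"
  shows "a * b \<le> ennreal (1 / c) * (a * a) + ennreal c * (b * b)"
proof -
  have c: "ennreal (1 / c) * ennreal c = 1"
    using assms by (simp add: ennreal_mult[symmetric])
  show ?thesis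
  proof (cases "a \<le> ennreal c * b")
    case True
    then have "a * b \<le> ennreal c * b * b" by (rule mult_right_mono) simp
    then show ?thesis by (simp add: mult.assoc add_increasing)
  next
    case False
    then have "ennreal (1 / c) * (ennreal c * b) \<le> ennreal (1 / c) * a" by (intro mult_left_mono) auto
    then have "b \<le> ennreal (1 / c) * a" using c by (simp add: mult.assoc[symmetric])
    then have "a * b \<le> a * (ennreal (1 / c) * a)" by (rule mult_left_mono) simp
    also have "\<dots> = ennreal (1 / c) * (a * a)" by (simp add: ac_simps)
    finally show ?thesis by (rule add_increasing2[OF zero_le])
  qed
qed

context feynman_kac
begin

lemma fk_op_plus:
  assumes t: "0 \<le> t" and [measurable]: "f \<in> borel_measurable borel" "g \<in> borel_measurable borel"
  shows "fk_op t (\<lambda>y. f y + g y) x = fk_op t f x + fk_op t g x"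
proof -
  have [measurable]: "X t \<in> borel_measurable M" using t by simp
  show ?thesis
    unfolding fk_op_def distrib_left using t by (intro nn_integral_add) measurable
qed

lemma fk_semigroup_eq:
  assumes t: "0 \<le> t" and [measurable]: "f \<in> borel_measurable borel" and f: "\<And>y. 0 \<le> f y"
  shows "fk_semigroup M X V t f x = enn2real (fk_op t (\<lambda>y. ennreal (f y)) x)"
proof -
  have [measurable]: "X t \<in> borel_measurable M" using t by simp
  have "fk_semigroup M X V t f x = (LINT \<omega>|M. exp (- action V t x (\<lambda>q. X q \<omega>)) * f (x + X t \<omega>))"
    by (simp add: fk_semigroup_def action_def)
  also have "\<dots> = enn2real (\<integral>\<^sup>+\<omega>. ennreal (exp (- action V t x (\<lambda>q. X q \<omega>)) * f (x + X t \<omega>)) \<partial>M)"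
    using t f by (intro integral_eq_nn_integral) auto
  finally have "fk_semigroup M X V t f x = enn2real (\<integral>\<^sup>+\<omega>. ennreal (exp (- action V t x (\<lambda>q. X q \<omega>)) * f (x + X t \<omega>)) \<partial>M)" .
  then show ?thesis using f by (simp add: fk_op_def ennreal_mult)
qed

end

locale fk_with_kernel = feynman_kac M X V
  for M :: "'w measure" and X :: "real \<Rightarrow> 'w \<Rightarrow> 'a::euclidean_space" and V :: "'a \<Rightarrow> real" +
  fixes u :: "real \<Rightarrow> 'a \<Rightarrow> 'a \<Rightarrow> real"
  assumes kernel: "fk_kernel M X V u"
begin

lemma u_pos: "0 < t \<Longrightarrow> 0 < u t x y"
  and u_sym: "0 < t \<Longrightarrow> u t x y = u t y x"
  and u_bounded: "0 < t \<Longrightarrow> bounded (range (\<lambda>(x, y). u t x y))"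
  and u_continuous: "0 < t \<Longrightarrow> continuous_on UNIV (\<lambda>(x, y). u t x y)"
  and u_kernel: "0 < t \<Longrightarrow> f \<in> L2_space \<Longrightarrow> fk_semigroup M X V t f x = (LINT y|lborel. u t x y * f y)"
  using kernel unfolding fk_kernel_def by blast+

lemma u_measurable [measurable]: "0 < t \<Longrightarrow> (\<lambda>(x, y). u t x y) \<in> borel_measurable (borel \<Otimes>\<^sub>M borel)"
  unfolding borel_prod by (intro borel_measurable_continuous_onI u_continuous)

lemma u_measurable1 [measurable]: "0 < t \<Longrightarrow> u t x \<in> borel_measurable borel"
  using measurable_compose[OF _ u_measurable, of "\<lambda>y. (x, y)" borel t] by simp

text \<open>
The hypothesis on the kernel concerns square integrable functions and real integrals. It
identifies two measures on bounded sets, where all quantities are finite, and hence everywhere; so the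
kernel represents the operator on all nonnegative functions.
\<close>

lemma fk_op_kernel:
  assumes t: "0 < t" and f: "f \<in> borel_measurable borel"
  shows "fk_op t f x = (\<integral>\<^sup>+y. ennreal (u t x y) * f y \<partial>lborel)"
proof -
  have t': "0 \<le> t" using t by simp
  note [measurable] = u_measurable1[OF t] X_measurable[OF t'] measurable_action_M1(1)[OF t' V_measurable]
  define \<mu>1 where "\<mu>1 = distr (density M (\<lambda>\<omega>. ennreal (exp (- action V t x (\<lambda>q. X q \<omega>))))) borel (\<lambda>\<omega>. x + X t \<omega>)"
  define \<mu>2 where "\<mu>2 = density lborel (\<lambda>y. ennreal (u t x y))"
  have n1: "(\<integral>\<^sup>+y. g y \<partial>\<mu>1) = fk_op t g x" if [measurable]: "g \<in> borel_measurable borel" for g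
    unfolding \<mu>1_def fk_op_def by (simp add: nn_integral_distr nn_integral_density)
  have n2: "(\<integral>\<^sup>+y. g y \<partial>\<mu>2) = (\<integral>\<^sup>+y. ennreal (u t x y) * g y \<partial>lborel)" if [measurable]: "g \<in> borel_measurable borel" for g
    unfolding \<mu>2_def by (simp add: nn_integral_density)
  have s: "sets \<mu>1 = sets borel" "sets \<mu>2 = sets borel" by (auto simp: \<mu>1_def \<mu>2_def)
  have bdd: "emeasure \<mu>1 A = emeasure \<mu>2 A" if A[measurable]: "A \<in> sets borel" and "bounded A" for A
  proof -
    have finA: "emeasure lborel A < \<infinity>" using emeasure_bounded_finite[OF \<open>bounded A\<close>] by simp
    have ind2: "ennreal ((indicator A y)\<^sup>2) = indicator A y" for y :: 'a by (auto simp: indicator_def)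
    then have "indicator A \<in> L2_space"
      unfolding L2_space_def l2_norm_sq_def using finA by simp
    then have "fk_semigroup M X V t (indicator A) x = (LINT y|lborel. u t x y * indicator A y)"
      by (rule u_kernel[OF t])
    moreover have "fk_semigroup M X V t (indicator A) x = enn2real (fk_op t (indicator A) x)"
      using fk_semigroup_eq[OF t', of "indicator A" x] by (simp add: ennreal_indicator)
    moreover have fin1: "fk_op t (indicator A) x < \<top>"
    proof -
      have "fk_op t (indicator A) x \<le> fk_op t (\<lambda>_. 1) x" by (intro fk_op_mono) (auto simp: indicator_def)
      then show ?thesis using fk_op_one_finite[OF t'] by (rule order.strict_trans1)
    qed
    moreover have "(\<integral>\<^sup>+y. ennreal (u t x y) * indicator A y \<partial>lborel) = ennreal (LINT y|lborel. u t x y * indicator A y)"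
    proof -
      obtain B where B: "\<And>x y. norm (u t x y) \<le> B" using u_bounded[OF t] unfolding bounded_iff by auto
      have "integrable lborel (\<lambda>y. u t x y * indicator A y)"
      proof (intro integrableI_bounded)
        have "(\<integral>\<^sup>+y. ennreal (norm (u t x y * indicator A y)) \<partial>lborel) \<le> (\<integral>\<^sup>+y. ennreal B * indicator A y \<partial>lborel)"
          using B[of x] by (intro nn_integral_mono) (auto simp: indicator_def intro!: ennreal_leI)
        also have "\<dots> < \<infinity>" using finA by (simp add: nn_integral_cmult ennreal_mult_less_top)
        finally show "(\<integral>\<^sup>+y. ennreal (norm (u t x y * indicator A y)) \<partial>lborel) < \<infinity>" .
      qed simp
      then show ?thesis
        using u_pos[OF t] by (subst nn_integral_eq_integral[symmetric])
          (auto simp: less_imp_le ennreal_mult ennreal_indicator)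
    qed
    ultimately have "fk_op t (indicator A) x = (\<integral>\<^sup>+y. ennreal (u t x y) * indicator A y \<partial>lborel)"
      using ennreal_enn2real[of "fk_op t (indicator A) x"] by metis
    then show ?thesis using n1[of "indicator A"] n2[of "indicator A"] s by simp
  qed
  have "\<mu>1 = \<mu>2"
  proof (rule measure_eqI)
    fix A assume "A \<in> sets \<mu>1"
    then have A[measurable]: "A \<in> sets borel" using s by simp
    let ?A = "\<lambda>n. A \<inter> ball 0 (real n)"
    have inc: "incseq ?A" by (auto simp: incseq_def)
    have rng: "range ?A \<subseteq> sets borel" by auto
    have U: "(\<Union>n. ?A n) = A"
      using reals_Archimedean2 by (auto simp: mem_ball) 
    have "emeasure \<mu>1 A = (SUP n. emeasure \<mu>1 (?A n))"
      using SUP_emeasure_incseq[of ?A \<mu>1] rng inc s unfolding U by simp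
    also have "\<dots> = (SUP n. emeasure \<mu>2 (?A n))"
      by (intro SUP_cong refl bdd) (auto intro: bounded_Int)
    also have "\<dots> = emeasure \<mu>2 A"
      using SUP_emeasure_incseq[of ?A \<mu>2] rng inc s unfolding U by simp
    finally show "emeasure \<mu>1 A = emeasure \<mu>2 A" .
  qed (use s in simp)
  then show ?thesis using n1[OF f] n2[OF f] by simp
qed

lemma fk_op_cong_AE:
  assumes "0 < t" "f \<in> borel_measurable borel" "g \<in> borel_measurable borel" "AE y in lborel. f y = g y"
  shows "fk_op t f x = fk_op t g x"
  using assms by (simp add: fk_op_kernel) (intro nn_integral_cong_AE, auto)

lemma fk_op_symmetric:
  assumes t: "0 \<le> t" and [measurable]: "f \<in> borel_measurable borel" "g \<in> borel_measurable borel"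
  shows "(\<integral>\<^sup>+x. f x * fk_op t g x \<partial>lborel) = (\<integral>\<^sup>+x. g x * fk_op t f x \<partial>lborel)"
proof (cases "t = 0")
  case True
  then show ?thesis by (simp add: fk_op_0 mult.commute)
next
  case False
  then have t': "0 < t" using t by simp
  have [measurable]: "(\<lambda>z. u t (fst z) (snd z)) \<in> borel_measurable (borel \<Otimes>\<^sub>M borel)"
    using u_measurable[OF t'] by (simp add: split_beta')
  have "(\<integral>\<^sup>+x. f x * fk_op t g x \<partial>lborel) = (\<integral>\<^sup>+x. (\<integral>\<^sup>+y. f x * (ennreal (u t x y) * g y) \<partial>lborel) \<partial>lborel)"
    using u_measurable1[OF t'] by (simp add: fk_op_kernel[OF t'] nn_integral_cmult)
  also have "\<dots> = (\<integral>\<^sup>+y. (\<integral>\<^sup>+x. f x * (ennreal (u t x y) * g y) \<partial>lborel) \<partial>lborel)"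
    by (rule lborel_pair.Fubini'[symmetric]) (simp add: split_beta')
  also have "\<dots> = (\<integral>\<^sup>+y. (\<integral>\<^sup>+x. g y * (ennreal (u t y x) * f x) \<partial>lborel) \<partial>lborel)"
    by (simp add: u_sym[OF t', of y for y] ac_simps)
  also have "\<dots> = (\<integral>\<^sup>+y. g y * fk_op t f y \<partial>lborel)"
    using u_measurable1[OF t'] by (simp add: fk_op_kernel[OF t'] nn_integral_cmult)
  finally show ?thesis .
qed

end

locale fk_ground = fk_with_kernel M X V u
  for M :: "'w measure" and X :: "real \<Rightarrow> 'w \<Rightarrow> 'a::euclidean_space" and V :: "'a \<Rightarrow> real" and u +
  fixes l :: real and \<phi> :: "'a \<Rightarrow> real"
  assumes ground: "ground_state (fk_hamiltonian M X V) l \<phi>"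
begin

lemma phi_pos: "0 < \<phi> x"
  and phi_continuous: "continuous_on UNIV \<phi>"
  and phi_norm: "l2_norm_sq \<phi> = 1"
  and phi_bounded: "bounded (range \<phi>)"
  using ground by (auto simp: ground_state_def)

lemma phi_measurable [measurable]: "\<phi> \<in> borel_measurable borel"
  using borel_measurable_continuous_onI[OF phi_continuous] .

text \<open>
The function \<open>e\<^bsup>lt\<^esup> T\<^sub>t \<phi>\<close>, which is to be shown equal to \<open>\<phi>\<close>.
\<close>

definition scaled :: "real \<Rightarrow> 'a \<Rightarrow> ennreal" where
  "scaled t x = ennreal (exp (l * t)) * fk_op t (\<lambda>y. ennreal (\<phi> y)) x"

definition defect :: "real \<Rightarrow> 'a \<Rightarrow> real" where
  "defect t x = \<phi> x - enn2real (scaled t x)"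

lemma exp_cancel: "ennreal (exp (- l * t)) * (ennreal (exp (l * t)) * c) = c"
proof -
  have "ennreal (exp (- l * t)) * ennreal (exp (l * t)) = ennreal (exp (- l * t) * exp (l * t))"
    by (rule ennreal_mult[symmetric]) auto
  also have "exp (- l * t) * exp (l * t) = 1" by (simp flip: exp_add)
  finally show ?thesis by (simp add: mult.assoc[symmetric])
qed

lemma scaled_measurable [measurable]: "0 \<le> t \<Longrightarrow> scaled t \<in> borel_measurable borel"
  unfolding scaled_def[abs_def] by measurable

lemma defect_measurable [measurable]: "0 \<le> t \<Longrightarrow> defect t \<in> borel_measurable borel"
  unfolding defect_def[abs_def] by measurable

lemma scaled_finite: "0 \<le> t \<Longrightarrow> scaled t x < \<top>"
proof -
  assume t: "0 \<le> t"
  obtain B where B: "\<And>y. \<phi> y \<le> B" using phi_bounded unfolding bounded_iff by (metis abs_le_D1 rangeI real_norm_def)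
  have "fk_op t (\<lambda>y. ennreal (\<phi> y)) x \<le> fk_op t (\<lambda>y. ennreal B * 1) x"
    using B by (intro fk_op_mono) (simp add: ennreal_leI)
  also have "\<dots> = ennreal B * fk_op t (\<lambda>_. 1) x" by (rule fk_op_cmult[OF t]) simp
  also have "\<dots> < \<top>" using fk_op_one_finite[OF t] by (simp add: ennreal_mult_less_top)
  finally show ?thesis by (simp add: scaled_def ennreal_mult_less_top)
qed

lemma scaled_add: "0 \<le> s \<Longrightarrow> 0 \<le> t \<Longrightarrow> scaled (s + t) x = ennreal (exp (l * s)) * fk_op s (scaled t) x"
proof -
  assume st: "0 \<le> s" "0 \<le> t"
  have "ennreal (exp (l * s)) * fk_op s (scaled t) x
     = ennreal (exp (l * s)) * (ennreal (exp (l * t)) * fk_op s (fk_op t (\<lambda>y. ennreal (\<phi> y))) x)"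
    unfolding scaled_def[abs_def] using st by (subst fk_op_cmult) auto
  also have "\<dots> = scaled (s + t) x"
    using st by (simp add: scaled_def fk_op_add distrib_left exp_add ennreal_mult mult.assoc)
  finally show ?thesis by simp
qed

text \<open>
In \<open>L\<^sup>2\<close>, \<open>\<phi> - e\<^bsup>lh\<^esup> T\<^sub>h \<phi> = o(h)\<close>. This is the eigenvalue equation for the generator: the quotient by
\<open>h\<close> differs from \<open>e\<^bsup>lh\<^esup> ((\<phi> - T\<^sub>h \<phi>)/h - l \<phi>)\<close> by a multiple of \<open>\<phi>\<close> whose coefficient tends to 0.
\<close>

lemma defect_small: "((\<lambda>h. \<integral>\<^sup>+x. ennreal ((defect h x / h)\<^sup>2) \<partial>lborel) \<longlongrightarrow> 0) (at_right 0)"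
proof -
  define G where "G h = l2_norm_sq (\<lambda>x. (\<phi> x - fk_semigroup M X V h \<phi> x) / h - l * \<phi> x)" for h
  define c where "c h = (1 - exp (l * h)) / h + l * exp (l * h)" for h
  have G: "(G \<longlongrightarrow> 0) (at_right 0)"
    using ground unfolding ground_state_def fk_hamiltonian_def semigroup_hamiltonian_def G_def[abs_def] by simp
  have "((\<lambda>h. exp (l * h)) has_real_derivative l) (at 0)"
    by (auto intro!: derivative_eq_intros)
  then have "((\<lambda>h. (exp (l * h) - 1) / h) \<longlongrightarrow> l) (at_right 0)"
    unfolding has_field_derivative_iff by (auto intro: tendsto_within_subset)
  then have "((\<lambda>h. - ((exp (l * h) - 1) / h) + l * exp (l * h)) \<longlongrightarrow> - l + l * exp (l * 0)) (at_right 0)"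
    by (intro tendsto_intros)
  then have c: "(c \<longlongrightarrow> 0) (at_right 0)"
    unfolding c_def[abs_def] by (simp add: minus_divide_left)
  have "((\<lambda>h. ennreal (2 * exp (2 * l * h)) * G h + ennreal (2 * (c h)\<^sup>2)) \<longlongrightarrow> ennreal (2 * exp (2 * l * 0)) * 0 + ennreal (2 * 0\<^sup>2)) (at_right 0)"
    by (intro tendsto_intros tendsto_mult_ennreal G c) auto
  then have lim: "((\<lambda>h. ennreal (2 * exp (2 * l * h)) * G h + ennreal (2 * (c h)\<^sup>2)) \<longlongrightarrow> 0) (at_right 0)" by simp
  show ?thesis
  proof (rule tendsto_sandwich[OF _ _ tendsto_const lim])
    show "\<forall>\<^sub>F h in at_right 0. (\<integral>\<^sup>+x. ennreal ((defect h x / h)\<^sup>2) \<partial>lborel)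
        \<le> ennreal (2 * exp (2 * l * h)) * G h + ennreal (2 * (c h)\<^sup>2)"
      unfolding eventually_at_right_field
    proof (intro exI[of _ 1] conjI allI impI)
      fix h :: real assume h: "0 < h" "h < 1"
      have fk: "fk_semigroup M X V h \<phi> x = enn2real (fk_op h (\<lambda>y. ennreal (\<phi> y)) x)" for x
        using h phi_pos by (intro fk_semigroup_eq) (auto intro: less_imp_le)
      have [measurable]: "fk_semigroup M X V h \<phi> \<in> borel_measurable borel"
        using h fk_op_measurable[of h "\<lambda>y. ennreal (\<phi> y)"] unfolding fk[abs_def] by simp
      define g where "g x = (\<phi> x - fk_semigroup M X V h \<phi> x) / h - l * \<phi> x" for x
      have [measurable]: "g \<in> borel_measurable borel" unfolding g_def[abs_def] by measurable
      have dec: "defect h x / h = exp (l * h) * g x + c h * \<phi> x" for x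
        using h by (simp add: defect_def scaled_def fk g_def c_def enn2real_mult field_simps)
      have sq: "(defect h x / h)\<^sup>2 \<le> 2 * exp (2 * l * h) * (g x)\<^sup>2 + 2 * (c h)\<^sup>2 * (\<phi> x)\<^sup>2" for x
      proof -
        have "(a + b)\<^sup>2 \<le> 2 * a\<^sup>2 + 2 * b\<^sup>2" for a b :: real
          using zero_le_power2[of "a - b"] by (simp add: power2_sum power2_diff)
        from this[of "exp (l * h) * g x" "c h * \<phi> x"] show ?thesis
          unfolding dec by (simp add: power_mult_distrib exp_double[symmetric] mult.assoc)
      qed
      have "(\<integral>\<^sup>+x. ennreal ((defect h x / h)\<^sup>2) \<partial>lborel)
          \<le> (\<integral>\<^sup>+x. ennreal (2 * exp (2 * l * h)) * ennreal ((g x)\<^sup>2) + ennreal (2 * (c h)\<^sup>2) * ennreal ((\<phi> x)\<^sup>2) \<partial>lborel)"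
        using sq by (intro nn_integral_mono) (simp add: ennreal_leI flip: ennreal_mult ennreal_plus)
      also have "\<dots> = ennreal (2 * exp (2 * l * h)) * (\<integral>\<^sup>+x. ennreal ((g x)\<^sup>2) \<partial>lborel)
          + ennreal (2 * (c h)\<^sup>2) * (\<integral>\<^sup>+x. ennreal ((\<phi> x)\<^sup>2) \<partial>lborel)"
        by (subst nn_integral_add) (simp_all add: nn_integral_cmult)
      also have "\<dots> = ennreal (2 * exp (2 * l * h)) * G h + ennreal (2 * (c h)\<^sup>2)"
        using phi_norm unfolding l2_norm_sq_def G_def g_def by simp
      finally show "(\<integral>\<^sup>+x. ennreal ((defect h x / h)\<^sup>2) \<partial>lborel)
        \<le> ennreal (2 * exp (2 * l * h)) * G h + ennreal (2 * (c h)\<^sup>2)" .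
    qed simp
  qed simp
qed

text \<open>
Bound for the difference of \<open>scaled\<close> at the times \<open>k h\<close> and \<open>(k + 1) h\<close>.
\<close>

definition step_error :: "real \<Rightarrow> nat \<Rightarrow> 'a \<Rightarrow> ennreal" where
  "step_error h k x = ennreal (exp (l * (real k * h))) * fk_op (real k * h) (\<lambda>y. ennreal \<bar>defect h y\<bar>) x"

text \<open>
Both inequalities are needed, as \<open>scaled\<close> has values in \<open>[0, \<infinity>]\<close> and cannot be subtracted.
\<close>

lemma scaled_telescope:
  assumes h: "0 \<le> h"
  shows "ennreal (\<phi> x) \<le> scaled (real k * h) x + (\<Sum>j<k. step_error h j x)"
    and "scaled (real k * h) x \<le> ennreal (\<phi> x) + (\<Sum>j<k. step_error h j x)"
proof -
  have d1: "ennreal (\<phi> y) \<le> scaled h y + ennreal \<bar>defect h y\<bar>"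
    and d2: "scaled h y \<le> ennreal (\<phi> y) + ennreal \<bar>defect h y\<bar>" for y
  proof -
    obtain s where s: "scaled h y = ennreal s" "0 \<le> s" using scaled_finite[OF h, of y] by (cases "scaled h y") auto
    show "ennreal (\<phi> y) \<le> scaled h y + ennreal \<bar>defect h y\<bar>" "scaled h y \<le> ennreal (\<phi> y) + ennreal \<bar>defect h y\<bar>"
      using s phi_pos[of y] by (auto simp: defect_def simp flip: ennreal_plus intro!: ennreal_leI)
  qed
  have kh: "0 \<le> real k * h" for k using h by simp
  have Suc: "scaled (real (Suc k) * h) x = ennreal (exp (l * (real k * h))) * fk_op (real k * h) (scaled h) x" for k x
    using scaled_add[OF kh h, of k x] by (simp add: algebra_simps)
  have s1: "scaled (real k * h) x \<le> scaled (real (Suc k) * h) x + step_error h k x" for k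
  proof -
    have "scaled (real k * h) x \<le> ennreal (exp (l * (real k * h))) * fk_op (real k * h) (\<lambda>y. scaled h y + ennreal \<bar>defect h y\<bar>) x"
      unfolding scaled_def[of "real k * h"] using d1 by (intro mult_left_mono fk_op_mono) auto
    also have "\<dots> = scaled (real (Suc k) * h) x + step_error h k x"
      unfolding Suc step_error_def using kh h by (subst fk_op_plus) (auto simp: distrib_left)
    finally show ?thesis .
  qed
  have s2: "scaled (real (Suc k) * h) x \<le> scaled (real k * h) x + step_error h k x" for k
  proof -
    have "scaled (real (Suc k) * h) x \<le> ennreal (exp (l * (real k * h))) * fk_op (real k * h) (\<lambda>y. ennreal (\<phi> y) + ennreal \<bar>defect h y\<bar>) x"
      unfolding Suc using d2 by (intro mult_left_mono fk_op_mono) auto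
    also have "\<dots> = scaled (real k * h) x + step_error h k x"
      unfolding scaled_def step_error_def using kh h by (subst fk_op_plus) (auto simp: distrib_left)
    finally show ?thesis .
  qed
  have "ennreal (\<phi> x) \<le> scaled (real k * h) x + (\<Sum>j<k. step_error h j x)
     \<and> scaled (real k * h) x \<le> ennreal (\<phi> x) + (\<Sum>j<k. step_error h j x)"
  proof (induction k)
    case 0
    show ?case by (simp add: scaled_def fk_op_0)
  next
    case (Suc k)
    have "ennreal (\<phi> x) \<le> (scaled (real (Suc k) * h) x + step_error h k x) + (\<Sum>j<k. step_error h j x)"
      using Suc s1[of k] by (meson add_right_mono order_trans)
    moreover have "scaled (real (Suc k) * h) x \<le> (ennreal (\<phi> x) + (\<Sum>j<k. step_error h j x)) + step_error h k x"
      using Suc s2[of k] by (meson add_right_mono order_trans)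
    ultimately show ?case by (simp add: ac_simps)
  qed
  then show "ennreal (\<phi> x) \<le> scaled (real k * h) x + (\<Sum>j<k. step_error h j x)"
    and "scaled (real k * h) x \<le> ennreal (\<phi> x) + (\<Sum>j<k. step_error h j x)" by auto
qed

text \<open>
By symmetry of the semigroup the integral over \<open>K\<close> is the integral of the defect against
\<open>T\<^bsub>kh\<^esub> 1\<^bsub>K\<^esub>\<close>. The latter function is at most \<open>C\<close>, and its integral is at most \<open>C\<close> times the volume of
\<open>K\<close>, again by symmetry, so that its \<open>L\<^sup>2\<close> norm is bounded independently of \<open>k\<close>.
\<close>

lemma step_error_integral:
  assumes K[measurable]: "K \<in> sets borel" and h: "0 < h" and kh: "real k * h \<le> T"
    and C: "\<And>t x. 0 \<le> t \<Longrightarrow> t \<le> T \<Longrightarrow> fk_op t (\<lambda>_. 1) x \<le> ennreal C" "0 \<le> C" and c: "0 < c"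
  shows "(\<integral>\<^sup>+x. step_error h k x * indicator K x \<partial>lborel)
    \<le> ennreal (exp (\<bar>l\<bar> * T)) * (ennreal (h\<^sup>2 / c) * (\<integral>\<^sup>+x. ennreal ((defect h x / h)\<^sup>2) \<partial>lborel) + ennreal (c * C\<^sup>2) * emeasure lborel K)"
proof -
  define a where "a = real k * h"
  have a: "0 \<le> a" "a \<le> T" using h kh by (auto simp: a_def)
  have h0: "0 \<le> h" using h by simp
  note [measurable] = defect_measurable[OF h0]
  define f where "f y = ennreal \<bar>defect h y\<bar>" for y
  define g where "g = fk_op a (indicator K)"
  have [measurable]: "f \<in> borel_measurable borel" unfolding f_def[abs_def] by measurable
  have [measurable]: "g \<in> borel_measurable borel" unfolding g_def using a by measurable
  have "(\<integral>\<^sup>+x. step_error h k x * indicator K x \<partial>lborel)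
     = ennreal (exp (l * a)) * (\<integral>\<^sup>+x. indicator K x * fk_op a f x \<partial>lborel)"
    unfolding step_error_def a_def[symmetric] f_def[symmetric, abs_def] using a
    by (subst nn_integral_cmult[symmetric]) (auto simp: ac_simps)
  also have "(\<integral>\<^sup>+x. indicator K x * fk_op a f x \<partial>lborel) = (\<integral>\<^sup>+x. f x * g x \<partial>lborel)"
    unfolding g_def by (rule fk_op_symmetric) (use a in auto)
  also have "\<dots> \<le> (\<integral>\<^sup>+x. ennreal (1 / c) * (f x * f x) + ennreal c * (g x * g x) \<partial>lborel)"
    by (intro nn_integral_mono ennreal_mult_le_weighted_squares c)
  also have "\<dots> = ennreal (1 / c) * (\<integral>\<^sup>+x. f x * f x \<partial>lborel) + ennreal c * (\<integral>\<^sup>+x. g x * g x \<partial>lborel)"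
    by (simp add: nn_integral_add nn_integral_cmult)
  also have "(\<integral>\<^sup>+x. f x * f x \<partial>lborel) = ennreal (h\<^sup>2) * (\<integral>\<^sup>+x. ennreal ((defect h x / h)\<^sup>2) \<partial>lborel)"
  proof -
    have "f x * f x = ennreal (h\<^sup>2) * ennreal ((defect h x / h)\<^sup>2)" for x
      unfolding f_def using h by (simp add: power2_eq_square flip: ennreal_mult)
    then show ?thesis by (simp add: nn_integral_cmult)
  qed
  also have "(\<integral>\<^sup>+x. g x * g x \<partial>lborel) \<le> ennreal (C\<^sup>2) * emeasure lborel K"
  proof -
    have gC: "g x \<le> ennreal C" for x
      unfolding g_def using C(1)[OF a, of x]
      by (rule order_trans[rotated]) (intro fk_op_mono, auto simp: indicator_def)
    have "(\<integral>\<^sup>+x. g x * g x \<partial>lborel) \<le> (\<integral>\<^sup>+x. ennreal C * g x \<partial>lborel)"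
      using gC by (intro nn_integral_mono mult_right_mono) auto
    also have "\<dots> = ennreal C * (\<integral>\<^sup>+x. 1 * g x \<partial>lborel)" by (simp add: nn_integral_cmult)
    also have "(\<integral>\<^sup>+x. 1 * g x \<partial>lborel) = (\<integral>\<^sup>+x. indicator K x * fk_op a (\<lambda>_. 1) x \<partial>lborel)"
      unfolding g_def by (rule fk_op_symmetric) (use a in auto)
    also have "\<dots> \<le> (\<integral>\<^sup>+x. ennreal C * indicator K x \<partial>lborel)"
      using C(1)[OF a] by (subst mult.commute, intro nn_integral_mono mult_right_mono) auto
    also have "\<dots> = ennreal C * emeasure lborel K" by (simp add: nn_integral_cmult)
    finally show ?thesis
      using C by (simp add: mult_left_mono power2_eq_square ennreal_mult mult.assoc)
  qed
  finally have "(\<integral>\<^sup>+x. step_error h k x * indicator K x \<partial>lborel) \<le> ennreal (exp (l * a)) *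
    (ennreal (1 / c) * (ennreal (h\<^sup>2) * (\<integral>\<^sup>+x. ennreal ((defect h x / h)\<^sup>2) \<partial>lborel)) + ennreal c * (ennreal (C\<^sup>2) * emeasure lborel K))"
    by (simp add: mult_left_mono add_left_mono)
  also have "\<dots> \<le> ennreal (exp (\<bar>l\<bar> * T)) *
    (ennreal (1 / c) * (ennreal (h\<^sup>2) * (\<integral>\<^sup>+x. ennreal ((defect h x / h)\<^sup>2) \<partial>lborel)) + ennreal c * (ennreal (C\<^sup>2) * emeasure lborel K))"
  proof -
    have "l * a \<le> \<bar>l\<bar> * a" using a by (intro mult_right_mono) auto
    also have "\<dots> \<le> \<bar>l\<bar> * T" using a by (intro mult_left_mono) auto
    finally show ?thesis by (intro mult_right_mono ennreal_leI) auto
  qed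
  also have "\<dots> = ennreal (exp (\<bar>l\<bar> * T)) * (ennreal (h\<^sup>2 / c) * (\<integral>\<^sup>+x. ennreal ((defect h x / h)\<^sup>2) \<partial>lborel) + ennreal (c * C\<^sup>2) * emeasure lborel K)"
    using c by (simp add: ennreal_mult[of "1/c" "h\<^sup>2", simplified] ennreal_mult[of c "C\<^sup>2"] mult.assoc[symmetric])
  finally show ?thesis .
qed

text \<open>
There are \<open>n = t/h\<close> steps, each with an error \<open>o(h)\<close> on a set of finite volume, so the total error
vanishes in the limit.
\<close>

lemma scaled_eq_AE:
  assumes t: "0 < t"
  shows "AE x in lborel. scaled t x = ennreal (\<phi> x)"
proof -
  obtain C where C: "0 \<le> C" "\<And>s x. 0 \<le> s \<Longrightarrow> s \<le> t \<Longrightarrow> fk_op s (\<lambda>_. 1) x \<le> ennreal C"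
    using fk_op_one_bounded[of t] by auto
  have t0: "0 \<le> t" using t by simp
  note [measurable] = scaled_measurable[OF t0] defect_measurable[OF t0]
  have zero: "(\<integral>\<^sup>+x. ennreal \<bar>defect t x\<bar> * indicator K x \<partial>lborel) = 0"
    if K[measurable]: "K \<in> sets borel" and Kf: "emeasure lborel K < \<infinity>" for K
  proof -
    obtain D where D: "emeasure lborel K = ennreal D" "0 \<le> D" using Kf by (cases "emeasure lborel K") auto
    \<comment> \<open>A bound for the total error in units of \<open>\<epsilon>\<close>, where \<open>\<epsilon>\<^sup>2\<close> bounds the square integral of \<open>defect h / h\<close>.\<close>
    define Q where "Q = exp (\<bar>l\<bar> * t) * t * (1 + C\<^sup>2 * D)"
    have Q: "0 < Q" unfolding Q_def using t D by (intro mult_pos_pos add_pos_nonneg) auto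
    have le: "(\<integral>\<^sup>+x. ennreal \<bar>defect t x\<bar> * indicator K x \<partial>lborel) \<le> ennreal (Q * \<epsilon>)" if \<epsilon>: "0 < \<epsilon>" for \<epsilon>
    proof -
      have "\<forall>\<^sub>F h in at_right 0. (\<integral>\<^sup>+x. ennreal ((defect h x / h)\<^sup>2) \<partial>lborel) < ennreal (\<epsilon>\<^sup>2)"
        using defect_small \<epsilon> by (auto simp: order_tendsto_iff)
      then obtain b where b: "b > 0" "\<And>h. 0 < h \<Longrightarrow> h < b \<Longrightarrow> (\<integral>\<^sup>+x. ennreal ((defect h x / h)\<^sup>2) \<partial>lborel) < ennreal (\<epsilon>\<^sup>2)"
        unfolding eventually_at_right_field by auto
      obtain n :: nat where n: "t / b < real n" using reals_Archimedean2 by blast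
      have n0: "0 < n" using n t b by (cases n) (auto simp: field_simps)
      define h where "h = t / real n"
      have h: "0 < h" "h < b" "real n * h = t" using t n n0 b by (auto simp: h_def field_simps)
      have h0: "0 \<le> h" using h by simp
      have I: "(\<integral>\<^sup>+x. ennreal ((defect h x / h)\<^sup>2) \<partial>lborel) \<le> ennreal (\<epsilon>\<^sup>2)" using b(2)[OF h(1,2)] by simp
      have pw: "ennreal \<bar>defect t x\<bar> \<le> (\<Sum>k<n. step_error h k x)" for x
      proof -
        obtain s where s: "scaled t x = ennreal s" "0 \<le> s" using scaled_finite[OF t0, of x] by (cases "scaled t x") auto
        show ?thesis
        proof (cases "(\<Sum>k<n. step_error h k x)")
          case (real r)
          then show ?thesis
            using scaled_telescope[where x=x and k=n, OF h0] s phi_pos[of x]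
            by (auto simp: h defect_def simp flip: ennreal_plus intro!: ennreal_leI)
        qed (simp only: top_greatest)
      qed
      have mse[measurable]: "step_error h k \<in> borel_measurable borel" for k
      proof -
        have [measurable]: "(\<lambda>y. ennreal \<bar>defect h y\<bar>) \<in> borel_measurable borel"
          using defect_measurable[OF h0] by measurable
        have "fk_op (real k * h) (\<lambda>y. ennreal \<bar>defect h y\<bar>) \<in> borel_measurable borel"
          using h0 by (intro fk_op_measurable) auto
        then show ?thesis unfolding step_error_def[abs_def] by measurable
      qed
      have "(\<integral>\<^sup>+x. ennreal \<bar>defect t x\<bar> * indicator K x \<partial>lborel) \<le> (\<integral>\<^sup>+x. (\<Sum>k<n. step_error h k x * indicator K x) \<partial>lborel)"
        unfolding sum_distrib_right[symmetric] using pw by (intro nn_integral_mono mult_right_mono) auto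
      also have "\<dots> = (\<Sum>k<n. \<integral>\<^sup>+x. step_error h k x * indicator K x \<partial>lborel)"
        by (rule nn_integral_sum) measurable
      also have "\<dots> \<le> (\<Sum>k<n. ennreal (exp (\<bar>l\<bar> * t) * (h * \<epsilon> * (1 + C\<^sup>2 * D))))"
      proof (rule sum_mono)
        fix k assume k: "k \<in> {..<n}"
        have "real k * h \<le> real n * h" using k h by (intro mult_right_mono) auto
        then have kt: "real k * h \<le> t" using h by simp
        have "(\<integral>\<^sup>+x. step_error h k x * indicator K x \<partial>lborel)
          \<le> ennreal (exp (\<bar>l\<bar> * t)) * (ennreal (h\<^sup>2 / (h * \<epsilon>)) * (\<integral>\<^sup>+x. ennreal ((defect h x / h)\<^sup>2) \<partial>lborel) + ennreal (h * \<epsilon> * C\<^sup>2) * emeasure lborel K)"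
          \<comment> \<open>The weight \<open>c = h \<epsilon>\<close> balances the two terms.\<close>
          using h \<epsilon> by (intro step_error_integral[OF K h(1) kt C(2) C(1)]) auto
        also have "\<dots> \<le> ennreal (exp (\<bar>l\<bar> * t)) * (ennreal (h\<^sup>2 / (h * \<epsilon>)) * ennreal (\<epsilon>\<^sup>2) + ennreal (h * \<epsilon> * C\<^sup>2) * ennreal D)"
          unfolding D by (intro mult_left_mono add_right_mono I) auto
        also have "\<dots> = ennreal (exp (\<bar>l\<bar> * t) * (h\<^sup>2 / (h * \<epsilon>) * \<epsilon>\<^sup>2 + h * \<epsilon> * C\<^sup>2 * D))"
        proof -
          have "0 \<le> h\<^sup>2 / (h * \<epsilon>)" "0 \<le> h * \<epsilon> * C\<^sup>2" using h \<epsilon> by auto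
          then show ?thesis
            using D by (simp only: ennreal_mult[symmetric] ennreal_plus[symmetric] mult_nonneg_nonneg
                zero_le_power2 add_nonneg_nonneg exp_ge_zero)
        qed
        also have "h\<^sup>2 / (h * \<epsilon>) * \<epsilon>\<^sup>2 + h * \<epsilon> * C\<^sup>2 * D = h * \<epsilon> * (1 + C\<^sup>2 * D)"
          using h \<epsilon> by (simp add: power2_eq_square field_simps)
        finally show "(\<integral>\<^sup>+x. step_error h k x * indicator K x \<partial>lborel) \<le> ennreal (exp (\<bar>l\<bar> * t) * (h * \<epsilon> * (1 + C\<^sup>2 * D)))" .
      qed
      also have "\<dots> = ennreal (\<Sum>k<n. exp (\<bar>l\<bar> * t) * (h * \<epsilon> * (1 + C\<^sup>2 * D)))"
        using h \<epsilon> D by (intro sum_ennreal) auto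
      also have "(\<Sum>k<n. exp (\<bar>l\<bar> * t) * (h * \<epsilon> * (1 + C\<^sup>2 * D))) = exp (\<bar>l\<bar> * t) * ((real n * h) * \<epsilon> * (1 + C\<^sup>2 * D))"
        by simp
      also have "\<dots> = Q * \<epsilon>" unfolding h(3) Q_def by simp
      finally show ?thesis .
    qed
    have "(\<integral>\<^sup>+x. ennreal \<bar>defect t x\<bar> * indicator K x \<partial>lborel) \<le> 0"
    proof (rule ennreal_le_epsilon)
      fix e :: real assume e: "0 < e"
      then show "(\<integral>\<^sup>+x. ennreal \<bar>defect t x\<bar> * indicator K x \<partial>lborel) \<le> 0 + ennreal e"
        using le[of "e / Q"] Q by simp
    qed
    then show ?thesis by simp
  qed
  have "AE x in lborel. \<forall>n::nat. ennreal \<bar>defect t x\<bar> * indicator (ball 0 (real n)) x = 0"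
    unfolding AE_all_countable
  proof
    fix n :: nat
    have "(\<integral>\<^sup>+x. ennreal \<bar>defect t x\<bar> * indicator (ball 0 (real n)) x \<partial>lborel) = 0"
      using emeasure_bounded_finite[OF bounded_ball] by (intro zero) auto
    moreover have "(\<lambda>x. ennreal \<bar>defect t x\<bar> * indicator (ball 0 (real n)) x) \<in> borel_measurable lborel"
      by (intro borel_measurable_times_ennreal borel_measurable_indicator) auto
    ultimately show "AE x in lborel. ennreal \<bar>defect t x\<bar> * indicator (ball 0 (real n)) x = 0"
      by (subst (asm) nn_integral_0_iff_AE)
  qed
  then show ?thesis
  proof (rule AE_mp, intro AE_I2 impI)
    fix x assume *: "\<forall>n::nat. ennreal \<bar>defect t x\<bar> * indicator (ball 0 (real n)) x = 0"
    obtain n :: nat where "norm x < real n" using reals_Archimedean2 by blast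
    then have "defect t x = 0" using *[rule_format, of n] by simp
    then show "scaled t x = ennreal (\<phi> x)" using scaled_finite[OF t0, of x] by (simp add: defect_def ennreal_enn2real_if)
  qed
qed

text \<open>
Along the path, \<open>exp (- action) \<phi>(x + X\<^sub>t)\<close> tends to \<open>\<phi>(x)\<close> as \<open>t\<close> tends to 0, by right continuity
of the path and continuity of \<open>\<phi>\<close>. Fatou's lemma turns this into an inequality for the
expectations, which the hypothesis makes independent of \<open>t\<close> up to a factor tending to 1.
\<close>

lemma scaled_ge:
  assumes c: "\<And>t. 0 < t \<Longrightarrow> scaled t x = c"
  shows "ennreal (\<phi> x) \<le> c"
proof -
  define t where "t n = 1 / real (Suc n)" for n
  have t: "0 < t n" "t n \<le> 1" for n by (auto simp: t_def)
  have t_lim: "t \<longlonglongrightarrow> 0" unfolding t_def using LIMSEQ_Suc[OF lim_1_over_n] by simp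
  have t_right: "filterlim t (at_right 0) sequentially"
    unfolding filterlim_at using t t_lim by (auto intro!: always_eventually simp: less_imp_neq[OF t(1), symmetric])
  let ?F = "\<lambda>n \<omega>. ennreal (exp (- action V (t n) x (\<lambda>q. X q \<omega>))) * ennreal (\<phi> (x + X (t n) \<omega>))"
  have [measurable]: "?F n \<in> borel_measurable M" for n
    using t[of n] X_measurable[of "t n"] by (simp add: less_imp_le)
  have AE_lim: "AE \<omega> in M. (\<lambda>n. ?F n \<omega>) \<longlonglongrightarrow> ennreal (\<phi> x)"
    using AE_space AE_abs_action_finite[of 1 x, simplified]
  proof eventually_elim
    case (elim \<omega>)
    let ?p = "\<lambda>q. X q \<omega>"
    have int: "set_integrable lborel {0..1} (\<lambda>q. V (x + ?p q))"
      using elim by (intro set_integrable_action) auto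
    have "(\<lambda>n. action V (t n) x ?p) \<longlonglongrightarrow> (LINT q::real|lborel. 0)"
      unfolding action_def set_lebesgue_integral_def
    proof (rule integral_dominated_convergence[where w="\<lambda>q. norm (indicator {0..1} q *\<^sub>R V (x + ?p q))"])
      show "(\<lambda>q. indicator {0..t n} q *\<^sub>R V (x + ?p q)) \<in> borel_measurable lborel" for n
        using set_borel_measurable_action[of ?p "t n" V x] elim t[of n] by (auto simp: set_borel_measurable_def)
      show "integrable lborel (\<lambda>q. norm (indicator {0..1} q *\<^sub>R V (x + ?p q)))"
        using int unfolding set_integrable_def by (rule integrable_norm)
      show "AE q in lborel. norm (indicator {0..t n} q *\<^sub>R V (x + ?p q)) \<le> norm (indicator {0..1} q *\<^sub>R V (x + ?p q))" for n
        using t[of n] by (intro AE_I2) (auto simp: indicator_def)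
      show "AE q in lborel. (\<lambda>n. indicator {0..t n} q *\<^sub>R V (x + ?p q)) \<longlonglongrightarrow> 0"
      proof (rule AE_mp[OF AE_lborel_singleton[of 0]], intro AE_I2 impI)
        fix q :: real assume q: "q \<noteq> 0"
        have "\<forall>\<^sub>F n in sequentially. q \<notin> {0..t n}"
        proof (cases "q < 0")
          case False
          then have "\<forall>\<^sub>F n in sequentially. t n < q" using q t_lim by (auto simp: order_tendsto_iff)
          then show ?thesis by eventually_elim auto
        qed auto
        then have "\<forall>\<^sub>F n in sequentially. indicator {0..t n} q *\<^sub>R V (x + ?p q) = 0"
          by eventually_elim auto
        then show "(\<lambda>n. indicator {0..t n} q *\<^sub>R V (x + ?p q)) \<longlonglongrightarrow> 0" by (rule tendsto_eventually)
      qed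
    qed simp
    moreover have "(\<lambda>n. X (t n) \<omega>) \<longlonglongrightarrow> X 0 \<omega>"
      using elim by (intro filterlim_compose[OF cadlag_right[OF cadlag_X] t_right]) auto
    then have "(\<lambda>n. x + X (t n) \<omega>) \<longlonglongrightarrow> x + 0" using elim X0 by (intro tendsto_intros) auto
    then have "(\<lambda>n. \<phi> (x + X (t n) \<omega>)) \<longlonglongrightarrow> \<phi> x"
      using continuous_on_tendsto_compose[OF phi_continuous] by simp
    ultimately have "(\<lambda>n. ennreal (exp (- action V (t n) x ?p) * \<phi> (x + X (t n) \<omega>))) \<longlonglongrightarrow> ennreal (exp (- 0) * \<phi> x)"
      by (intro tendsto_intros) auto
    then show ?case using phi_pos by (simp add: ennreal_mult less_imp_le)
  qed
  have "ennreal (\<phi> x) = (\<integral>\<^sup>+\<omega>. ennreal (\<phi> x) \<partial>M)" by (simp add: emeasure_space_1)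
  also have "\<dots> = (\<integral>\<^sup>+\<omega>. liminf (\<lambda>n. ?F n \<omega>) \<partial>M)"
    using AE_lim by (intro nn_integral_cong_AE) (auto elim!: eventually_mono dest!: lim_imp_Liminf[rotated])
  also have "\<dots> \<le> liminf (\<lambda>n. integral\<^sup>N M (?F n))"
    by (rule nn_integral_liminf) measurable
  also have "(\<lambda>n. integral\<^sup>N M (?F n)) = (\<lambda>n. ennreal (exp (- l * t n)) * c)"
  proof
    fix n
    have "integral\<^sup>N M (?F n) = ennreal (exp (- l * t n)) * (ennreal (exp (l * t n)) * integral\<^sup>N M (?F n))"
      by (rule exp_cancel[symmetric])
    also have "ennreal (exp (l * t n)) * integral\<^sup>N M (?F n) = c"
      using c[OF t(1)[of n]] by (simp add: scaled_def fk_op_def)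
    finally show "integral\<^sup>N M (?F n) = ennreal (exp (- l * t n)) * c" .
  qed
  also have "liminf (\<lambda>n. ennreal (exp (- l * t n)) * c) = c"
  proof (rule lim_imp_Liminf)
    have "(\<lambda>n. ennreal (exp (- l * t n)) * c) \<longlonglongrightarrow> ennreal (exp (- l * 0)) * c"
      by (intro tendsto_mult_ennreal tendsto_intros t_lim) auto
    then show "(\<lambda>n. ennreal (exp (- l * t n)) * c) \<longlonglongrightarrow> c" by simp
  qed simp
  finally show ?thesis .
qed

text \<open>
As the kernel is continuous, Fatou's lemma makes \<open>e\<^bsup>lt\<^esup> T\<^sub>t \<phi>\<close> lower semicontinuous. It agrees with the
continuous function \<open>\<phi>\<close> on a set of full measure, which is dense.
\<close>

lemma scaled_le:
  assumes t: "0 < t"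
  shows "scaled t x \<le> ennreal (\<phi> x)"
proof -
  have "\<exists>z\<in>ball x (1 / real (Suc n)). scaled t z = ennreal (\<phi> z)" for n
  proof (rule ccontr)
    assume "\<not> ?thesis"
    then have "AE z in lborel. z \<notin> ball x (1 / real (Suc n))"
      using scaled_eq_AE[OF t] by (auto elim!: eventually_mono)
    then have "emeasure lborel (ball x (1 / real (Suc n))) = 0"
      by (subst (asm) AE_iff_measurable[OF _ refl]) (auto simp: ball_def)
    then have "ball x (1 / real (Suc n)) \<in> null_sets lborel" by auto
    then have "negligible (ball x (1 / real (Suc n)))"
      unfolding negligible_iff_null_sets by (rule null_sets_completionI)
    then show False
      using open_not_negligible[of "ball x (1 / real (Suc n))"] by simp
  qed
  then obtain z where z: "\<And>n. z n \<in> ball x (1 / real (Suc n))" "\<And>n. scaled t (z n) = ennreal (\<phi> (z n))" by metis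
  have zl: "z \<longlonglongrightarrow> x"
  proof (rule metric_tendsto_imp_tendsto)
    show "(\<lambda>n. 1 / real (Suc n)) \<longlonglongrightarrow> 0" using LIMSEQ_Suc[OF lim_1_over_n] by simp
    show "\<forall>\<^sub>F n in sequentially. dist (z n) x \<le> dist (1 / real (Suc n)) 0"
      using z(1) by (intro always_eventually allI) (auto simp: dist_commute less_imp_le)
  qed
  have u_lim: "(\<lambda>n. u t (z n) y) \<longlonglongrightarrow> u t x y" for y
  proof -
    have "(\<lambda>n. (z n, y)) \<longlonglongrightarrow> (x, y)" using zl by (intro tendsto_intros)
    moreover have "isCont (\<lambda>(x, y). u t x y) (x, y)"
      using u_continuous[OF t] by (simp add: continuous_on_eq_continuous_at)
    ultimately have "(\<lambda>n. (\<lambda>(x, y). u t x y) (z n, y)) \<longlonglongrightarrow> (\<lambda>(x, y). u t x y) (x, y)"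
      by (rule isCont_tendsto_compose[rotated])
    then show ?thesis by simp
  qed
  note [measurable] = u_measurable1[OF t]
  have "fk_op t (\<lambda>y. ennreal (\<phi> y)) x = (\<integral>\<^sup>+y. liminf (\<lambda>n. ennreal (u t (z n) y * \<phi> y)) \<partial>lborel)"
    unfolding fk_op_kernel[OF t, of "\<lambda>y. ennreal (\<phi> y)", simplified]
  proof (intro nn_integral_cong)
    fix y
    have "(\<lambda>n. ennreal (u t (z n) y * \<phi> y)) \<longlonglongrightarrow> ennreal (u t x y * \<phi> y)"
      by (intro tendsto_intros u_lim)
    then have "liminf (\<lambda>n. ennreal (u t (z n) y * \<phi> y)) = ennreal (u t x y * \<phi> y)"
      by (rule lim_imp_Liminf[rotated]) simp
    then show "ennreal (u t x y) * ennreal (\<phi> y) = liminf (\<lambda>n. ennreal (u t (z n) y * \<phi> y))"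
      using u_pos[OF t] phi_pos by (simp add: ennreal_mult less_imp_le)
  qed
  also have "\<dots> \<le> liminf (\<lambda>n. \<integral>\<^sup>+y. ennreal (u t (z n) y * \<phi> y) \<partial>lborel)"
    by (rule nn_integral_liminf) measurable
  also have "(\<lambda>n. \<integral>\<^sup>+y. ennreal (u t (z n) y * \<phi> y) \<partial>lborel) = (\<lambda>n. fk_op t (\<lambda>y. ennreal (\<phi> y)) (z n))"
    using u_pos[OF t] phi_pos by (simp add: fk_op_kernel[OF t] ennreal_mult less_imp_le)
  also have "\<dots> = (\<lambda>n. ennreal (exp (- l * t) * \<phi> (z n)))"
  proof
    fix n
    have "fk_op t (\<lambda>y. ennreal (\<phi> y)) (z n) = ennreal (exp (- l * t)) * (ennreal (exp (l * t)) * fk_op t (\<lambda>y. ennreal (\<phi> y)) (z n))"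
      by (rule exp_cancel[symmetric])
    also have "ennreal (exp (l * t)) * fk_op t (\<lambda>y. ennreal (\<phi> y)) (z n) = ennreal (\<phi> (z n))"
      using z(2)[of n] by (simp add: scaled_def)
    finally show "fk_op t (\<lambda>y. ennreal (\<phi> y)) (z n) = ennreal (exp (- l * t) * \<phi> (z n))"
      using ennreal_mult[of "exp (- l * t)" "\<phi> (z n)"] phi_pos[of "z n"] by simp
  qed
  also have "liminf \<dots> = ennreal (exp (- l * t) * \<phi> x)"
  proof (rule lim_imp_Liminf)
    have "(\<lambda>n. \<phi> (z n)) \<longlonglongrightarrow> \<phi> x"
      using continuous_on_tendsto_compose[OF phi_continuous zl] by simp
    then show "(\<lambda>n. ennreal (exp (- l * t) * \<phi> (z n))) \<longlonglongrightarrow> ennreal (exp (- l * t) * \<phi> x)"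
      by (intro tendsto_intros)
  qed simp
  finally have "scaled t x \<le> ennreal (exp (l * t)) * ennreal (exp (- l * t) * \<phi> x)"
    unfolding scaled_def by (rule mult_left_mono) simp
  also have "\<dots> = ennreal (\<phi> x)"
  proof -
    have "ennreal (exp (l * t)) * ennreal (exp (- l * t) * \<phi> x)
        = ennreal (exp (- l * t)) * (ennreal (exp (l * t)) * ennreal (\<phi> x))"
      using ennreal_mult[of "exp (- l * t)" "\<phi> x"] phi_pos[of x] by (simp only: mult.left_commute) simp
    then show ?thesis by (simp only: exp_cancel)
  qed
  finally show ?thesis .
qed

text \<open>
For positive times the operator has a kernel and does not see null sets, so \<open>scaled\<close> is
independent of time at every point; thus \<open>scaled_ge\<close> applies with \<open>c\<close> equal to this common value, and
\<open>scaled_le\<close> gives the reverse inequality.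
\<close>

lemma ground_state_fixed:
  assumes t: "0 \<le> t"
  shows "fk_op t (\<lambda>y. ennreal (\<phi> y)) x = ennreal (exp (- l * t) * \<phi> x)"
proof -
  have pos: "scaled t x = ennreal (\<phi> x)" if t: "0 < t" for t
  proof (rule antisym[OF scaled_le[OF t] scaled_ge])
    fix s :: real assume s: "0 < s"
    have "scaled (a + b) x = scaled a x" if "0 < a" "0 < b" for a b
    proof -
      have "fk_op a (scaled b) x = fk_op a (\<lambda>y. ennreal (\<phi> y)) x"
        using that by (intro fk_op_cong_AE scaled_eq_AE) auto
      then show ?thesis using that by (simp add: scaled_add scaled_def[of a])
    qed
    from this[OF s t] this[OF t s] show "scaled s x = scaled t x" by (simp add: add.commute)
  qed
  have "fk_op t (\<lambda>y. ennreal (\<phi> y)) x = ennreal (exp (- l * t)) * (ennreal (exp (l * t)) * fk_op t (\<lambda>y. ennreal (\<phi> y)) x)"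
    by (rule exp_cancel[symmetric])
  also have "ennreal (exp (l * t)) * fk_op t (\<lambda>y. ennreal (\<phi> y)) x = ennreal (\<phi> x)"
  proof (cases "t = 0")
    case False
    then show ?thesis using pos[of t] t by (simp add: scaled_def)
  qed (simp add: fk_op_0)
  finally show ?thesis using ennreal_mult[of "exp (- l * t)" "\<phi> x"] phi_pos[of x] by simp
qed

end

section \<open>The intrinsic process on the half-line\<close>

text \<open>
The Markov property with transition kernels \<open>N\<close>, relative to the \<open>\<sigma>\<close>-fields generated by the process.
Nonnegative functions and integrals over events of the past are used instead of conditional
expectations, because this form is easily carried from one probability space to another.
\<close>

definition kernel_markov :: "'w measure \<Rightarrow> (real \<Rightarrow> 'w \<Rightarrow> 'a::euclidean_space) \<Rightarrow> (real \<Rightarrow> 'a \<Rightarrow> 'a measure) \<Rightarrow> bool" where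
  "kernel_markov Q Y N \<longleftrightarrow> (\<forall>t\<ge>0. Y t \<in> borel_measurable Q) \<and>
     (\<forall>s t A f. 0 \<le> s \<longrightarrow> s \<le> t \<longrightarrow> A \<in> sets (process_sigma (space Q) Y {0..s}) \<longrightarrow> f \<in> borel_measurable borel \<longrightarrow>
        (\<integral>\<^sup>+\<omega>. indicator A \<omega> * f (Y t \<omega>) \<partial>Q) = (\<integral>\<^sup>+\<omega>. indicator A \<omega> * (\<integral>\<^sup>+y. f y \<partial>N (t - s) (Y s \<omega>)) \<partial>Q))"

context fk_ground
begin

text \<open>
The Doob transform of the Feynman-Kac operator by the ground state.
\<close>

definition intrinsic_op :: "real \<Rightarrow> ('a \<Rightarrow> ennreal) \<Rightarrow> 'a \<Rightarrow> ennreal" where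
  "intrinsic_op t f x = ennreal (exp (l * t) / \<phi> x) * fk_op t (\<lambda>y. ennreal (\<phi> y) * f y) x"

definition transition :: "real \<Rightarrow> 'a \<Rightarrow> 'a measure" where
  "transition t x = (if t = 0 then return borel x
     else density lborel (\<lambda>y. ennreal (intrinsic_kernel l \<phi> u t x y * (\<phi> y)\<^sup>2)))"

lemma sets_transition [simp, measurable_cong]: "sets (transition t x) = sets borel"
  by (simp add: transition_def)

lemma nn_integral_transition:
  assumes t: "0 \<le> t" and f[measurable]: "f \<in> borel_measurable borel"
  shows "(\<integral>\<^sup>+y. f y \<partial>transition t x) = intrinsic_op t f x"
proof (cases "t = 0")
  case True
  have "ennreal (1 / \<phi> x) * (ennreal (\<phi> x) * f x) = f x"
    using phi_pos[of x] by (simp add: mult.assoc[symmetric] ennreal_mult[symmetric])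
  then show ?thesis using True by (simp add: transition_def intrinsic_op_def fk_op_0 nn_integral_return)
next
  case False
  then have t': "0 < t" using t by simp
  note [measurable] = u_measurable1[OF t']
  have eq: "ennreal (intrinsic_kernel l \<phi> u t x y * (\<phi> y)\<^sup>2)
      = ennreal (exp (l * t) / \<phi> x) * (ennreal (u t x y) * ennreal (\<phi> y))" for y
    using phi_pos[of x] phi_pos[of y] u_pos[OF t', of x y]
    by (simp add: intrinsic_kernel_def power2_eq_square flip: ennreal_mult)
  have "(\<integral>\<^sup>+y. f y \<partial>transition t x) = (\<integral>\<^sup>+y. ennreal (intrinsic_kernel l \<phi> u t x y * (\<phi> y)\<^sup>2) * f y \<partial>lborel)"
    using False unfolding transition_def intrinsic_kernel_def by (simp add: nn_integral_density)
  also have "\<dots> = (\<integral>\<^sup>+y. ennreal (exp (l * t) / \<phi> x) * (ennreal (u t x y) * (ennreal (\<phi> y) * f y)) \<partial>lborel)"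
    unfolding eq by (simp add: mult.assoc)
  also have "\<dots> = intrinsic_op t f x"
    by (simp add: intrinsic_op_def fk_op_kernel[OF t'] nn_integral_cmult)
  finally show ?thesis .
qed

lemma intrinsic_op_0:
  assumes "f \<in> borel_measurable borel"
  shows "intrinsic_op 0 f x = f x"
  using nn_integral_transition[of 0 f x] assms by (simp add: transition_def nn_integral_return)

lemma prob_space_transition:
  assumes t: "0 \<le> t"
  shows "prob_space (transition t x)"
proof (rule prob_spaceI)
  have "emeasure (transition t x) (space (transition t x)) = (\<integral>\<^sup>+y. 1 \<partial>transition t x)" by simp
  also have "\<dots> = ennreal (exp (l * t) / \<phi> x) * ennreal (exp (- l * t) * \<phi> x)"
    by (subst nn_integral_transition[OF t]) (simp_all add: intrinsic_op_def ground_state_fixed[OF t])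
  also have "\<dots> = ennreal (exp (l * t) / \<phi> x * (exp (- l * t) * \<phi> x))"
    using phi_pos[of x] by (intro ennreal_mult[symmetric]) auto
  also have "exp (l * t) / \<phi> x * (exp (- l * t) * \<phi> x) = 1"
    using phi_pos[of x] by (simp add: exp_minus field_simps)
  finally show "emeasure (transition t x) (space (transition t x)) = 1" by simp
qed

lemma intrinsic_op_measurable [measurable]:
  assumes "0 \<le> t" and [measurable]: "f \<in> borel_measurable borel"
  shows "intrinsic_op t f \<in> borel_measurable borel"
  unfolding intrinsic_op_def[abs_def] using assms(1)
  by (intro borel_measurable_times_ennreal fk_op_measurable) auto

lemma phi_intrinsic_op:
  "0 \<le> t \<Longrightarrow> ennreal (\<phi> x) * intrinsic_op t f x = ennreal (exp (l * t)) * fk_op t (\<lambda>y. ennreal (\<phi> y) * f y) x"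
proof -
  have "ennreal (\<phi> x) * ennreal (exp (l * t) / \<phi> x) = ennreal (exp (l * t))"
    using phi_pos[of x] by (simp flip: ennreal_mult)
  then show ?thesis by (simp add: intrinsic_op_def mult.assoc[symmetric])
qed

lemma intrinsic_op_add:
  assumes st: "0 \<le> s" "0 \<le> t" and [measurable]: "f \<in> borel_measurable borel"
  shows "intrinsic_op (s + t) f x = intrinsic_op s (intrinsic_op t f) x"
proof -
  have "intrinsic_op s (intrinsic_op t f) x
     = ennreal (exp (l * s) / \<phi> x) * fk_op s (\<lambda>y. ennreal (exp (l * t)) * fk_op t (\<lambda>y. ennreal (\<phi> y) * f y) y) x"
    using st by (simp add: intrinsic_op_def[of s] phi_intrinsic_op)
  also have "\<dots> = ennreal (exp (l * s) / \<phi> x) * (ennreal (exp (l * t)) * fk_op s (fk_op t (\<lambda>y. ennreal (\<phi> y) * f y)) x)"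
    using st by (subst fk_op_cmult) (auto intro!: fk_op_measurable)
  also have "\<dots> = ennreal (exp (l * (s + t)) / \<phi> x) * fk_op (s + t) (\<lambda>y. ennreal (\<phi> y) * f y) x"
    using st phi_pos[of x] by (simp add: fk_op_add mult.assoc[symmetric] distrib_left exp_add flip: ennreal_mult)
  finally show ?thesis by (simp add: intrinsic_op_def)
qed

text \<open>
The two factors \<open>\<phi>(x)\<close> of the stationary density cancel the factor \<open>1/\<phi>(x)\<close> of the operator and supply
the factor \<open>\<phi>(x)\<close> in the function, which leaves the symmetric operator \<open>fk_op\<close>.
\<close>

lemma intrinsic_op_symmetric:
  assumes t: "0 \<le> t" and [measurable]: "f \<in> borel_measurable borel" "g \<in> borel_measurable borel"
  shows "(\<integral>\<^sup>+x. f x * intrinsic_op t g x \<partial>stationary_measure \<phi>)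
       = (\<integral>\<^sup>+x. g x * intrinsic_op t f x \<partial>stationary_measure \<phi>)"
proof -
  have *: "(\<integral>\<^sup>+x. f x * intrinsic_op t g x \<partial>stationary_measure \<phi>)
     = ennreal (exp (l * t)) * (\<integral>\<^sup>+x. (ennreal (\<phi> x) * f x) * fk_op t (\<lambda>y. ennreal (\<phi> y) * g y) x \<partial>lborel)"
    if [measurable]: "f \<in> borel_measurable borel" "g \<in> borel_measurable borel" for f g
  proof -
    have [measurable]: "intrinsic_op t g \<in> borel_measurable borel" "fk_op t (\<lambda>y. ennreal (\<phi> y) * g y) \<in> borel_measurable borel"
      using t by (auto intro!: fk_op_measurable intrinsic_op_measurable)
    have eq: "ennreal ((\<phi> x)\<^sup>2) * (f x * intrinsic_op t g x)
       = ennreal (exp (l * t)) * ((ennreal (\<phi> x) * f x) * fk_op t (\<lambda>y. ennreal (\<phi> y) * g y) x)" for x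
    proof -
      have "ennreal ((\<phi> x)\<^sup>2) * (f x * intrinsic_op t g x) = (ennreal (\<phi> x) * f x) * (ennreal (\<phi> x) * intrinsic_op t g x)"
        using phi_pos[of x] by (simp add: power2_eq_square ennreal_mult ac_simps less_imp_le)
      then show ?thesis unfolding phi_intrinsic_op[OF t] by (simp add: ac_simps)
    qed
    show ?thesis
      unfolding stationary_measure_def by (simp add: nn_integral_density eq nn_integral_cmult)
  qed
  show ?thesis
    by (simp add: * fk_op_symmetric[OF t, of "\<lambda>x. ennreal (\<phi> x) * f x" "\<lambda>x. ennreal (\<phi> x) * g x"])
qed

text \<open>
The density on paths over a unit time interval; its mean is 1 because \<open>\<phi>\<close> is fixed by
\<open>e\<^sup>l T\<^sub>1\<close>.
\<close>

definition segment_density :: "'a \<Rightarrow> 'w \<Rightarrow> ennreal" where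
  "segment_density x \<omega> = ennreal (exp l / \<phi> x) * (ennreal (exp (- action V 1 x (\<lambda>q. X q \<omega>))) * ennreal (\<phi> (x + X 1 \<omega>)))"

definition segment_law :: "'a \<Rightarrow> 'w measure" where
  "segment_law x = density M (segment_density x)"

lemma segment_density_measurable [measurable]:
  "(\<lambda>z. segment_density (fst z) (snd z)) \<in> borel_measurable (borel \<Otimes>\<^sub>M M)"
proof -
  have [measurable]: "(\<lambda>z. action V 1 (fst z) (\<lambda>q. X q (snd z))) \<in> borel_measurable (borel \<Otimes>\<^sub>M M)"
    using measurable_action_M(1)[of 1 V] by (simp add: split_beta')
  have [measurable]: "X 1 \<in> borel_measurable M" by simp
  show ?thesis unfolding segment_density_def by measurable
qed

lemma segment_density_measurable1 [measurable]: "segment_density x \<in> borel_measurable M"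
  using measurable_compose[OF _ segment_density_measurable, of "\<lambda>\<omega>. (x, \<omega>)" M] by simp

lemma sets_segment_law [simp, measurable_cong]: "sets (segment_law x) = sets M"
  and space_segment_law [simp]: "space (segment_law x) = space M"
  by (auto simp: segment_law_def)

text \<open>
Consistency of the densities: for events up to time \<open>t \<le> 1\<close>, integrating out the path on \<open>[t, 1]\<close>
replaces the density for time 1 by that for time \<open>t\<close>.
\<close>

lemma nn_integral_segment_law_past:
  assumes t: "0 \<le> t" "t \<le> 1" and F: "F \<in> borel_measurable (past t)"
  shows "(\<integral>\<^sup>+\<omega>. F \<omega> \<partial>segment_law x)
    = ennreal (exp (l * t) / \<phi> x) * (\<integral>\<^sup>+\<omega>. F \<omega> * (ennreal (exp (- action V t x (\<lambda>q. X q \<omega>))) * ennreal (\<phi> (x + X t \<omega>))) \<partial>M)"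
proof -
  have [measurable]: "F \<in> borel_measurable M" using measurable_past_M[OF F] .
  have [measurable]: "X 1 \<in> borel_measurable M" "X t \<in> borel_measurable M" using t by auto
  have [measurable]: "(\<lambda>\<omega>. action V 1 x (\<lambda>q. X q \<omega>)) \<in> borel_measurable M" "(\<lambda>\<omega>. action V t x (\<lambda>q. X q \<omega>)) \<in> borel_measurable M"
    using t by auto
  have t1: "t + (1 - t) = 1" "0 \<le> 1 - t" using t by auto
  have "(\<integral>\<^sup>+\<omega>. F \<omega> \<partial>segment_law x) = (\<integral>\<^sup>+\<omega>. ennreal (exp l / \<phi> x) *
      (F \<omega> * (ennreal (exp (- action V 1 x (\<lambda>q. X q \<omega>))) * ennreal (\<phi> (x + X 1 \<omega>)))) \<partial>M)"
    unfolding segment_law_def by (subst nn_integral_density) (auto simp: segment_density_def ac_simps)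
  also have "\<dots> = ennreal (exp l / \<phi> x) * (\<integral>\<^sup>+\<omega>. F \<omega> * (ennreal (exp (- action V 1 x (\<lambda>q. X q \<omega>))) * ennreal (\<phi> (x + X 1 \<omega>))) \<partial>M)"
    by (rule nn_integral_cmult) measurable
  also have "(\<integral>\<^sup>+\<omega>. F \<omega> * (ennreal (exp (- action V 1 x (\<lambda>q. X q \<omega>))) * ennreal (\<phi> (x + X 1 \<omega>))) \<partial>M)
     = (\<integral>\<^sup>+\<omega>. F \<omega> * (ennreal (exp (- action V t x (\<lambda>q. X q \<omega>))) * fk_op (1 - t) (\<lambda>y. ennreal (\<phi> y)) (x + X t \<omega>)) \<partial>M)"
    using fk_markov[OF t(1) t1(2) F, of "\<lambda>y. ennreal (\<phi> y)" x] t1(1) by simp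
  also have "\<dots> = (\<integral>\<^sup>+\<omega>. ennreal (exp (- l * (1 - t))) * (F \<omega> * (ennreal (exp (- action V t x (\<lambda>q. X q \<omega>))) * ennreal (\<phi> (x + X t \<omega>)))) \<partial>M)"
    unfolding ground_state_fixed[OF t1(2)]
    using phi_pos by (intro nn_integral_cong) (simp add: ennreal_mult less_imp_le ac_simps)
  also have "\<dots> = ennreal (exp (- l * (1 - t))) * (\<integral>\<^sup>+\<omega>. F \<omega> * (ennreal (exp (- action V t x (\<lambda>q. X q \<omega>))) * ennreal (\<phi> (x + X t \<omega>))) \<partial>M)"
    by (rule nn_integral_cmult) measurable
  also have "ennreal (exp l / \<phi> x) * (ennreal (exp (- l * (1 - t))) * (\<integral>\<^sup>+\<omega>. F \<omega> * (ennreal (exp (- action V t x (\<lambda>q. X q \<omega>))) * ennreal (\<phi> (x + X t \<omega>))) \<partial>M))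
    = ennreal (exp l / \<phi> x * exp (- l * (1 - t))) * (\<integral>\<^sup>+\<omega>. F \<omega> * (ennreal (exp (- action V t x (\<lambda>q. X q \<omega>))) * ennreal (\<phi> (x + X t \<omega>))) \<partial>M)"
    using phi_pos[of x] by (simp add: mult.assoc[symmetric] flip: ennreal_mult)
  also have "exp l / \<phi> x * exp (- l * (1 - t)) = exp (l * t) / \<phi> x"
    by (simp add: algebra_simps flip: exp_add)
  finally show ?thesis .
qed

lemma prob_space_segment_law: "prob_space (segment_law x)"
proof (rule prob_spaceI)
  have "emeasure (segment_law x) (space (segment_law x)) = (\<integral>\<^sup>+\<omega>. 1 \<partial>segment_law x)" by simp
  also have "\<dots> = ennreal (exp (l * 0) / \<phi> x) * (\<integral>\<^sup>+\<omega>. 1 * (ennreal (exp (- action V 0 x (\<lambda>q. X q \<omega>))) * ennreal (\<phi> (x + X 0 \<omega>))) \<partial>M)"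
    by (rule nn_integral_segment_law_past) auto
  also have "\<dots> = ennreal (exp (l * 0) / \<phi> x) * fk_op 0 (\<lambda>y. ennreal (\<phi> y)) x" by (simp add: fk_op_def)
  also have "\<dots> = 1" using phi_pos[of x] by (simp add: fk_op_0 flip: ennreal_mult)
  finally show "emeasure (segment_law x) (space (segment_law x)) = 1" .
qed

text \<open>
Both sides are reduced to the Feynman-Kac weight, at time \<open>t\<close> and at time \<open>s\<close> respectively, where the
claim becomes the Markov property of the weighted process.
\<close>

lemma segment_law_markov:
  assumes s: "0 \<le> s" "s \<le> t" "t \<le> 1" and F: "F \<in> borel_measurable (past s)" and f[measurable]: "f \<in> borel_measurable borel"
  shows "(\<integral>\<^sup>+\<omega>. F \<omega> * f (x + X t \<omega>) \<partial>segment_law x)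
       = (\<integral>\<^sup>+\<omega>. F \<omega> * intrinsic_op (t - s) f (x + X s \<omega>) \<partial>segment_law x)"
proof -
  have Ft: "F \<in> borel_measurable (past t)" using measurable_past_mono[OF s(2) F] .
  have ts: "0 \<le> t - s" "s + (t - s) = t" using s by auto
  have [measurable]: "F \<in> borel_measurable M" using measurable_past_M[OF F] .
  have [measurable]: "X s \<in> borel_measurable M" using s by auto
  have [measurable]: "(\<lambda>\<omega>. action V s x (\<lambda>q. X q \<omega>)) \<in> borel_measurable M" using s by auto
  have m1: "(\<lambda>\<omega>. F \<omega> * f (x + X t \<omega>)) \<in> borel_measurable (past t)"
  proof -
    have [measurable]: "X t \<in> borel_measurable (past t)" using s by (intro X_past) auto
    show ?thesis using Ft by measurable
  qed
  have m2: "(\<lambda>\<omega>. F \<omega> * intrinsic_op (t - s) f (x + X s \<omega>)) \<in> borel_measurable (past s)"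
  proof -
    have [measurable]: "X s \<in> borel_measurable (past s)" using s by (intro X_past) auto
    show ?thesis using F intrinsic_op_measurable[OF ts(1) f] by measurable
  qed
  have [measurable]: "(\<lambda>y. ennreal (\<phi> y) * f y) \<in> borel_measurable borel" by measurable
  have [measurable]: "fk_op (t - s) (\<lambda>y. ennreal (\<phi> y) * f y) \<in> borel_measurable borel"
    using ts by (intro fk_op_measurable) auto
  have "(\<integral>\<^sup>+\<omega>. F \<omega> * f (x + X t \<omega>) \<partial>segment_law x)
     = ennreal (exp (l * t) / \<phi> x) * (\<integral>\<^sup>+\<omega>. (F \<omega> * f (x + X t \<omega>)) * (ennreal (exp (- action V t x (\<lambda>q. X q \<omega>))) * ennreal (\<phi> (x + X t \<omega>))) \<partial>M)"
    using s by (intro nn_integral_segment_law_past m1) auto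
  also have "(\<integral>\<^sup>+\<omega>. (F \<omega> * f (x + X t \<omega>)) * (ennreal (exp (- action V t x (\<lambda>q. X q \<omega>))) * ennreal (\<phi> (x + X t \<omega>))) \<partial>M)
     = (\<integral>\<^sup>+\<omega>. F \<omega> * (ennreal (exp (- action V t x (\<lambda>q. X q \<omega>))) * (ennreal (\<phi> (x + X t \<omega>)) * f (x + X t \<omega>))) \<partial>M)"
    by (simp add: ac_simps)
  also have "\<dots> = (\<integral>\<^sup>+\<omega>. F \<omega> * (ennreal (exp (- action V s x (\<lambda>q. X q \<omega>))) * fk_op (t - s) (\<lambda>y. ennreal (\<phi> y) * f y) (x + X s \<omega>)) \<partial>M)"
    using fk_markov[OF s(1) ts(1) F, of "\<lambda>y. ennreal (\<phi> y) * f y" x] ts(2) by simp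
  also have "ennreal (exp (l * t) / \<phi> x) * \<dots> = ennreal (exp (l * s) / \<phi> x) * (ennreal (exp (l * (t - s))) * \<dots>)"
  proof -
    have "exp (l * t) / \<phi> x = exp (l * s) / \<phi> x * exp (l * (t - s))"
      by (simp add: right_diff_distrib exp_diff)
    then have "ennreal (exp (l * t) / \<phi> x) = ennreal (exp (l * s) / \<phi> x) * ennreal (exp (l * (t - s)))"
      using ennreal_mult[of "exp (l * s) / \<phi> x" "exp (l * (t - s))"] phi_pos[of x] by simp
    then show ?thesis by (simp only: mult.assoc)
  qed
  also have "ennreal (exp (l * (t - s))) * (\<integral>\<^sup>+\<omega>. F \<omega> * (ennreal (exp (- action V s x (\<lambda>q. X q \<omega>))) * fk_op (t - s) (\<lambda>y. ennreal (\<phi> y) * f y) (x + X s \<omega>)) \<partial>M)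
     = (\<integral>\<^sup>+\<omega>. ennreal (exp (l * (t - s))) * (F \<omega> * (ennreal (exp (- action V s x (\<lambda>q. X q \<omega>))) * fk_op (t - s) (\<lambda>y. ennreal (\<phi> y) * f y) (x + X s \<omega>))) \<partial>M)"
    by (rule nn_integral_cmult[symmetric]) measurable
  also have "\<dots> = (\<integral>\<^sup>+\<omega>. (F \<omega> * intrinsic_op (t - s) f (x + X s \<omega>)) * (ennreal (exp (- action V s x (\<lambda>q. X q \<omega>))) * ennreal (\<phi> (x + X s \<omega>))) \<partial>M)"
  proof (rule nn_integral_cong)
    fix \<omega>
    have "ennreal (exp (l * (t - s))) * (F \<omega> * (ennreal (exp (- action V s x (\<lambda>q. X q \<omega>))) * fk_op (t - s) (\<lambda>y. ennreal (\<phi> y) * f y) (x + X s \<omega>)))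
      = F \<omega> * ennreal (exp (- action V s x (\<lambda>q. X q \<omega>))) * (ennreal (exp (l * (t - s))) * fk_op (t - s) (\<lambda>y. ennreal (\<phi> y) * f y) (x + X s \<omega>))"
      by (simp only: ac_simps)
    also have "\<dots> = (F \<omega> * intrinsic_op (t - s) f (x + X s \<omega>)) * (ennreal (exp (- action V s x (\<lambda>q. X q \<omega>))) * ennreal (\<phi> (x + X s \<omega>)))"
      unfolding phi_intrinsic_op[OF ts(1), symmetric] by (simp only: ac_simps)
    finally show "ennreal (exp (l * (t - s))) * (F \<omega> * (ennreal (exp (- action V s x (\<lambda>q. X q \<omega>))) * fk_op (t - s) (\<lambda>y. ennreal (\<phi> y) * f y) (x + X s \<omega>)))
      = (F \<omega> * intrinsic_op (t - s) f (x + X s \<omega>)) * (ennreal (exp (- action V s x (\<lambda>q. X q \<omega>))) * ennreal (\<phi> (x + X s \<omega>)))" .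
  qed
  also have "ennreal (exp (l * s) / \<phi> x) * \<dots> = (\<integral>\<^sup>+\<omega>. F \<omega> * intrinsic_op (t - s) f (x + X s \<omega>) \<partial>segment_law x)"
    using s by (intro nn_integral_segment_law_past[symmetric] m2) auto
  finally show ?thesis .
qed

end

lemma (in Ionescu_Tulcea) nn_integral_lim_restrict:
  assumes G[measurable]: "G \<in> borel_measurable (PiM {0..<n} M)"
  shows "(\<integral>\<^sup>+\<omega>. G (restrict \<omega> {0..<n}) \<partial>PF.lim) = (\<integral>\<^sup>+\<omega>. G \<omega> \<partial>C 0 n (\<lambda>_. undefined))"
proof -
  have "up_to {0..<n} = n"
    using up_to_iff_Ico[of "{0..<n}" n] up_to[of "{0..<n}"] by (cases n) auto
  moreover have u: "(\<lambda>_. undefined) \<in> space (PiM {0..<0} M)" by (simp add: space_PiM)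
  ultimately have "distr PF.lim (PiM {0..<n} M) (\<lambda>x. restrict x {0..<n})
      = distr (C 0 n (\<lambda>_. undefined)) (PiM {0..<n} M) (\<lambda>f. restrict f {0..<n})"
    by (subst distr_lim) (auto simp: CI_def)
  then have "(\<integral>\<^sup>+\<omega>. G \<omega> \<partial>distr PF.lim (PiM {0..<n} M) (\<lambda>x. restrict x {0..<n}))
      = (\<integral>\<^sup>+\<omega>. G \<omega> \<partial>distr (C 0 n (\<lambda>_. undefined)) (PiM {0..<n} M) (\<lambda>f. restrict f {0..<n}))" by simp
  also have "\<dots> = (\<integral>\<^sup>+\<omega>. G (restrict \<omega> {0..<n}) \<partial>C 0 n (\<lambda>_. undefined))"
  proof (rule nn_integral_distr)
    have sC: "sets (C 0 n (\<lambda>_. undefined)) = sets (PiM {0..<n} M)" using sets_C[OF u, of n] by simp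
    show "(\<lambda>f. restrict f {0..<n}) \<in> C 0 n (\<lambda>_. undefined) \<rightarrow>\<^sub>M PiM {0..<n} M"
      unfolding measurable_cong_sets[OF sC refl] by (rule measurable_restrict_subset) simp
  qed (use G in simp)
  also have "\<dots> = (\<integral>\<^sup>+\<omega>. G \<omega> \<partial>C 0 n (\<lambda>_. undefined))"
    using space_C[OF u, of n] by (intro nn_integral_cong) (auto simp: space_PiM intro!: arg_cong[where f=G] PiE_restrict)
  also have "(\<integral>\<^sup>+\<omega>. G \<omega> \<partial>distr PF.lim (PiM {0..<n} M) (\<lambda>x. restrict x {0..<n})) = (\<integral>\<^sup>+\<omega>. G (restrict \<omega> {0..<n}) \<partial>PF.lim)"
    by (intro nn_integral_distr) (auto intro!: measurable_restrict simp: measurable_cong_sets[OF PF.sets_lim refl])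
  finally show ?thesis .
qed

text \<open>
Under the measure of Ionescu-Tulcea, coordinate \<open>n\<close> has conditional law \<open>P n\<close> given the
preceding ones.
\<close>

lemma (in Ionescu_Tulcea) nn_integral_lim_step:
  assumes H[measurable]: "H \<in> borel_measurable (PiM {0..<n} M \<Otimes>\<^sub>M M n)"
  shows "(\<integral>\<^sup>+\<omega>. H (restrict \<omega> {0..<n}, \<omega> n) \<partial>PF.lim)
       = (\<integral>\<^sup>+\<omega>. (\<integral>\<^sup>+z. H (restrict \<omega> {0..<n}, z) \<partial>P n (restrict \<omega> {0..<n})) \<partial>PF.lim)"
proof -
  let ?G = "\<lambda>\<omega>. H (restrict \<omega> {0..<n}, \<omega> n)"
  have u: "(\<lambda>_. undefined) \<in> space (PiM {0..<0} M)" by (simp add: space_PiM)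
  have G[measurable]: "?G \<in> borel_measurable (PiM {0..<Suc n} M)"
    by (rule measurable_compose[OF _ H]) (auto intro!: measurable_Pair measurable_restrict)
  have K[measurable]: "(\<lambda>\<omega>. \<integral>\<^sup>+z. H (\<omega>, z) \<partial>P n \<omega>) \<in> borel_measurable (PiM {0..<n} M)"
    using P[of n] by (intro nn_integral_measurable_subprob_algebra2[where N="M n"]) (auto simp: split_beta')
  have "(\<integral>\<^sup>+\<omega>. ?G \<omega> \<partial>PF.lim) = (\<integral>\<^sup>+\<omega>. ?G (restrict \<omega> {0..<Suc n}) \<partial>PF.lim)"
    by (intro nn_integral_cong) (simp add: Int_absorb1)
  also have "\<dots> = (\<integral>\<^sup>+\<omega>. ?G \<omega> \<partial>C 0 (Suc n) (\<lambda>_. undefined))"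
    by (rule nn_integral_lim_restrict[OF G])
  also have "\<dots> = (\<integral>\<^sup>+\<omega>. (\<integral>\<^sup>+\<omega>'. ?G \<omega>' \<partial>eP n \<omega>) \<partial>C 0 n (\<lambda>_. undefined))"
  proof -
    have "sets (C 0 n (\<lambda>_. undefined)) = sets (PiM {0..<n} M)" using sets_C[OF u, of n] by simp
    then have "eP n \<in> C 0 n (\<lambda>_. undefined) \<rightarrow>\<^sub>M subprob_algebra (PiM {0..<Suc n} M)"
      using measurable_eP[of n] by (simp cong: measurable_cong_sets)
    then show ?thesis by (simp add: nn_integral_bind[OF G])
  qed
  also have "\<dots> = (\<integral>\<^sup>+\<omega>. (\<integral>\<^sup>+z. H (\<omega>, z) \<partial>P n \<omega>) \<partial>C 0 n (\<lambda>_. undefined))"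
  proof (rule nn_integral_cong)
    fix \<omega> assume "\<omega> \<in> space (C 0 n (\<lambda>_. undefined))"
    then have \<omega>: "\<omega> \<in> space (PiM {0..<n} M)" using space_C[OF u, of n] by simp
    have r: "restrict (fun_upd \<omega> n z) {0..<n} = \<omega>" for z
    proof
      fix i show "restrict (fun_upd \<omega> n z) {0..<n} i = \<omega> i"
        using \<omega> by (auto simp: space_PiM PiE_def extensional_def restrict_def)
    qed
    show "(\<integral>\<^sup>+\<omega>'. ?G \<omega>' \<partial>eP n \<omega>) = (\<integral>\<^sup>+z. H (\<omega>, z) \<partial>P n \<omega>)"
      by (subst nn_integral_eP[OF \<omega> G]) (simp only: r fun_upd_same)
  qed
  also have "\<dots> = (\<integral>\<^sup>+\<omega>. (\<integral>\<^sup>+z. H (restrict \<omega> {0..<n}, z) \<partial>P n (restrict \<omega> {0..<n})) \<partial>PF.lim)"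
    by (rule nn_integral_lim_restrict[OF K, symmetric])
  finally show ?thesis .
qed

context fk_ground
begin

text \<open>
The position after \<open>n\<close> unit time intervals.
\<close>

definition chain_position :: "'a \<Rightarrow> nat \<Rightarrow> (nat \<Rightarrow> 'w) \<Rightarrow> 'a" where
  "chain_position x n \<omega> = x + (\<Sum>k<n. X 1 (\<omega> k))"

lemma chain_position_measurable [measurable]:
  assumes "{..<n} \<subseteq> I"
  shows "chain_position x n \<in> borel_measurable (PiM I (\<lambda>_. M))"
proof -
  have [measurable]: "X 1 \<in> borel_measurable M" by simp
  have "(\<lambda>\<omega>. X 1 (\<omega> k)) \<in> borel_measurable (PiM I (\<lambda>_. M))" if "k < n" for k
    using assms that by (intro measurable_compose[OF measurable_component_singleton]) auto
  then show ?thesis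
    unfolding chain_position_def[abs_def] by (intro borel_measurable_add borel_measurable_sum) auto
qed

lemma chain_position_restrict: "k \<le> n \<Longrightarrow> chain_position x k (restrict \<omega> {0..<n}) = chain_position x k \<omega>"
  unfolding chain_position_def by (intro arg_cong2[where f="(+)"] sum.cong) auto

lemma chain_law_exists:
  "\<exists>Q. prob_space Q \<and> sets Q = sets (PiM UNIV (\<lambda>_::nat. M)) \<and>
    (\<forall>n. \<forall>H\<in>borel_measurable (PiM {0..<n} (\<lambda>_. M) \<Otimes>\<^sub>M M).
      (\<integral>\<^sup>+\<omega>. H (restrict \<omega> {0..<n}, \<omega> n) \<partial>Q)
      = (\<integral>\<^sup>+\<omega>. (\<integral>\<^sup>+z. H (restrict \<omega> {0..<n}, z) \<partial>segment_law (chain_position x n \<omega>)) \<partial>Q))"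
proof -
  interpret IT: Ionescu_Tulcea "\<lambda>i \<omega>. segment_law (chain_position x i \<omega>)" "\<lambda>_. M"
  proof (rule Ionescu_Tulcea.intro)
    fix i
    have "segment_law \<in> borel \<rightarrow>\<^sub>M subprob_algebra M"
    proof (rule measurable_subprob_algebra)
      fix a show "subprob_space (segment_law a)"
        using prob_space_segment_law by (rule prob_space_imp_subprob_space)
    next
      fix A assume [measurable]: "A \<in> sets M"
      have "(\<lambda>a. \<integral>\<^sup>+\<omega>. segment_density a \<omega> * indicator A \<omega> \<partial>M) \<in> borel_measurable borel"
        by (intro borel_measurable_nn_integral) (simp add: split_beta')
      then show "(\<lambda>a. emeasure (segment_law a) A) \<in> borel_measurable borel"
        by (simp add: segment_law_def emeasure_density)
    qed simp
    then show "(\<lambda>\<omega>. segment_law (chain_position x i \<omega>)) \<in> PiM {0..<i} (\<lambda>_. M) \<rightarrow>\<^sub>M subprob_algebra M"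
      by (rule measurable_compose[rotated]) (auto intro!: chain_position_measurable)
  qed (rule prob_space_segment_law)
  show ?thesis
  proof (intro exI[of _ IT.PF.lim] conjI allI ballI)
    show "prob_space IT.PF.lim"
    proof (rule prob_spaceI)
      have "(\<lambda>_. undefined) \<in> space (PiM {0..<0} (\<lambda>_::nat. M))" by (simp add: space_PiM)
      from prob_space.emeasure_space_1[OF IT.prob_space_C[OF this, of 0]]
      show "emeasure IT.PF.lim (space IT.PF.lim) = 1"
        using IT.nn_integral_lim_restrict[of "\<lambda>_. 1" 0] by (simp del: IT.C.simps)
    qed
    show "sets IT.PF.lim = sets (PiM UNIV (\<lambda>_. M))" by simp
    fix n and H :: "(nat \<Rightarrow> 'w) \<times> 'w \<Rightarrow> ennreal"
    assume "H \<in> borel_measurable (PiM {0..<n} (\<lambda>_. M) \<Otimes>\<^sub>M M)"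
    from IT.nn_integral_lim_step[OF this]
    show "(\<integral>\<^sup>+\<omega>. H (restrict \<omega> {0..<n}, \<omega> n) \<partial>IT.PF.lim)
      = (\<integral>\<^sup>+\<omega>. (\<integral>\<^sup>+z. H (restrict \<omega> {0..<n}, z) \<partial>segment_law (chain_position x n \<omega>)) \<partial>IT.PF.lim)"
      by (simp add: chain_position_restrict)
  qed
qed

definition chain_path :: "'a \<Rightarrow> real \<Rightarrow> (nat \<Rightarrow> 'w) \<Rightarrow> 'a" where
  "chain_path x t \<omega> = concat_path (\<lambda>n. chain_position x n \<omega>) (\<lambda>n r. X r (\<omega> n)) t"

lemma chain_path_eq:
  assumes "\<And>k. \<omega> k \<in> space M" "real n \<le> t" "t \<le> real n + 1"
  shows "chain_path x t \<omega> = chain_position x n \<omega> + X (t - real n) (\<omega> n)"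
proof (cases "t < real n + 1")
  case True
  then show ?thesis using assms by (simp add: chain_path_def concat_path_eq)
next
  case False
  then have t: "t = real (Suc n)" using assms by simp
  then have "chain_path x t \<omega> = chain_position x (Suc n) \<omega> + X 0 (\<omega> (Suc n))"
    unfolding chain_path_def by (subst concat_path_eq[of "Suc n"]) auto
  then show ?thesis using assms(1) X0 t by (simp add: chain_position_def)
qed

text \<open>
The Markov property is first shown for two times within one unit interval, where it is that of a
single segment given the preceding ones, and then extended to later times across the integers with
the semigroup property of the transition operators.
\<close>

lemma one_sided_process:
  "\<exists>(Q :: (nat \<Rightarrow> 'w) measure) Y. prob_space Q \<and> kernel_markov Q Y transition \<and>
     (\<forall>\<omega>\<in>space Q. cadlag_on {0..} (\<lambda>t. Y t \<omega>) \<and> Y 0 \<omega> = x) \<and>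
     (\<forall>t>0. AE \<omega> in Q. left_lim (\<lambda>r. Y r \<omega>) t = Y t \<omega>)"
proof -
  obtain Q :: "(nat \<Rightarrow> 'w) measure" where Q: "prob_space Q" "sets Q = sets (PiM UNIV (\<lambda>_::nat. M))"
    and Q_step: "\<And>n H. H \<in> borel_measurable (PiM {0..<n} (\<lambda>_. M) \<Otimes>\<^sub>M M) \<Longrightarrow>
      (\<integral>\<^sup>+\<omega>. H (restrict \<omega> {0..<n}, \<omega> n) \<partial>Q)
      = (\<integral>\<^sup>+\<omega>. (\<integral>\<^sup>+z. H (restrict \<omega> {0..<n}, z) \<partial>segment_law (chain_position x n \<omega>)) \<partial>Q)"
    using chain_law_exists[of x] by blast
  interpret Q: prob_space Q by fact
  note [measurable_cong] = Q(2)
  have spQ: "space Q = space (PiM UNIV (\<lambda>_::nat. M))" using Q(2) by (rule sets_eq_imp_space_eq)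
  have \<omega>M: "\<omega> k \<in> space M" if "\<omega> \<in> space Q" for \<omega> k using that by (auto simp: spQ space_PiM)
  define Y where "Y t \<omega> = chain_path x t \<omega>" for t \<omega>
  have Y_eq: "Y t \<omega> = chain_position x n \<omega> + X (t - real n) (\<omega> n)"
    if "\<omega> \<in> space Q" "real n \<le> t" "t \<le> real n + 1" for n t \<omega>
    unfolding Y_def using chain_path_eq[OF \<omega>M[OF that(1)] that(2,3)] .
  have cad: "cadlag_on {0..} (\<lambda>t. Y t \<omega>)" if "\<omega> \<in> space Q" for \<omega>
    unfolding Y_def chain_path_def using \<omega>M[OF that] by (intro cadlag_concat_path[unfolded eta_contract_eq] cadlag_X)
  have Y0: "Y 0 \<omega> = x" if "\<omega> \<in> space Q" for \<omega>
    using Y_eq[OF that, of 0 0] \<omega>M[OF that] X0 by (simp add: chain_position_def)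
  have comp: "(\<lambda>\<omega>. \<omega> k) \<in> Q \<rightarrow>\<^sub>M M" for k by (simp add: measurable_cong_sets[OF Q(2) refl])
  have Ym[measurable]: "Y t \<in> borel_measurable Q" if t: "0 \<le> t" for t
  proof -
    define n where "n = nat \<lfloor>t\<rfloor>"
    have "real n = of_int \<lfloor>t\<rfloor>" using t by (simp add: n_def)
    then have n: "real n \<le> t" "t \<le> real n + 1" by linarith+
    have "chain_position x n \<in> borel_measurable Q"
      using chain_position_measurable[of n UNIV x] by (simp add: measurable_cong_sets[OF Q(2) refl])
    moreover have "(\<lambda>\<omega>. X (t - real n) (\<omega> n)) \<in> borel_measurable Q"
      using n by (intro measurable_compose[OF comp X_measurable]) auto
    ultimately have "(\<lambda>\<omega>. chain_position x n \<omega> + X (t - real n) (\<omega> n)) \<in> borel_measurable Q" by measurable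
    then show ?thesis using Y_eq[OF _ n] by (simp cong: measurable_cong)
  qed
  have jump: "AE \<omega> in Q. left_lim (\<lambda>r. Y r \<omega>) t = Y t \<omega>" if t: "0 < t" for t
  proof -
    \<comment> \<open>The interval with \<open>n < t \<le> n + 1\<close>, since left limits at an integer belong to the preceding segment.\<close>
    define n where "n = nat (\<lceil>t\<rceil> - 1)"
    have "\<lceil>t\<rceil> \<ge> 1" using t by (simp add: one_le_ceiling)
    then have "real n = of_int \<lceil>t\<rceil> - 1" by (simp add: n_def)
    then have n: "real n < t" "t \<le> real n + 1" by linarith+
    have "AE z in M. ((\<lambda>r. X r z) \<longlongrightarrow> X (t - real n) z) (at_left (t - real n))"
      using n by (intro no_fixed_jump) auto
    then obtain Z where Z: "Z \<in> null_sets M"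
        "\<And>z. z \<in> space M \<Longrightarrow> z \<notin> Z \<Longrightarrow> ((\<lambda>r. X r z) \<longlongrightarrow> X (t - real n) z) (at_left (t - real n))"
      unfolding eventually_ae_filter by blast
    have Zm[measurable]: "Z \<in> sets M" using Z by auto
    have "(\<integral>\<^sup>+\<omega>. indicator Z (\<omega> n) \<partial>Q) = (\<integral>\<^sup>+\<omega>. (\<lambda>(a, z). indicator Z z) (restrict \<omega> {0..<n}, \<omega> n) \<partial>Q)" by simp
    also have "\<dots> = (\<integral>\<^sup>+\<omega>. (\<integral>\<^sup>+z. (\<lambda>(a, z). indicator Z z) (restrict \<omega> {0..<n}, z) \<partial>segment_law (chain_position x n \<omega>)) \<partial>Q)"
      by (rule Q_step) measurable
    also have "\<dots> = (\<integral>\<^sup>+\<omega>. 0 \<partial>Q)"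
    proof (rule nn_integral_cong)
      fix \<omega>
      have "emeasure (segment_law (chain_position x n \<omega>)) Z = 0"
        unfolding segment_law_def using Z(1) by (subst emeasure_density) (auto intro!: nn_integral_null_set)
      then show "(\<integral>\<^sup>+z. (\<lambda>(a, z). indicator Z z) (restrict \<omega> {0..<n}, z) \<partial>segment_law (chain_position x n \<omega>)) = 0"
        by simp
    qed
    finally have "(\<integral>\<^sup>+\<omega>. indicator Z (\<omega> n) \<partial>Q) = 0" by simp
    then have "AE \<omega> in Q. (indicator Z (\<omega> n) :: ennreal) = 0"
      using comp[of n] by (subst (asm) nn_integral_0_iff_AE) auto
    with AE_space show ?thesis
    proof eventually_elim
      case (elim \<omega>)
      then have "((\<lambda>r. X r (\<omega> n)) \<longlongrightarrow> X (t - real n) (\<omega> n)) (at_left (t - real n))"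
        using \<omega>M[of \<omega> n] by (intro Z) (auto split: split_indicator_asm)
      from tendsto_concat_path_left[where p="\<lambda>n r. X r (\<omega> n)" and y="\<lambda>n. chain_position x n \<omega>", OF n this]
      have "((\<lambda>r. Y r \<omega>) \<longlongrightarrow> Y t \<omega>) (at_left t)"
        using Y_eq[of \<omega> n t] elim n by (simp add: Y_def chain_path_def[abs_def])
      then show ?case by (rule left_lim_eqI)
    qed
  qed
  let ?past = "\<lambda>s. process_sigma (space Q) Y {0..s}"
  have op: "(\<integral>\<^sup>+y. f y \<partial>transition t z) = intrinsic_op t f z" if "0 \<le> t" "f \<in> borel_measurable borel" for t f z
    by (rule nn_integral_transition[OF that])
  have unit: "(\<integral>\<^sup>+\<omega>. indicator A \<omega> * f (Y t \<omega>) \<partial>Q) = (\<integral>\<^sup>+\<omega>. indicator A \<omega> * intrinsic_op (t - s) f (Y s \<omega>) \<partial>Q)"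
    if n: "real n \<le> s" "s < real n + 1" and st: "s \<le> t" "t \<le> real n + 1"
      and A: "A \<in> sets (?past s)" and f[measurable]: "f \<in> borel_measurable borel" for n s t A f
  proof -
    let ?Pi = "PiM {0..<n} (\<lambda>_. M)"
    let ?G = "?Pi \<Otimes>\<^sub>M past (s - real n)"
    \<comment> \<open>The past up to \<open>s\<close> consists of the complete segments before \<open>n\<close> and of segment \<open>n\<close> up to \<open>s - n\<close>.\<close>
    define \<rho> where "\<rho> \<omega> = (restrict \<omega> {0..<n}, \<omega> n)" for \<omega> :: "nat \<Rightarrow> 'w"
    have \<rho>: "\<rho> \<in> space Q \<rightarrow> space ?G"
      unfolding \<rho>_def spQ by (auto simp: space_pair_measure space_PiM)
    have "sets (?past s) \<subseteq> sets (vimage_algebra (space Q) \<rho> ?G)"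
    proof (rule sets_process_sigma_subset)
      fix r assume r: "r \<in> {0..s}"
      have "\<exists>g\<in>borel_measurable ?G. \<forall>\<omega>\<in>space Q. Y r \<omega> = g (\<rho> \<omega>)"
      proof (cases "real n \<le> r")
        case True
        show ?thesis
        proof (intro bexI[of _ "\<lambda>(a, z). chain_position x n a + X (r - real n) z"] ballI)
          fix \<omega> assume "\<omega> \<in> space Q"
          then show "Y r \<omega> = (\<lambda>(a, z). chain_position x n a + X (r - real n) z) (\<rho> \<omega>)"
            using Y_eq[of \<omega> n r] True r n by (simp add: \<rho>_def chain_position_restrict)
        next
          have [measurable]: "X (r - real n) \<in> borel_measurable (past (s - real n))"
            using True r by (intro X_past) auto
          have [measurable]: "chain_position x n \<in> borel_measurable ?Pi"
            by (rule chain_position_measurable) auto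
          show "(\<lambda>(a, z). chain_position x n a + X (r - real n) z) \<in> borel_measurable ?G" by measurable
        qed
      next
        case False
        define k where "k = nat \<lfloor>r\<rfloor>"
        have "real k = of_int \<lfloor>r\<rfloor>" using r by (simp add: k_def)
        then have k: "real k \<le> r" "r \<le> real k + 1" by linarith+
        have kn: "k < n" using k False by linarith
        show ?thesis
        proof (intro bexI[of _ "\<lambda>(a, z). chain_position x k a + X (r - real k) (a k)"] ballI)
          fix \<omega> assume "\<omega> \<in> space Q"
          then show "Y r \<omega> = (\<lambda>(a, z). chain_position x k a + X (r - real k) (a k)) (\<rho> \<omega>)"
            using Y_eq[of \<omega> k r] k kn by (simp add: \<rho>_def chain_position_restrict)
        next
          have [measurable]: "(\<lambda>a. X (r - real k) (a k)) \<in> borel_measurable ?Pi"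
            using k kn
            by (intro measurable_compose[OF measurable_component_singleton[of k "{0..<n}" "\<lambda>_. M"] X_measurable[of "r - real k"]]) auto
          have [measurable]: "chain_position x k \<in> borel_measurable ?Pi"
            using kn by (intro chain_position_measurable) auto
          show "(\<lambda>(a, z). chain_position x k a + X (r - real k) (a k)) \<in> borel_measurable ?G" by measurable
        qed
      qed
      then obtain g where g: "g \<in> borel_measurable ?G" "\<And>\<omega>. \<omega> \<in> space Q \<Longrightarrow> Y r \<omega> = g (\<rho> \<omega>)" by blast
      have "(\<lambda>\<omega>. g (\<rho> \<omega>)) \<in> borel_measurable (vimage_algebra (space Q) \<rho> ?G)"
        by (rule measurable_compose[OF measurable_vimage_algebra1[OF \<rho>] g(1)])
      then show "Y r \<in> borel_measurable (vimage_algebra (space Q) \<rho> ?G)"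
        using g(2) by (subst measurable_cong[where g="\<lambda>\<omega>. g (\<rho> \<omega>)"]) auto
    qed simp
    with A obtain A' where A': "A' \<in> sets ?G" "A = \<rho> -` A' \<inter> space Q"
      unfolding sets_vimage_algebra2[OF \<rho>] by blast
    have [measurable]: "(\<lambda>z. z) \<in> M \<rightarrow>\<^sub>M past (s - real n)"
      using sets_past_subset[of "s - real n"] by (auto intro!: measurableI simp: sets.sets_into_space Int_absorb2 subset_eq)
    have iA[measurable]: "indicator A' \<in> borel_measurable ?G" using A'(1) by simp
    have "(\<lambda>z. indicator A' (fst z, snd z) :: ennreal) \<in> borel_measurable (?Pi \<Otimes>\<^sub>M M)"
      by (rule measurable_compose[OF _ iA]) measurable
    then have [measurable]: "(indicator A' :: _ \<Rightarrow> ennreal) \<in> borel_measurable (?Pi \<Otimes>\<^sub>M M)" by simp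
    have [measurable]: "chain_position x n \<in> borel_measurable ?Pi" by (rule chain_position_measurable) auto
    have [measurable]: "X (t - real n) \<in> borel_measurable M" "X (s - real n) \<in> borel_measurable M" using n st by auto
    have [measurable]: "intrinsic_op (t - s) f \<in> borel_measurable borel"
      using st f by (intro intrinsic_op_measurable) auto
    have iA1: "(\<lambda>z. indicator A' (a, z)) \<in> borel_measurable (past (s - real n))" if "a \<in> space ?Pi" for a
      using that by (intro measurable_compose[OF measurable_Pair1' iA])
    have key: "(\<integral>\<^sup>+\<omega>. indicator A \<omega> * g (Y r \<omega>) \<partial>Q)
      = (\<integral>\<^sup>+\<omega>. (\<integral>\<^sup>+z. indicator A' (restrict \<omega> {0..<n}, z) * g (chain_position x n \<omega> + X (r - real n) z)
            \<partial>segment_law (chain_position x n \<omega>)) \<partial>Q)"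
      if r: "real n \<le> r" "r \<le> real n + 1" and [measurable]: "g \<in> borel_measurable borel" for g r
    proof -
      let ?H = "\<lambda>(a, z). indicator A' (a, z) * g (chain_position x n a + X (r - real n) z)"
      have [measurable]: "X (r - real n) \<in> borel_measurable M" using r by simp
      have "(\<integral>\<^sup>+\<omega>. indicator A \<omega> * g (Y r \<omega>) \<partial>Q) = (\<integral>\<^sup>+\<omega>. ?H (restrict \<omega> {0..<n}, \<omega> n) \<partial>Q)"
        using Y_eq[OF _ r]
        by (intro nn_integral_cong) (simp add: A'(2) \<rho>_def chain_position_restrict indicator_def)
      also have "\<dots> = (\<integral>\<^sup>+\<omega>. (\<integral>\<^sup>+z. ?H (restrict \<omega> {0..<n}, z) \<partial>segment_law (chain_position x n \<omega>)) \<partial>Q)"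
        by (rule Q_step) measurable
      finally show ?thesis by (simp add: chain_position_restrict)
    qed
    have "(\<integral>\<^sup>+\<omega>. indicator A \<omega> * f (Y t \<omega>) \<partial>Q)
      = (\<integral>\<^sup>+\<omega>. (\<integral>\<^sup>+z. indicator A' (restrict \<omega> {0..<n}, z) * f (chain_position x n \<omega> + X (t - real n) z)
            \<partial>segment_law (chain_position x n \<omega>)) \<partial>Q)"
      using n st by (intro key) auto
    also have "\<dots> = (\<integral>\<^sup>+\<omega>. (\<integral>\<^sup>+z. indicator A' (restrict \<omega> {0..<n}, z) * intrinsic_op (t - real n - (s - real n)) f (chain_position x n \<omega> + X (s - real n) z)
            \<partial>segment_law (chain_position x n \<omega>)) \<partial>Q)"
      using n st \<omega>M by (intro nn_integral_cong segment_law_markov iA1) (auto simp: space_PiM)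
    also have "\<dots> = (\<integral>\<^sup>+\<omega>. indicator A \<omega> * intrinsic_op (t - s) f (Y s \<omega>) \<partial>Q)"
      using n st by (subst key) auto
    finally show ?thesis .
  qed
  have markov: "(\<integral>\<^sup>+\<omega>. indicator A \<omega> * f (Y t \<omega>) \<partial>Q) = (\<integral>\<^sup>+\<omega>. indicator A \<omega> * intrinsic_op (t - s) f (Y s \<omega>) \<partial>Q)"
    if "0 \<le> s" "s \<le> t" "t \<le> real m" and A: "A \<in> sets (?past s)" and f[measurable]: "f \<in> borel_measurable borel" for s t A f m
    using that
  proof (induction m arbitrary: t f)
    case 0
    then have "s = t" by simp
    then show ?case using intrinsic_op_0[OF 0(5)] by simp
  next
    case (Suc m)
    note [measurable] = Suc.prems(5)
    \<comment> \<open>If an integer lies strictly between the two times, the later time is first brought back to it.\<close>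
    consider "s = t" | "t \<le> real m" | "s < real m" "real m < t" | "real m \<le> s" "s < t"
      using Suc.prems(2) by linarith
    then show ?case
    proof cases
      case 1
      then show ?thesis using intrinsic_op_0[OF Suc.prems(5)] by simp
    next
      case 2
      then show ?thesis by (intro Suc.IH Suc.prems)
    next
      case 3
      have m: "real m \<le> real m" "real m < real m + 1" "real m \<le> t" "t \<le> real m + 1" using 3 Suc.prems by auto
      have "A \<in> sets (?past (real m))"
        using Suc.prems(4) process_sigma_mono[of "{0..s}" "{0..real m}" "space Q" Y] 3 by auto
      then have "(\<integral>\<^sup>+\<omega>. indicator A \<omega> * f (Y t \<omega>) \<partial>Q) = (\<integral>\<^sup>+\<omega>. indicator A \<omega> * intrinsic_op (t - real m) f (Y (real m) \<omega>) \<partial>Q)"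
        by (intro unit[OF m] Suc.prems)
      also have "\<dots> = (\<integral>\<^sup>+\<omega>. indicator A \<omega> * intrinsic_op (real m - s) (intrinsic_op (t - real m) f) (Y s \<omega>) \<partial>Q)"
        using 3 m Suc.prems by (intro Suc.IH) auto
      also have "\<dots> = (\<integral>\<^sup>+\<omega>. indicator A \<omega> * intrinsic_op (t - s) f (Y s \<omega>) \<partial>Q)"
        using intrinsic_op_add[of "real m - s" "t - real m" f] 3 m by simp
      finally show ?thesis .
    next
      case 4
      then have "s < real m + 1" "t \<le> real m + 1" using Suc.prems by auto
      then show ?thesis using unit[of m s t A f] 4 Suc.prems by simp
    qed
  qed
  have "kernel_markov Q Y transition"
    unfolding kernel_markov_def
  proof (intro conjI allI impI)
    fix s t A and f :: "'a \<Rightarrow> ennreal"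
    assume *: "0 \<le> s" "s \<le> t" "A \<in> sets (?past s)" "f \<in> borel_measurable borel"
    obtain m :: nat where "t \<le> real m" using real_arch_simple by blast
    from markov[OF *(1,2) this *(3,4)]
    show "(\<integral>\<^sup>+\<omega>. indicator A \<omega> * f (Y t \<omega>) \<partial>Q) = (\<integral>\<^sup>+\<omega>. indicator A \<omega> * (\<integral>\<^sup>+y. f y \<partial>transition (t - s) (Y s \<omega>)) \<partial>Q)"
      using * by (simp add: op)
  qed (rule Ym)
  then show ?thesis
    using Q(1) cad Y0 jump by blast
qed

end

section \<open>From one-sided to two-sided paths\<close>

lemma kernel_markov_measurable: "kernel_markov Q Y N \<Longrightarrow> 0 \<le> t \<Longrightarrow> Y t \<in> borel_measurable Q"
  by (simp add: kernel_markov_def)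

lemma kernel_markovD:
  "kernel_markov Q Y N \<Longrightarrow> 0 \<le> s \<Longrightarrow> s \<le> t \<Longrightarrow> A \<in> sets (process_sigma (space Q) Y {0..s}) \<Longrightarrow> f \<in> borel_measurable borel \<Longrightarrow>
    (\<integral>\<^sup>+\<omega>. indicator A \<omega> * f (Y t \<omega>) \<partial>Q) = (\<integral>\<^sup>+\<omega>. indicator A \<omega> * (\<integral>\<^sup>+y. f y \<partial>N (t - s) (Y s \<omega>)) \<partial>Q)"
  by (simp add: kernel_markov_def)

lemma space_path_sigma [simp]: "space (path_sigma I) = cadlag_paths"
  by (simp add: path_sigma_def)

lemma process_sigma_reversed:
  "process_sigma cadlag_paths (\<lambda>t w. w (- t)) I = path_sigma (uminus ` I)"
  unfolding path_sigma_def process_sigma_def by (rule arg_cong[where f="sigma cadlag_paths"]) blast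

text \<open>
If a coordinate map composed with \<open>\<Phi>\<close> factors through \<open>\<pi>\<close>, then so do the preimages of all events
which these coordinates generate.
\<close>

lemma process_sigma_preimage:
  assumes \<Phi>: "\<Phi> \<in> space P \<rightarrow> S" and \<pi>: "\<pi> \<in> space P \<rightarrow> S'"
    and eq: "\<And>t z. t \<in> I \<Longrightarrow> z \<in> space P \<Longrightarrow> U t (\<Phi> z) = Z t (\<pi> z)"
    and A: "A \<in> sets (process_sigma S U I)"
  obtains A' where "A' \<in> sets (process_sigma S' Z I)" "\<Phi> -` A \<inter> space P = \<pi> -` A' \<inter> space P"
proof -
  let ?G = "vimage_algebra (space P) \<pi> (process_sigma S' Z I)"
  have \<pi>': "\<pi> \<in> space P \<rightarrow> space (process_sigma S' Z I)" using \<pi> by simp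
  have "\<Phi> \<in> ?G \<rightarrow>\<^sub>M process_sigma S U I"
  proof (rule measurable_process_sigma)
    fix t assume t: "t \<in> I"
    have "(\<lambda>z. Z t (\<pi> z)) \<in> borel_measurable ?G"
      by (rule measurable_compose[OF measurable_vimage_algebra1[OF \<pi>'] measurable_process_sigma_component[OF t]])
    then show "(\<lambda>z. U t (\<Phi> z)) \<in> borel_measurable ?G"
      using eq[OF t] by (subst measurable_cong[where g="\<lambda>z. Z t (\<pi> z)"]) auto
  qed (use \<Phi> in auto)
  from measurable_sets[OF this A] have "\<Phi> -` A \<inter> space P \<in> sets ?G" by simp
  then obtain A' where "A' \<in> sets (process_sigma S' Z I)" "\<Phi> -` A \<inter> space P = \<pi> -` A' \<inter> space P"
    unfolding sets_vimage_algebra2[OF \<pi>'] by blast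
  then show thesis by (rule that)
qed

text \<open>
Both half-lines of the two-sided process are images of one factor of a product space; this lemma
serves for both.
\<close>

lemma kernel_markov_transfer:
  fixes Z :: "real \<Rightarrow> 'w \<Rightarrow> 'a::euclidean_space"
  assumes km: "kernel_markov Q Z N"
    and \<Phi>: "\<Phi> \<in> P \<rightarrow>\<^sub>M R" and \<pi>: "\<pi> \<in> P \<rightarrow>\<^sub>M Q" and law: "distr P Q \<pi> = Q"
    and U: "\<And>t. 0 \<le> t \<Longrightarrow> U t \<in> borel_measurable R"
    and eq: "\<And>t z. 0 \<le> t \<Longrightarrow> z \<in> space P \<Longrightarrow> U t (\<Phi> z) = Z t (\<pi> z)"
    and N: "\<And>t f. 0 \<le> t \<Longrightarrow> f \<in> borel_measurable borel \<Longrightarrow> (\<lambda>x. \<integral>\<^sup>+y. f y \<partial>N t x) \<in> borel_measurable borel"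
  shows "kernel_markov (distr P R \<Phi>) U N"
  unfolding kernel_markov_def
proof (intro conjI allI impI)
  fix t :: real assume "0 \<le> t" then show "U t \<in> borel_measurable (distr P R \<Phi>)" using U by simp
next
  fix s t A and f :: "'a \<Rightarrow> ennreal"
  assume st: "0 \<le> s" "s \<le> t" and A: "A \<in> sets (process_sigma (space (distr P R \<Phi>)) U {0..s})"
    and f[measurable]: "f \<in> borel_measurable borel"
  have AR: "A \<in> sets R"
    using A sets_process_sigma_subset[of R "space R" "{0..s}" U] U by auto
  obtain A' where A': "A' \<in> sets (process_sigma (space Q) Z {0..s})" "\<Phi> -` A \<inter> space P = \<pi> -` A' \<inter> space P"
    using process_sigma_preimage[of \<Phi> P "space R" \<pi> "space Q" "{0..s}" U Z A] A eq
      measurable_space[OF \<Phi>] measurable_space[OF \<pi>] by auto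
  have Zm: "Z r \<in> borel_measurable Q" if "0 \<le> r" for r using kernel_markov_measurable[OF km that] .
  have A'Q: "A' \<in> sets Q"
    using A'(1) sets_process_sigma_subset[of Q "space Q" "{0..s}" Z] Zm by auto
  have key: "(\<integral>\<^sup>+w. indicator A w * g (U r w) \<partial>distr P R \<Phi>) = (\<integral>\<^sup>+\<omega>. indicator A' \<omega> * g (Z r \<omega>) \<partial>Q)"
    if r: "0 \<le> r" and g[measurable]: "g \<in> borel_measurable borel" for r and g :: "'a \<Rightarrow> ennreal"
  proof -
    note [measurable] = AR A'Q U[OF r] Zm[OF r] \<Phi> \<pi>
    have "(\<integral>\<^sup>+w. indicator A w * g (U r w) \<partial>distr P R \<Phi>) = (\<integral>\<^sup>+z. indicator A (\<Phi> z) * g (U r (\<Phi> z)) \<partial>P)"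
      by (rule nn_integral_distr) measurable
    also have "\<dots> = (\<integral>\<^sup>+z. indicator A' (\<pi> z) * g (Z r (\<pi> z)) \<partial>P)"
    proof (rule nn_integral_cong)
      fix z assume z: "z \<in> space P"
      then have "\<Phi> z \<in> A \<longleftrightarrow> \<pi> z \<in> A'" using A'(2) by blast
      then show "indicator A (\<Phi> z) * g (U r (\<Phi> z)) = indicator A' (\<pi> z) * g (Z r (\<pi> z))"
        using eq[OF r z] by (simp add: indicator_def)
    qed
    also have "\<dots> = (\<integral>\<^sup>+\<omega>. indicator A' \<omega> * g (Z r \<omega>) \<partial>distr P Q \<pi>)"
      by (rule nn_integral_distr[symmetric]) measurable
    finally show ?thesis unfolding law .
  qed
  show "(\<integral>\<^sup>+w. indicator A w * f (U t w) \<partial>distr P R \<Phi>)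
      = (\<integral>\<^sup>+w. indicator A w * (\<integral>\<^sup>+y. f y \<partial>N (t - s) (U s w)) \<partial>distr P R \<Phi>)"
    using key[of t f] key[of s "\<lambda>x. \<integral>\<^sup>+y. f y \<partial>N (t - s) x"] kernel_markovD[OF km st A'(1) f] N[OF _ f, of "t - s"] st
    by simp
qed

text \<open>
The left limits up to time \<open>s\<close> are determined by the path up to \<open>s\<close>, so their past is contained in
that of \<open>Y\<close>; and at each single time they agree with \<open>Y\<close> almost surely.
\<close>

lemma kernel_markov_left_limits:
  fixes Y :: "real \<Rightarrow> 'w \<Rightarrow> 'a::euclidean_space"
  assumes km: "kernel_markov Q Y N" and cad: "\<And>\<omega>. \<omega> \<in> space Q \<Longrightarrow> cadlag_on {0..} (\<lambda>t. Y t \<omega>)"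
    and jump: "\<And>t. 0 < t \<Longrightarrow> AE \<omega> in Q. left_lim (\<lambda>r. Y r \<omega>) t = Y t \<omega>"
  shows "kernel_markov Q (\<lambda>t \<omega>. if t = 0 then Y 0 \<omega> else left_lim (\<lambda>r. Y r \<omega>) t) N" (is "kernel_markov Q ?L N")
proof -
  note Ym = kernel_markov_measurable[OF km]
  have L_past: "?L t \<in> borel_measurable (process_sigma (space Q) Y {0..t})" if t: "0 \<le> t" for t
  proof (cases "t = 0")
    case True
    then show ?thesis using measurable_process_sigma_component[of 0 "{0..0}" Y "space Q"] by simp
  next
    case False
    define h where "h n = t - t / (real n + 1)" for n :: nat
    have h: "0 \<le> h n" "h n < t" for n using t False by (auto simp: h_def field_simps)
    have "(\<lambda>n. t / (real n + 1)) \<longlonglongrightarrow> 0"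
      using tendsto_mult_right_zero[OF LIMSEQ_Suc[OF lim_1_over_n], of t] by (simp add: field_simps)
    from tendsto_diff[OF tendsto_const this, of t] have hl: "filterlim h (at_left t) sequentially"
      unfolding filterlim_at using h by (auto intro!: always_eventually simp: h_def[abs_def] less_imp_neq)
    show ?thesis
    proof (rule borel_measurable_LIMSEQ_metric[where f="\<lambda>n. Y (h n)"])
      show "Y (h n) \<in> borel_measurable (process_sigma (space Q) Y {0..t})" for n
        using h[of n] by (intro measurable_process_sigma_component) auto
      fix \<omega> assume "\<omega> \<in> space (process_sigma (space Q) Y {0..t})"
      then have "((\<lambda>r. Y r \<omega>) \<longlongrightarrow> left_lim (\<lambda>r. Y r \<omega>) t) (at_left t)"
        using t False by (intro cadlag_left cad) auto
      from filterlim_compose[OF this hl] show "(\<lambda>n. Y (h n) \<omega>) \<longlonglongrightarrow> ?L t \<omega>" using False by simp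
    qed
  qed
  have past_sub: "sets (process_sigma (space Q) ?L {0..s}) \<subseteq> sets (process_sigma (space Q) Y {0..s})" for s
  proof (rule sets_process_sigma_subset)
    fix r assume r: "r \<in> {0..s}"
    have "subalgebra (process_sigma (space Q) Y {0..s}) (process_sigma (space Q) Y {0..r})"
      using process_sigma_mono[of "{0..r}" "{0..s}" "space Q" Y] r by (simp add: subalgebra_def)
    from measurable_from_subalg[OF this L_past[of r]] r
    show "?L r \<in> borel_measurable (process_sigma (space Q) Y {0..s})" by simp
  qed simp
  have eq: "AE \<omega> in Q. ?L t \<omega> = Y t \<omega>" if "0 \<le> t" for t
    using jump[of t] that by (cases "t = 0") auto
  show ?thesis
    unfolding kernel_markov_def
  proof (intro conjI allI impI)
    fix t :: real assume t: "0 \<le> t"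
    have "subalgebra Q (process_sigma (space Q) Y {0..t})"
      using sets_process_sigma_subset[of Q "space Q" "{0..t}" Y] Ym by (simp add: subalgebra_def)
    from measurable_from_subalg[OF this L_past[OF t]] show "?L t \<in> borel_measurable Q" .
  next
    fix s t A and f :: "'a \<Rightarrow> ennreal"
    assume st: "0 \<le> s" "s \<le> t" and A: "A \<in> sets (process_sigma (space Q) ?L {0..s})" and f: "f \<in> borel_measurable borel"
    have "(\<integral>\<^sup>+\<omega>. indicator A \<omega> * f (?L t \<omega>) \<partial>Q) = (\<integral>\<^sup>+\<omega>. indicator A \<omega> * f (Y t \<omega>) \<partial>Q)"
      by (rule nn_integral_cong_AE, rule AE_mp[OF eq[of t]]) (use st in auto)
    also have "\<dots> = (\<integral>\<^sup>+\<omega>. indicator A \<omega> * (\<integral>\<^sup>+y. f y \<partial>N (t - s) (Y s \<omega>)) \<partial>Q)"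
      using A past_sub by (intro kernel_markovD[OF km st _ f]) auto
    also have "\<dots> = (\<integral>\<^sup>+\<omega>. indicator A \<omega> * (\<integral>\<^sup>+y. f y \<partial>N (t - s) (?L s \<omega>)) \<partial>Q)"
      by (rule nn_integral_cong_AE, rule AE_mp[OF eq[of s]]) (use st in auto)
    finally show "(\<integral>\<^sup>+\<omega>. indicator A \<omega> * f (?L t \<omega>) \<partial>Q) = (\<integral>\<^sup>+\<omega>. indicator A \<omega> * (\<integral>\<^sup>+y. f y \<partial>N (t - s) (?L s \<omega>)) \<partial>Q)" .
  qed
qed

text \<open>
All paths start exactly at \<open>x\<close>, hence the value at time 0, which belongs to both half-lines, does not
disturb their independence.
\<close>

lemma two_sided_law_exists:
  fixes Y :: "real \<Rightarrow> 'w \<Rightarrow> 'a::euclidean_space"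
  assumes Q: "prob_space Q" and km: "kernel_markov Q Y N"
    and cad: "\<And>\<omega>. \<omega> \<in> space Q \<Longrightarrow> cadlag_on {0..} (\<lambda>t. Y t \<omega>)" and Y0: "\<And>\<omega>. \<omega> \<in> space Q \<Longrightarrow> Y 0 \<omega> = x"
    and jump: "\<And>t. 0 < t \<Longrightarrow> AE \<omega> in Q. left_lim (\<lambda>r. Y r \<omega>) t = Y t \<omega>"
    and N: "\<And>t f. 0 \<le> t \<Longrightarrow> f \<in> borel_measurable borel \<Longrightarrow> (\<lambda>x. \<integral>\<^sup>+y. f y \<partial>N t x) \<in> borel_measurable borel"
  shows "\<exists>\<mu>. prob_space \<mu> \<and> space \<mu> = cadlag_paths \<and> sets \<mu> = sets (path_sigma UNIV) \<and>
    measure \<mu> {w \<in> space \<mu>. w 0 = x} = 1 \<and>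
    prob_space.indep_set \<mu> (sets (path_sigma {0..})) (sets (path_sigma {..0})) \<and>
    kernel_markov \<mu> (\<lambda>t w. w t) N \<and> kernel_markov \<mu> (\<lambda>t w. w (- t)) N"
proof -
  interpret Q: prob_space Q by fact
  interpret PP: pair_prob_space Q Q by unfold_locales
  let ?P = "Q \<Otimes>\<^sub>M Q"
  let ?L = "\<lambda>t \<omega>. if t = 0 then Y 0 \<omega> else left_lim (\<lambda>r. Y r \<omega>) t"
  note kmL = kernel_markov_left_limits[OF km cad jump]
  note Ym = kernel_markov_measurable[OF km] and Lm = kernel_markov_measurable[OF kmL]
  define \<Phi> where "\<Phi> z = two_sided (\<lambda>t. Y t (fst z)) (\<lambda>t. Y t (snd z))" for z
  have \<Phi>_pos: "\<Phi> z t = Y t (fst z)" if "0 \<le> t" for t z using that by (simp add: \<Phi>_def two_sided_def)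
  have \<Phi>_neg: "\<Phi> z (- t) = ?L t (snd z)" if "0 \<le> t" "z \<in> space ?P" for t z
    using that Y0[of "fst z"] Y0[of "snd z"] by (auto simp: \<Phi>_def two_sided_def space_pair_measure)
  have \<Phi>_path: "\<Phi> z \<in> cadlag_paths" if "z \<in> space ?P" for z
    using that unfolding cadlag_paths_def \<Phi>_def
    by (auto intro!: cadlag_two_sided cad simp: Y0 space_pair_measure)
  have \<Phi>_m: "\<Phi> \<in> ?P \<rightarrow>\<^sub>M path_sigma UNIV"
    unfolding path_sigma_def
  proof (rule measurable_process_sigma[OF \<Phi>_path])
    fix t :: real
    show "(\<lambda>z. \<Phi> z t) \<in> borel_measurable ?P"
    proof (cases "0 \<le> t")
      case True
      then show ?thesis unfolding \<Phi>_pos[OF True] by (intro measurable_compose[OF measurable_fst Ym])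
    next
      case False
      then have "(\<lambda>z. ?L (- t) (snd z)) \<in> borel_measurable ?P"
        by (intro measurable_compose[OF measurable_snd Lm]) auto
      then show ?thesis using \<Phi>_neg[of "- t"] False by (subst measurable_cong[where g="\<lambda>z. ?L (- t) (snd z)"]) auto
    qed
  qed
  define \<mu> where "\<mu> = distr ?P (path_sigma UNIV) \<Phi>"
  have sp: "space \<mu> = cadlag_paths" and st: "sets \<mu> = sets (path_sigma UNIV)" by (auto simp: \<mu>_def)
  interpret \<mu>: prob_space \<mu> unfolding \<mu>_def by (rule PP.P.prob_space_distr[OF \<Phi>_m])
  have coord: "(\<lambda>w. w t) \<in> borel_measurable (path_sigma UNIV)" for t
    unfolding path_sigma_def by (rule measurable_process_sigma_component[where Y="\<lambda>t w. w t"]) simp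
  have fst_law: "distr ?P Q fst = Q"
    by (rule Q.distr_pair_fst)
  have snd_law: "distr ?P Q snd = Q"
  proof (rule measure_eqI)
    fix A assume "A \<in> sets (distr ?P Q snd)"
    then have A: "A \<in> Q.events" by simp
    then have "snd -` A \<inter> space ?P = space Q \<times> A"
      using sets.sets_into_space by (auto simp: space_pair_measure)
    then show "emeasure (distr ?P Q snd) A = emeasure Q A"
      using A by (simp add: emeasure_distr Q.emeasure_pair_measure_Times Q.emeasure_space_1)
  qed simp
  have one: "measure \<mu> {w \<in> space \<mu>. w 0 = x} = 1"
  proof (rule \<mu>.prob_eq_1[THEN iffD2])
    have "{w \<in> space \<mu>. w 0 = x} = (\<lambda>w. w 0) -` {x} \<inter> space (path_sigma UNIV)" by (auto simp: sp)
    then show "{w \<in> space \<mu>. w 0 = x} \<in> \<mu>.events" using measurable_sets[OF coord, of "{x}" 0] by (simp add: st)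
    have "AE z in ?P. \<Phi> z 0 = x"
      using \<Phi>_pos[of 0] Y0 by (intro AE_I2) (auto simp: space_pair_measure)
    then have "AE w in \<mu>. w 0 = x"
      unfolding \<mu>_def using measurable_sets[OF coord, of "{x}" 0]
      by (subst AE_distr_iff[OF \<Phi>_m]) (auto simp: vimage_def Int_def conj_commute)
    then show "AE w in \<mu>. w \<in> {w \<in> space \<mu>. w 0 = x}" using AE_space by eventually_elim simp
  qed
  have km1: "kernel_markov \<mu> (\<lambda>t w. w t) N"
    unfolding \<mu>_def
    by (rule kernel_markov_transfer[OF km \<Phi>_m measurable_fst fst_law]) (auto simp: coord N \<Phi>_pos)
  have km2: "kernel_markov \<mu> (\<lambda>t w. w (- t)) N"
    unfolding \<mu>_def
    by (rule kernel_markov_transfer[OF kmL \<Phi>_m measurable_snd snd_law]) (auto simp: coord N \<Phi>_neg)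
  have indep: "\<mu>.indep_set (sets (path_sigma {0..})) (sets (path_sigma {..0}))"
  proof (rule \<mu>.indep_setI)
    show sub: "sets (path_sigma {0..}) \<subseteq> \<mu>.events" "sets (path_sigma {..0}) \<subseteq> \<mu>.events"
      unfolding st unfolding path_sigma_def by (rule process_sigma_mono; simp)+
    fix A B :: "(real \<Rightarrow> 'a) set"
    assume A: "A \<in> sets (path_sigma {0..})" and B: "B \<in> sets (path_sigma {..0})"
    have \<Phi>P: "\<Phi> \<in> space ?P \<rightarrow> cadlag_paths" using \<Phi>_path by auto
    have fstP: "fst \<in> space ?P \<rightarrow> space Q" and sndP: "snd \<in> space ?P \<rightarrow> space Q"
      by (auto simp: space_pair_measure)
    have im: "uminus ` {0..} = {..0::real}"
      by (auto intro!: image_eqI[of _ _ "- y" for y])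
    have B': "B \<in> sets (process_sigma cadlag_paths (\<lambda>t w. w (- t)) {0..})"
      using B unfolding process_sigma_reversed im .
    obtain A' where A': "A' \<in> sets (process_sigma (space Q) Y {0..})" "\<Phi> -` A \<inter> space ?P = fst -` A' \<inter> space ?P"
      by (rule process_sigma_preimage[where Z=Y, OF \<Phi>P fstP _ A[unfolded path_sigma_def]]) (auto simp: \<Phi>_pos)
    obtain B' where B': "B' \<in> sets (process_sigma (space Q) ?L {0..})" "\<Phi> -` B \<inter> space ?P = snd -` B' \<inter> space ?P"
      by (rule process_sigma_preimage[where Z="?L", OF \<Phi>P sndP _ B']) (simp_all add: \<Phi>_neg)
    have A'Q: "A' \<in> Q.events" using A'(1) sets_process_sigma_subset[of Q "space Q" "{0..}" Y] Ym by auto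
    have B'Q: "B' \<in> Q.events" using B'(1) sets_process_sigma_subset[of Q "space Q" "{0..}" ?L] Lm by auto
    have AB: "A \<in> sets (path_sigma UNIV)" "B \<in> sets (path_sigma UNIV)" using A B sub st by auto
    have m: "\<mu>.prob C = measure ?P (\<Phi> -` C \<inter> space ?P)" if "C \<in> sets (path_sigma UNIV)" for C
      unfolding \<mu>_def using that by (intro measure_distr \<Phi>_m)
    have sub': "A' \<subseteq> space Q" "B' \<subseteq> space Q" using A'Q B'Q sets.sets_into_space by auto
    have e: "\<Phi> -` A \<inter> space ?P = A' \<times> space Q" "\<Phi> -` B \<inter> space ?P = space Q \<times> B'"
      "\<Phi> -` (A \<inter> B) \<inter> space ?P = A' \<times> B'"
    proof -
      show a: "\<Phi> -` A \<inter> space ?P = A' \<times> space Q" unfolding A' using sub' by (auto simp: space_pair_measure)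
      show b: "\<Phi> -` B \<inter> space ?P = space Q \<times> B'" unfolding B' using sub' by (auto simp: space_pair_measure)
      have "\<Phi> -` (A \<inter> B) \<inter> space ?P = (\<Phi> -` A \<inter> space ?P) \<inter> (\<Phi> -` B \<inter> space ?P)" by auto
      then show "\<Phi> -` (A \<inter> B) \<inter> space ?P = A' \<times> B'" unfolding a b using sub' by auto
    qed
    have mt: "measure ?P (C \<times> D) = measure Q C * measure Q D" if "C \<in> Q.events" "D \<in> Q.events" for C D
      using that by (simp add: measure_def Q.emeasure_pair_measure_Times enn2real_mult)
    show "\<mu>.prob (A \<inter> B) = \<mu>.prob A * \<mu>.prob B"
      unfolding m[OF AB(1)] m[OF AB(2)] m[OF sets.Int[OF AB]] e
      using A'Q B'Q by (simp add: mt Q.prob_space)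
  qed
  show ?thesis
    using \<mu>.prob_space_axioms sp st one indep km1 km2 by blast
qed

section \<open>Reversible transition kernels\<close>

locale reversible_transition =
  fixes N :: "real \<Rightarrow> 'a::euclidean_space \<Rightarrow> 'a measure" and m :: "'a measure"
  assumes prob_N: "0 \<le> t \<Longrightarrow> prob_space (N t x)"
    and sets_N [simp, measurable_cong]: "sets (N t x) = sets borel"
    and N_measurable: "0 \<le> t \<Longrightarrow> f \<in> borel_measurable borel \<Longrightarrow> (\<lambda>x. \<integral>\<^sup>+y. f y \<partial>N t x) \<in> borel_measurable borel"
    and N_zero: "N 0 x = return borel x"
    and N_add: "0 \<le> s \<Longrightarrow> 0 \<le> t \<Longrightarrow> f \<in> borel_measurable borel \<Longrightarrow>
      (\<integral>\<^sup>+y. f y \<partial>N (s + t) x) = (\<integral>\<^sup>+z. (\<integral>\<^sup>+y. f y \<partial>N t z) \<partial>N s x)"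
    and N_symmetric: "0 \<le> t \<Longrightarrow> f \<in> borel_measurable borel \<Longrightarrow> g \<in> borel_measurable borel \<Longrightarrow>
      (\<integral>\<^sup>+x. f x * (\<integral>\<^sup>+y. g y \<partial>N t x) \<partial>m) = (\<integral>\<^sup>+x. g x * (\<integral>\<^sup>+y. f y \<partial>N t x) \<partial>m)"
    and prob_m: "prob_space m"
    and sets_m [simp, measurable_cong]: "sets m = sets borel"
    and N_ac: "0 < t \<Longrightarrow> AE y in m. P y \<Longrightarrow> AE y in N t x. P y"
begin

definition transition_op :: "real \<Rightarrow> ('a \<Rightarrow> real) \<Rightarrow> 'a \<Rightarrow> real" where
  "transition_op t f x = (LINT y|N t x. f y)"

text \<open>
Bounded almost everywhere, not everywhere: at time 0 the operators are the identity and retain the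
values of a function on null sets.
\<close>

definition Linf :: "('a \<Rightarrow> real) set" where
  "Linf = {f \<in> borel_measurable borel. \<exists>C. AE x in m. \<bar>f x\<bar> \<le> C}"

lemma Linf_measurable [measurable_dest]: "f \<in> Linf \<Longrightarrow> f \<in> borel_measurable borel"
  by (simp add: Linf_def)

lemma Linf_bounded:
  assumes "f \<in> borel_measurable borel" "\<And>x. \<bar>f x\<bar> \<le> C"
  shows "f \<in> Linf"
  using assms by (auto simp: Linf_def)

lemma Linf_mult: "f \<in> Linf \<Longrightarrow> g \<in> Linf \<Longrightarrow> (\<lambda>x. f x * g x) \<in> Linf"
proof -
  assume "f \<in> Linf" "g \<in> Linf"
  then obtain C D where *: "AE x in m. \<bar>f x\<bar> \<le> C" "AE x in m. \<bar>g x\<bar> \<le> D"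
    and [measurable]: "f \<in> borel_measurable borel" "g \<in> borel_measurable borel" by (auto simp: Linf_def)
  have "AE x in m. \<bar>f x * g x\<bar> \<le> C * D"
    using * by eventually_elim (auto simp: abs_mult intro!: mult_mono intro: order_trans[OF abs_ge_zero])
  then show ?thesis by (auto simp: Linf_def)
qed

lemma Linf_diff: "f \<in> Linf \<Longrightarrow> g \<in> Linf \<Longrightarrow> (\<lambda>x. f x - g x) \<in> Linf"
proof -
  assume "f \<in> Linf" "g \<in> Linf"
  then obtain C D where *: "AE x in m. \<bar>f x\<bar> \<le> C" "AE x in m. \<bar>g x\<bar> \<le> D"
    and [measurable]: "f \<in> borel_measurable borel" "g \<in> borel_measurable borel" by (auto simp: Linf_def)
  have "AE x in m. \<bar>f x - g x\<bar> \<le> C + D"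
    using * by eventually_elim linarith
  then show ?thesis by (auto simp: Linf_def)
qed

text \<open>
The transition kernels are described by integrals of nonnegative functions; this splitting carries
their properties over to real-valued functions.
\<close>

lemma Linf_split:
  assumes "f \<in> Linf"
  obtains p q where "p \<in> Linf" "q \<in> Linf" "\<And>x. 0 \<le> p x" "\<And>x. 0 \<le> q x" "f = (\<lambda>x. p x - q x)"
proof (rule that[of "\<lambda>x. max (f x) 0" "\<lambda>x. max (- f x) 0"])
  obtain C where C: "AE x in m. \<bar>f x\<bar> \<le> C" and [measurable]: "f \<in> borel_measurable borel"
    using assms by (auto simp: Linf_def)
  have "AE x in m. \<bar>max (f x) 0\<bar> \<le> C" "AE x in m. \<bar>max (- f x) 0\<bar> \<le> C"
    using C by (eventually_elim, linarith)+
  then show "(\<lambda>x. max (f x) 0) \<in> Linf" "(\<lambda>x. max (- f x) 0) \<in> Linf" by (auto simp: Linf_def)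
qed auto

text \<open>
At time 0 the kernel sits at the single point \<open>x\<close>, so the bound depends on the value at \<open>x\<close>; at
positive times the kernel does not charge null sets.
\<close>

lemma Linf_AE_N:
  assumes f: "f \<in> Linf" and t: "0 \<le> t"
  shows "\<exists>C. AE y in N t x. \<bar>f y\<bar> \<le> C"
proof (cases "t = 0")
  case True
  have [measurable]: "f \<in> borel_measurable borel" using f by measurable
  have "AE y in N 0 x. \<bar>f y\<bar> \<le> \<bar>f x\<bar>"
    unfolding N_zero by (subst AE_return) auto
  then show ?thesis using True by blast
next
  case False
  then show ?thesis using f N_ac[of t] t by (auto simp: Linf_def)
qed

lemma Linf_integrable:
  assumes f: "f \<in> Linf" and t: "0 \<le> t"
  shows "integrable (N t x) f"
proof -
  obtain C where "AE y in N t x. \<bar>f y\<bar> \<le> C" using Linf_AE_N[OF assms] by blast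
  then show ?thesis
    using f prob_N[OF t, of x] by (intro finite_measure.integrable_const_bound[where B=C]) (auto simp: prob_space_def Linf_def)
qed

lemma Linf_integrable_m:
  assumes f: "f \<in> Linf"
  shows "integrable m f"
proof -
  obtain C where "AE y in m. \<bar>f y\<bar> \<le> C" using f by (auto simp: Linf_def)
  then show ?thesis
    using f prob_m by (intro finite_measure.integrable_const_bound[where B=C]) (auto simp: prob_space_def Linf_def)
qed

lemma transition_op_zero: "f \<in> Linf \<Longrightarrow> transition_op 0 f = f"
  by (auto simp: transition_op_def N_zero integral_return Linf_def)

lemma transition_op_diff: "f \<in> Linf \<Longrightarrow> g \<in> Linf \<Longrightarrow> 0 \<le> t \<Longrightarrow> transition_op t (\<lambda>x. f x - g x) x = transition_op t f x - transition_op t g x"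
  unfolding transition_op_def by (intro Bochner_Integration.integral_diff Linf_integrable)

lemma transition_op_one: "0 \<le> t \<Longrightarrow> transition_op t (\<lambda>_. 1) x = 1"
  using prob_space.prob_space[OF prob_N] by (simp add: transition_op_def)

lemma nn_integral_transition_op:
  assumes "f \<in> Linf" "\<And>x. 0 \<le> f x" "0 \<le> t"
  shows "(\<integral>\<^sup>+y. ennreal (f y) \<partial>N t x) = ennreal (transition_op t f x)" "0 \<le> transition_op t f x"
  using assms unfolding transition_op_def by (auto intro!: nn_integral_eq_integral Linf_integrable Bochner_Integration.integral_nonneg)

lemma transition_op_Linf:
  assumes f: "f \<in> Linf" and t: "0 \<le> t"
  shows "transition_op t f \<in> Linf"
proof (cases "t = 0")
  case True
  then show ?thesis using f transition_op_zero by simp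
next
  case False
  then have t': "0 < t" using t by simp
  have nonneg: "transition_op t p \<in> Linf" if p: "p \<in> Linf" "\<And>x. 0 \<le> p x" for p
  proof -
    obtain C where C: "AE y in m. \<bar>p y\<bar> \<le> C" and [measurable]: "p \<in> borel_measurable borel"
      using p by (auto simp: Linf_def)
    have eq: "transition_op t p = (\<lambda>x. enn2real (\<integral>\<^sup>+y. ennreal (p y) \<partial>N t x))"
      using nn_integral_transition_op[OF p t] by auto
    have "(\<lambda>x. \<integral>\<^sup>+y. ennreal (p y) \<partial>N t x) \<in> borel_measurable borel" by (rule N_measurable[OF t]) simp
    then have "transition_op t p \<in> borel_measurable borel" unfolding eq by measurable
    moreover have "\<bar>transition_op t p x\<bar> \<le> C" for x
    proof -
      interpret prob_space "N t x" by (rule prob_N[OF t])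
      have "AE y in N t x. p y \<le> C" using N_ac[OF t' C, of x] by eventually_elim simp
      from integral_mono_AE[OF Linf_integrable[OF p(1) t] integrable_const this]
      have "transition_op t p x \<le> (LINT y|N t x. C)" unfolding transition_op_def .
      then show ?thesis using nn_integral_transition_op(2)[OF p t, of x] by (simp add: prob_space)
    qed
    ultimately show ?thesis by (rule Linf_bounded)
  qed
  obtain p q where pq: "p \<in> Linf" "q \<in> Linf" "\<And>x. 0 \<le> p x" "\<And>x. 0 \<le> q x" "f = (\<lambda>x. p x - q x)"
    using Linf_split[OF f] by blast
  have "transition_op t f = (\<lambda>x. transition_op t p x - transition_op t q x)" unfolding pq(5) using transition_op_diff[OF pq(1,2) t] by auto
  then show ?thesis using nonneg pq by (auto intro: Linf_diff)
qed

lemma transition_op_add: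
  assumes f: "f \<in> Linf" and st: "0 \<le> s" "0 \<le> t"
  shows "transition_op (s + t) f x = transition_op s (transition_op t f) x"
proof -
  have nonneg: "transition_op (s + t) p x = transition_op s (transition_op t p) x" if p: "p \<in> Linf" "\<And>x. 0 \<le> p x" for p
  proof -
    have [measurable]: "p \<in> borel_measurable borel" using p by measurable
    have "ennreal (transition_op (s + t) p x) = (\<integral>\<^sup>+y. ennreal (p y) \<partial>N (s + t) x)" using p st by (simp add: nn_integral_transition_op)
    also have "\<dots> = (\<integral>\<^sup>+z. ennreal (transition_op t p z) \<partial>N s x)"
      by (subst N_add[OF st]) (simp_all add: nn_integral_transition_op(1)[OF p st(2)])
    also have "\<dots> = ennreal (transition_op s (transition_op t p) x)" by (intro nn_integral_transition_op transition_op_Linf p st)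
    finally show ?thesis
      using nn_integral_transition_op(2)[OF p, of "s + t" x] nn_integral_transition_op(2)[of "transition_op t p" s x] nn_integral_transition_op(2)[OF p st(2)] transition_op_Linf[OF p(1) st(2)] st
      by simp
  qed
  obtain p q where pq: "p \<in> Linf" "q \<in> Linf" "\<And>x. 0 \<le> p x" "\<And>x. 0 \<le> q x" "f = (\<lambda>x. p x - q x)"
    using Linf_split[OF f] by blast
  have "transition_op (s + t) f x = transition_op s (transition_op t p) x - transition_op s (transition_op t q) x"
    unfolding pq(5) using pq st by (simp add: transition_op_diff nonneg)
  also have "\<dots> = transition_op s (\<lambda>y. transition_op t p y - transition_op t q y) x"
    using pq st by (simp add: transition_op_diff transition_op_Linf)
  also have "(\<lambda>y. transition_op t p y - transition_op t q y) = transition_op t f" unfolding pq(5) using transition_op_diff[OF pq(1,2) st(2)] by auto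
  finally show ?thesis .
qed

lemma transition_op_symmetric:
  assumes f: "f \<in> Linf" and g: "g \<in> Linf" and t: "0 \<le> t"
  shows "(LINT x|m. f x * transition_op t g x) = (LINT x|m. g x * transition_op t f x)"
proof -
  have nonneg: "(LINT x|m. p x * transition_op t q x) = (LINT x|m. q x * transition_op t p x)"
    if p: "p \<in> Linf" "\<And>x. 0 \<le> p x" and q: "q \<in> Linf" "\<And>x. 0 \<le> q x" for p q
  proof -
    have [measurable]: "p \<in> borel_measurable borel" "q \<in> borel_measurable borel" using p q by measurable
    have [measurable]: "transition_op t p \<in> borel_measurable borel" "transition_op t q \<in> borel_measurable borel"
      using transition_op_Linf[OF p(1) t] transition_op_Linf[OF q(1) t] by measurable
    have "(LINT x|m. p x * transition_op t q x) = enn2real (\<integral>\<^sup>+x. ennreal (p x) * (\<integral>\<^sup>+y. ennreal (q y) \<partial>N t x) \<partial>m)"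
      unfolding nn_integral_transition_op(1)[OF q t] using p(2) nn_integral_transition_op(2)[OF q t]
      by (subst integral_eq_nn_integral) (simp_all add: ennreal_mult)
    also have "\<dots> = enn2real (\<integral>\<^sup>+x. ennreal (q x) * (\<integral>\<^sup>+y. ennreal (p y) \<partial>N t x) \<partial>m)"
      by (subst N_symmetric[OF t]) auto
    also have "\<dots> = (LINT x|m. q x * transition_op t p x)"
      unfolding nn_integral_transition_op(1)[OF p t] using q(2) nn_integral_transition_op(2)[OF p t]
      by (subst integral_eq_nn_integral) (simp_all add: ennreal_mult)
    finally show ?thesis .
  qed
  obtain p q where pq: "p \<in> Linf" "q \<in> Linf" "\<And>x. 0 \<le> p x" "\<And>x. 0 \<le> q x" "f = (\<lambda>x. p x - q x)"
    using Linf_split[OF f] by blast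
  obtain p' q' where pq': "p' \<in> Linf" "q' \<in> Linf" "\<And>x. 0 \<le> p' x" "\<And>x. 0 \<le> q' x" "g = (\<lambda>x. p' x - q' x)"
    using Linf_split[OF g] by blast
  have int: "integrable m (\<lambda>x. a x * transition_op t b x)" if "a \<in> Linf" "b \<in> Linf" for a b
    using that t by (intro Linf_integrable_m Linf_mult transition_op_Linf)
  have expand: "(LINT x|m. (a x - b x) * transition_op t (\<lambda>x. c x - d x) x) =
      (LINT x|m. a x * transition_op t c x) - (LINT x|m. a x * transition_op t d x) - ((LINT x|m. b x * transition_op t c x) - (LINT x|m. b x * transition_op t d x))"
    if "a \<in> Linf" "b \<in> Linf" "c \<in> Linf" "d \<in> Linf" for a b c d
  proof -
    have "(LINT x|m. (a x - b x) * transition_op t (\<lambda>x. c x - d x) x)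
      = (LINT x|m. (a x * transition_op t c x - a x * transition_op t d x) - (b x * transition_op t c x - b x * transition_op t d x))"
      using that t by (simp add: transition_op_diff algebra_simps)
    then show ?thesis using that int by (simp add: Bochner_Integration.integral_diff)
  qed
  show ?thesis
    unfolding pq(5) pq'(5) expand[OF pq(1,2) pq'(1,2)] expand[OF pq'(1,2) pq(1,2)]
      nonneg[OF pq(1,3) pq'(1,3)] nonneg[OF pq(1,3) pq'(2,4)]
      nonneg[OF pq(2,4) pq'(1,3)] nonneg[OF pq(2,4) pq'(2,4)] by simp
qed

end

locale kernel_process = reversible_transition N m + prob_space \<mu>
  for N :: "real \<Rightarrow> 'a::euclidean_space \<Rightarrow> 'a measure" and m and \<mu> :: "'w measure" +
  fixes U :: "real \<Rightarrow> 'w \<Rightarrow> 'a" and x :: 'a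
  assumes km: "kernel_markov \<mu> U N" and U0: "AE \<omega> in \<mu>. U 0 \<omega> = x"
begin

abbreviation "past s \<equiv> process_sigma (space \<mu>) U {0..s}"

lemma U_measurable: "0 \<le> t \<Longrightarrow> U t \<in> borel_measurable \<mu>"
  by (rule kernel_markov_measurable[OF km])

lemma past_events: "sets (past s) \<subseteq> events"
  by (intro sets_process_sigma_subset) (auto intro: U_measurable)

lemma subalgebra_past: "subalgebra \<mu> (past s)"
  using past_events by (simp add: subalgebra_def)

lemma U_past: "0 \<le> r \<Longrightarrow> r \<le> s \<Longrightarrow> U r \<in> borel_measurable (past s)"
  by (intro measurable_process_sigma_component) auto

lemma past_mono:
  assumes "r \<le> s" "F \<in> borel_measurable (past r)"
  shows "F \<in> borel_measurable (past s)"
proof -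
  have "subalgebra (past s) (past r)"
    using process_sigma_mono[of "{0..r}" "{0..s}" "space \<mu>" U] assms by (simp add: subalgebra_def)
  from measurable_from_subalg[OF this assms(2)] show ?thesis .
qed

text \<open>
The Markov property is applied to the whole space as event of time 0.
\<close>

lemma law: assumes t: "0 \<le> t" shows "distr \<mu> borel (U t) = N t x"
proof (rule measure_eqI)
  fix A assume "A \<in> sets (distr \<mu> borel (U t))"
  then have A[measurable]: "A \<in> sets borel" by simp
  note [measurable] = U_measurable[OF t]
  have "emeasure (distr \<mu> borel (U t)) A = (\<integral>\<^sup>+y. indicator A y \<partial>distr \<mu> borel (U t))" by simp
  also have "\<dots> = (\<integral>\<^sup>+\<omega>. indicator A (U t \<omega>) \<partial>\<mu>)" by (rule nn_integral_distr) measurable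
  also have "\<dots> = (\<integral>\<^sup>+\<omega>. indicator (space \<mu>) \<omega> * indicator A (U t \<omega>) \<partial>\<mu>)"
    by (intro nn_integral_cong) simp
  also have "\<dots> = (\<integral>\<^sup>+\<omega>. indicator (space \<mu>) \<omega> * (\<integral>\<^sup>+y. indicator A y \<partial>N (t - 0) (U 0 \<omega>)) \<partial>\<mu>)"
    using sets.top[of "past 0"] t by (intro kernel_markovD[OF km]) auto
  also have "\<dots> = (\<integral>\<^sup>+\<omega>. (\<integral>\<^sup>+y. indicator A y \<partial>N t x) \<partial>\<mu>)"
    by (rule nn_integral_cong_AE, rule AE_mp[OF U0]) auto
  finally show "emeasure (distr \<mu> borel (U t)) A = emeasure (N t x) A" by (simp add: emeasure_space_1)
qed simp

lemma Linf_AE_U: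
  assumes f: "f \<in> Linf" and t: "0 \<le> t"
  shows "\<exists>C. AE \<omega> in \<mu>. \<bar>f (U t \<omega>)\<bar> \<le> C"
proof -
  have [measurable]: "f \<in> borel_measurable borel" using f by measurable
  obtain C where "AE y in N t x. \<bar>f y\<bar> \<le> C" using Linf_AE_N[OF assms] by blast
  then have "AE \<omega> in \<mu>. \<bar>f (U t \<omega>)\<bar> \<le> C"
    unfolding law[OF t, symmetric] by (subst (asm) AE_distr_iff[OF U_measurable[OF t]]) auto
  then show ?thesis by blast
qed

lemma Linf_U_measurable: "f \<in> Linf \<Longrightarrow> 0 \<le> r \<Longrightarrow> r \<le> s \<Longrightarrow> (\<lambda>\<omega>. f (U r \<omega>)) \<in> borel_measurable (past s)"
  by (rule measurable_compose[OF U_past Linf_measurable])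

lemma integrable_bounded_past:
  assumes "F \<in> borel_measurable (past s)" "AE \<omega> in \<mu>. \<bar>F \<omega>\<bar> \<le> (C::real)"
  shows "integrable \<mu> F"
  using assms measurable_from_subalg[OF subalgebra_past] by (intro integrable_const_bound[where B=C]) auto

lemma integrable_U:
  assumes f: "f \<in> Linf" and t: "0 \<le> t"
  shows "integrable \<mu> (\<lambda>\<omega>. f (U t \<omega>))"
  using Linf_AE_U[OF assms] Linf_U_measurable[OF f t order_refl] integrable_bounded_past by blast

lemma expectation_U: "f \<in> Linf \<Longrightarrow> 0 \<le> t \<Longrightarrow> (LINT \<omega>|\<mu>. f (U t \<omega>)) = transition_op t f x"
  unfolding transition_op_def law[symmetric] by (subst integral_distr) (auto intro: U_measurable Linf_measurable)

lemma markov_event: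
  assumes f: "f \<in> Linf" and st: "0 \<le> s" "s \<le> t" and A: "A \<in> sets (past s)"
  shows "(LINT \<omega>|\<mu>. indicator A \<omega> * f (U t \<omega>)) = (LINT \<omega>|\<mu>. indicator A \<omega> * transition_op (t - s) f (U s \<omega>))"
proof -
  have [measurable]: "A \<in> events" using A past_events by auto
  have [measurable]: "U s \<in> borel_measurable \<mu>" "U t \<in> borel_measurable \<mu>" using st by (auto intro: U_measurable)
  have ts: "0 \<le> t - s" using st by simp
  have nonneg: "(LINT \<omega>|\<mu>. indicator A \<omega> * p (U t \<omega>)) = (LINT \<omega>|\<mu>. indicator A \<omega> * transition_op (t - s) p (U s \<omega>))"
    if p: "p \<in> Linf" "\<And>x. 0 \<le> p x" for p
  proof -
    have [measurable]: "p \<in> borel_measurable borel" "transition_op (t - s) p \<in> borel_measurable borel"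
      using p transition_op_Linf[OF p(1) ts] by measurable
    have "(LINT \<omega>|\<mu>. indicator A \<omega> * p (U t \<omega>)) = enn2real (\<integral>\<^sup>+\<omega>. ennreal (indicator A \<omega> * p (U t \<omega>)) \<partial>\<mu>)"
      using p by (intro integral_eq_nn_integral) auto
    also have "(\<integral>\<^sup>+\<omega>. ennreal (indicator A \<omega> * p (U t \<omega>)) \<partial>\<mu>) = (\<integral>\<^sup>+\<omega>. indicator A \<omega> * ennreal (p (U t \<omega>)) \<partial>\<mu>)"
      using p by (intro nn_integral_cong) (auto simp: indicator_def)
    also have "\<dots> = (\<integral>\<^sup>+\<omega>. indicator A \<omega> * (\<integral>\<^sup>+y. ennreal (p y) \<partial>N (t - s) (U s \<omega>)) \<partial>\<mu>)"
      by (intro kernel_markovD[OF km st A]) measurable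
    also have "\<dots> = (\<integral>\<^sup>+\<omega>. ennreal (indicator A \<omega> * transition_op (t - s) p (U s \<omega>)) \<partial>\<mu>)"
      using nn_integral_transition_op[OF p ts] by (intro nn_integral_cong) (auto simp: indicator_def)
    also have "enn2real \<dots> = (LINT \<omega>|\<mu>. indicator A \<omega> * transition_op (t - s) p (U s \<omega>))"
      using nn_integral_transition_op(2)[OF p ts] by (intro integral_eq_nn_integral[symmetric]) auto
    finally show ?thesis .
  qed
  obtain p q where pq: "p \<in> Linf" "q \<in> Linf" "\<And>x. 0 \<le> p x" "\<And>x. 0 \<le> q x" "f = (\<lambda>x. p x - q x)"
    using Linf_split[OF f] by blast
  have int: "integrable \<mu> (\<lambda>\<omega>. indicator A \<omega> * g (U r \<omega>))" if "g \<in> Linf" "0 \<le> r" for g r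
    using integrable_mult_indicator[OF \<open>A \<in> events\<close> integrable_U[OF that]] by simp
  have "(LINT \<omega>|\<mu>. indicator A \<omega> * f (U t \<omega>)) = (LINT \<omega>|\<mu>. indicator A \<omega> * p (U t \<omega>) - indicator A \<omega> * q (U t \<omega>))"
    unfolding pq(5) by (simp add: right_diff_distrib)
  also have "\<dots> = (LINT \<omega>|\<mu>. indicator A \<omega> * p (U t \<omega>)) - (LINT \<omega>|\<mu>. indicator A \<omega> * q (U t \<omega>))"
    using pq st by (intro Bochner_Integration.integral_diff int) auto
  also have "\<dots> = (LINT \<omega>|\<mu>. indicator A \<omega> * transition_op (t - s) p (U s \<omega>)) - (LINT \<omega>|\<mu>. indicator A \<omega> * transition_op (t - s) q (U s \<omega>))"
    using pq by (simp add: nonneg)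
  also have "\<dots> = (LINT \<omega>|\<mu>. indicator A \<omega> * transition_op (t - s) p (U s \<omega>) - indicator A \<omega> * transition_op (t - s) q (U s \<omega>))"
    using pq st transition_op_Linf ts by (intro Bochner_Integration.integral_diff[symmetric] int) auto
  also have "\<dots> = (LINT \<omega>|\<mu>. indicator A \<omega> * transition_op (t - s) f (U s \<omega>))"
    unfolding pq(5) using transition_op_diff[OF pq(1,2) ts] by (simp add: right_diff_distrib)
  finally show ?thesis .
qed

text \<open>
The \<open>\<sigma>\<close>-field may be anything between the present and the past. The two extreme cases give the
Markov property in terms of conditional expectations.
\<close>

lemma cond_exp:
  assumes f: "f \<in> Linf" and st: "0 \<le> s" "s \<le> t"
    and G: "space G = space \<mu>" "sets G \<subseteq> sets (past s)" "U s \<in> borel_measurable G"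
  shows "AE \<omega> in \<mu>. real_cond_exp \<mu> G (\<lambda>\<omega>. f (U t \<omega>)) \<omega> = transition_op (t - s) f (U s \<omega>)"
proof -
  have "finite_measure_subalgebra \<mu> G"
    using G past_events[of s] by unfold_locales (auto simp: subalgebra_def)
  then interpret G: sigma_finite_subalgebra \<mu> G by (rule finite_measure_subalgebra_is_sigma_finite)
  have opL: "transition_op (t - s) f \<in> Linf" using st f by (intro transition_op_Linf) auto
  show ?thesis
  proof (rule G.real_cond_exp_charact)
    fix A assume "A \<in> sets G"
    then show "(LINT \<omega>:A|\<mu>. f (U t \<omega>)) = (LINT \<omega>:A|\<mu>. transition_op (t - s) f (U s \<omega>))"
      using markov_event[OF f st, of A] G by (auto simp: set_lebesgue_integral_def)
  next
    show "integrable \<mu> (\<lambda>\<omega>. f (U t \<omega>))" "integrable \<mu> (\<lambda>\<omega>. transition_op (t - s) f (U s \<omega>))"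
      using f opL st by (auto intro!: integrable_U)
    show "(\<lambda>\<omega>. transition_op (t - s) f (U s \<omega>)) \<in> borel_measurable G"
      by (rule measurable_compose[OF G(3) Linf_measurable[OF opL]])
  qed
qed

lemma markov_process_past: "markov_process \<mu> past U"
  unfolding markov_process_def
proof (intro conjI allI impI ballI)
  fix s t :: real and f :: "'a \<Rightarrow> real"
  assume f: "f \<in> borel_measurable borel" and *: "0 \<le> s \<and> s \<le> t \<and> bounded (range f)"
  then have st: "0 \<le> s" "s \<le> t" by auto
  obtain C where "\<And>y. \<bar>f y\<bar> \<le> C" using * unfolding bounded_iff by auto
  with f have fL: "f \<in> Linf" by (rule Linf_bounded)
  let ?V = "vimage_algebra (space \<mu>) (U s) borel"
  have "U s \<in> space \<mu> \<rightarrow> space borel" by simp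
  then have V: "sets ?V \<subseteq> sets (past s)" "U s \<in> borel_measurable ?V"
    using measurable_sets[OF U_past[OF st(1) order_refl]]
    by (auto simp: sets_vimage_algebra2 intro: measurable_vimage_algebra1)
  have "AE \<omega> in \<mu>. real_cond_exp \<mu> (past s) (\<lambda>\<omega>. f (U t \<omega>)) \<omega> = transition_op (t - s) f (U s \<omega>)"
    using st by (intro cond_exp[OF fL st]) (auto intro: U_past)
  moreover have "AE \<omega> in \<mu>. real_cond_exp \<mu> ?V (\<lambda>\<omega>. f (U t \<omega>)) \<omega> = transition_op (t - s) f (U s \<omega>)"
    using V by (intro cond_exp[OF fL st]) auto
  ultimately show "AE \<omega> in \<mu>. real_cond_exp \<mu> (past s) (\<lambda>\<omega>. f (U t \<omega>)) \<omega> = real_cond_exp \<mu> ?V (\<lambda>\<omega>. f (U t \<omega>)) \<omega>"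
    by eventually_elim simp
next
  fix s t :: real assume "0 \<le> s \<and> s \<le> t"
  then show "sets (past s) \<subseteq> sets (past t)" by (intro process_sigma_mono) auto
next
  fix t :: real assume "0 \<le> t"
  then show "subalgebra \<mu> (past t)" "U t \<in> borel_measurable (past t)"
    using subalgebra_past U_past by auto
qed

lemma markov_product:
  assumes f: "f \<in> Linf" and st: "0 \<le> s" "s \<le> t"
    and F: "F \<in> borel_measurable (past s)" "AE \<omega> in \<mu>. \<bar>F \<omega>\<bar> \<le> (C::real)"
  shows "(LINT \<omega>|\<mu>. F \<omega> * f (U t \<omega>)) = (LINT \<omega>|\<mu>. F \<omega> * transition_op (t - s) f (U s \<omega>))"
proof -
  have "finite_measure_subalgebra \<mu> (past s)"
    using subalgebra_past[of s] by unfold_locales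
  then interpret G: sigma_finite_subalgebra \<mu> "past s" by (rule finite_measure_subalgebra_is_sigma_finite)
  have t: "0 \<le> t" using st by simp
  have opL: "transition_op (t - s) f \<in> Linf" using st f by (intro transition_op_Linf) auto
  note [measurable] = Linf_measurable[OF f] Linf_measurable[OF opL] U_measurable[OF st(1)] U_measurable[OF t]
    measurable_from_subalg[OF subalgebra_past F(1)]
  obtain D where "AE \<omega> in \<mu>. \<bar>f (U t \<omega>)\<bar> \<le> D" using Linf_AE_U[OF f t] by blast
  with F(2) have "AE \<omega> in \<mu>. \<bar>F \<omega> * f (U t \<omega>)\<bar> \<le> C * D"
    by eventually_elim (auto simp: abs_mult intro!: mult_mono intro: order_trans[OF abs_ge_zero])
  then have int: "integrable \<mu> (\<lambda>\<omega>. F \<omega> * f (U t \<omega>))"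
    by (intro integrable_const_bound[where B="C * D"]) auto
  have "(LINT \<omega>|\<mu>. F \<omega> * f (U t \<omega>)) = (LINT \<omega>|\<mu>. F \<omega> * real_cond_exp \<mu> (past s) (\<lambda>\<omega>. f (U t \<omega>)) \<omega>)"
    by (rule G.real_cond_exp_intg(2)[symmetric, OF int F(1)]) measurable
  also have "\<dots> = (LINT \<omega>|\<mu>. F \<omega> * transition_op (t - s) f (U s \<omega>))"
  proof (rule integral_cong_AE)
    have "AE \<omega> in \<mu>. real_cond_exp \<mu> (past s) (\<lambda>\<omega>. f (U t \<omega>)) \<omega> = transition_op (t - s) f (U s \<omega>)"
      using st by (intro cond_exp[OF f st]) (auto intro: U_past)
    then show "AE \<omega> in \<mu>. F \<omega> * real_cond_exp \<mu> (past s) (\<lambda>\<omega>. f (U t \<omega>)) \<omega> = F \<omega> * transition_op (t - s) f (U s \<omega>)"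
      by eventually_elim simp
  qed measurable
  finally show ?thesis .
qed

lemma bounded_past_mult:
  assumes "F \<in> borel_measurable (past s)" "AE \<omega> in \<mu>. \<bar>F \<omega>\<bar> \<le> (C::real)" and f: "f \<in> Linf" and s: "0 \<le> s"
  shows "(\<lambda>\<omega>. F \<omega> * f (U s \<omega>)) \<in> borel_measurable (past s)" "\<exists>D. AE \<omega> in \<mu>. \<bar>F \<omega> * f (U s \<omega>)\<bar> \<le> D"
proof -
  note [measurable] = assms(1) Linf_U_measurable[OF f s order_refl]
  show "(\<lambda>\<omega>. F \<omega> * f (U s \<omega>)) \<in> borel_measurable (past s)" by measurable
  obtain D where "AE \<omega> in \<mu>. \<bar>f (U s \<omega>)\<bar> \<le> D" using Linf_AE_U[OF f s] by blast
  with assms(2) have "AE \<omega> in \<mu>. \<bar>F \<omega> * f (U s \<omega>)\<bar> \<le> C * D"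
    by eventually_elim (auto simp: abs_mult intro!: mult_mono intro: order_trans[OF abs_ge_zero])
  then show "\<exists>D. AE \<omega> in \<mu>. \<bar>F \<omega> * f (U s \<omega>)\<bar> \<le> D" by blast
qed

end

context reversible_transition
begin

text \<open>
In particular every function to which an operator is applied within the chain is again admissible.
\<close>

lemma chain_Linf:
  "(\<And>j. k \<le> j \<Longrightarrow> j < k + n \<Longrightarrow> t j \<le> t (Suc j)) \<Longrightarrow> (\<And>j. k < j \<Longrightarrow> j \<le> k + n \<Longrightarrow> f j \<in> Linf) \<Longrightarrow>
    semigroup_chain transition_op t f k n \<in> Linf"
proof (induction n arbitrary: k)
  case 0
  then show ?case by (simp add: Linf_bounded[where C=1])
next
  case (Suc n)
  have "semigroup_chain transition_op t f (Suc k) n \<in> Linf" using Suc.prems by (intro Suc.IH) auto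
  then show ?case using Suc.prems(1)[of k] Suc.prems(2)[of "Suc k"] by (auto intro!: transition_op_Linf Linf_mult)
qed

text \<open>
The operator expression for the times \<open>t 0 \<le> \<dots> \<le> t k\<close> seen from the latest one, where
\<open>semigroup_chain\<close> looks from the earliest one.
\<close>

primrec backward_chain :: "(nat \<Rightarrow> real) \<Rightarrow> (nat \<Rightarrow> 'a \<Rightarrow> real) \<Rightarrow> nat \<Rightarrow> 'a \<Rightarrow> real" where
  "backward_chain t f 0 = f 0"
| "backward_chain t f (Suc k) = (\<lambda>x. f (Suc k) x * transition_op (t (Suc k) - t k) (backward_chain t f k) x)"

lemma backward_chain_Linf:
  "(\<And>j. j < k \<Longrightarrow> t j \<le> t (Suc j)) \<Longrightarrow> (\<And>j. j \<le> k \<Longrightarrow> f j \<in> Linf) \<Longrightarrow> backward_chain t f k \<in> Linf"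
  by (induction k) (auto intro!: transition_op_Linf Linf_mult)

text \<open>
Symmetry of the operators allows the point at which the product is cut to be moved by one step.
\<close>

lemma chain_pairing:
  assumes mono: "\<And>j. j < n \<Longrightarrow> t j \<le> t (Suc j)" and f: "\<And>j. j \<le> n \<Longrightarrow> f j \<in> Linf" and "k \<le> n"
  shows "(LINT x|m. backward_chain t f k x * semigroup_chain transition_op t f k (n - k) x) = (LINT x|m. f 0 x * semigroup_chain transition_op t f 0 n x)"
  using \<open>k \<le> n\<close>
proof (induction k)
  case 0
  then show ?case by simp
next
  case (Suc k)
  let ?g = "\<lambda>x. f (Suc k) x * semigroup_chain transition_op t f (Suc k) (n - Suc k) x"
  have g: "?g \<in> Linf" using Suc.prems mono f by (intro Linf_mult chain_Linf) auto
  have b: "backward_chain t f k \<in> Linf" using Suc.prems mono f by (intro backward_chain_Linf) auto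
  have "n - k = Suc (n - Suc k)" using Suc.prems by simp
  then have "(LINT x|m. f 0 x * semigroup_chain transition_op t f 0 n x) = (LINT x|m. backward_chain t f k x * transition_op (t (Suc k) - t k) ?g x)"
    using Suc by simp
  also have "\<dots> = (LINT x|m. ?g x * transition_op (t (Suc k) - t k) (backward_chain t f k) x)"
    using mono[of k] Suc.prems by (intro transition_op_symmetric b g) auto
  finally show ?case by (simp add: ac_simps)
qed

end

context kernel_process
begin

text \<open>
The Markov property is used at the earlier of two neighbouring times, after the induction
hypothesis has collapsed everything later into a function of the later time.
\<close>

lemma forward_product:
  assumes "0 \<le> t k" "\<And>j. k \<le> j \<Longrightarrow> j < k + n \<Longrightarrow> t j \<le> t (Suc j)" "\<And>j. k < j \<Longrightarrow> j \<le> k + n \<Longrightarrow> f j \<in> Linf"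
    and "F \<in> borel_measurable (past (t k))" "AE \<omega> in \<mu>. \<bar>F \<omega>\<bar> \<le> (C::real)"
  shows "(LINT \<omega>|\<mu>. F \<omega> * (\<Prod>j\<in>{Suc k..k + n}. f j (U (t j) \<omega>))) = (LINT \<omega>|\<mu>. F \<omega> * semigroup_chain transition_op t f k n (U (t k) \<omega>))"
  using assms
proof (induction n arbitrary: k F C)
  case 0
  then show ?case by simp
next
  case (Suc n)
  have tk: "t k \<le> t (Suc k)" using Suc.prems(2)[of k] by simp
  have t0: "0 \<le> t (Suc k)" using tk Suc.prems(1) by simp
  have fk: "f (Suc k) \<in> Linf" using Suc.prems(3)[of "Suc k"] by simp
  have chL: "semigroup_chain transition_op t f (Suc k) n \<in> Linf" using Suc.prems by (intro chain_Linf) auto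
  note F = past_mono[OF tk Suc.prems(4)]
  obtain D where D: "AE \<omega> in \<mu>. \<bar>F \<omega> * f (Suc k) (U (t (Suc k)) \<omega>)\<bar> \<le> D"
    using bounded_past_mult(2)[OF F Suc.prems(5) fk t0] by blast
  have "{Suc k..k + Suc n} = insert (Suc k) {Suc (Suc k)..Suc k + n}" by auto
  then have "(LINT \<omega>|\<mu>. F \<omega> * (\<Prod>j\<in>{Suc k..k + Suc n}. f j (U (t j) \<omega>)))
    = (LINT \<omega>|\<mu>. (F \<omega> * f (Suc k) (U (t (Suc k)) \<omega>)) * (\<Prod>j\<in>{Suc (Suc k)..Suc k + n}. f j (U (t j) \<omega>)))"
    by (simp add: mult.assoc)
  also have "\<dots> = (LINT \<omega>|\<mu>. (F \<omega> * f (Suc k) (U (t (Suc k)) \<omega>)) * semigroup_chain transition_op t f (Suc k) n (U (t (Suc k)) \<omega>))"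
    using Suc.prems by (intro Suc.IH[OF t0 _ _ bounded_past_mult(1)[OF F Suc.prems(5) fk t0] D]) auto
  also have "\<dots> = (LINT \<omega>|\<mu>. F \<omega> * (\<lambda>x. f (Suc k) x * semigroup_chain transition_op t f (Suc k) n x) (U (t (Suc k)) \<omega>))"
    by (simp add: mult.assoc)
  also have "\<dots> = (LINT \<omega>|\<mu>. F \<omega> * transition_op (t (Suc k) - t k) (\<lambda>x. f (Suc k) x * semigroup_chain transition_op t f (Suc k) n x) (U (t k) \<omega>))"
    by (rule markov_product[OF Linf_mult[OF fk chL] Suc.prems(1) tk Suc.prems(4,5)])
  finally show ?case by simp
qed

lemma forward_expectation:
  assumes "0 \<le> t k" "\<And>j. k \<le> j \<Longrightarrow> j < k + n \<Longrightarrow> t j \<le> t (Suc j)" "\<And>j. k \<le> j \<Longrightarrow> j \<le> k + n \<Longrightarrow> f j \<in> Linf"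
  shows "(LINT \<omega>|\<mu>. (\<Prod>j\<in>{k..k + n}. f j (U (t j) \<omega>))) = transition_op (t k) (\<lambda>y. f k y * semigroup_chain transition_op t f k n y) x"
proof -
  have fk: "f k \<in> Linf" using assms(3)[of k] by simp
  have chL: "semigroup_chain transition_op t f k n \<in> Linf" using assms by (intro chain_Linf) auto
  obtain C where C: "AE \<omega> in \<mu>. \<bar>f k (U (t k) \<omega>)\<bar> \<le> C" using Linf_AE_U[OF fk assms(1)] by blast
  have "{k..k + n} = insert k {Suc k..k + n}" by auto
  then have "(LINT \<omega>|\<mu>. (\<Prod>j\<in>{k..k + n}. f j (U (t j) \<omega>))) = (LINT \<omega>|\<mu>. f k (U (t k) \<omega>) * (\<Prod>j\<in>{Suc k..k + n}. f j (U (t j) \<omega>)))"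
    by simp
  also have "\<dots> = (LINT \<omega>|\<mu>. f k (U (t k) \<omega>) * semigroup_chain transition_op t f k n (U (t k) \<omega>))"
    using assms by (intro forward_product[where C=C] Linf_U_measurable fk C) auto
  also have "\<dots> = transition_op (t k) (\<lambda>y. f k y * semigroup_chain transition_op t f k n y) x"
    using expectation_U[OF Linf_mult[OF fk chL] assms(1)] by simp
  finally show ?thesis .
qed

lemma backward_product:
  assumes "t k \<le> 0" "\<And>j. j < k \<Longrightarrow> t j \<le> t (Suc j)" "\<And>j. j \<le> k \<Longrightarrow> f j \<in> Linf"
    and "F \<in> borel_measurable (past (- t k))" "AE \<omega> in \<mu>. \<bar>F \<omega>\<bar> \<le> (C::real)"
  shows "(LINT \<omega>|\<mu>. F \<omega> * (\<Prod>j\<le>k. f j (U (- t j) \<omega>))) = (LINT \<omega>|\<mu>. F \<omega> * backward_chain t f k (U (- t k) \<omega>))"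
  using assms
proof (induction k arbitrary: F C)
  case 0
  then show ?case by simp
next
  case (Suc k)
  have tk: "- t (Suc k) \<le> - t k" using Suc.prems(2)[of k] by simp
  have t0: "0 \<le> - t (Suc k)" using Suc.prems(1) by simp
  have tk0: "t k \<le> 0" using tk t0 by linarith
  have fk: "f (Suc k) \<in> Linf" using Suc.prems(3)[of "Suc k"] by simp
  have bL: "backward_chain t f k \<in> Linf" using Suc.prems by (intro backward_chain_Linf) auto
  let ?F = "\<lambda>\<omega>. F \<omega> * f (Suc k) (U (- t (Suc k)) \<omega>)"
  note F' = bounded_past_mult[OF Suc.prems(4,5) fk t0]
  obtain D where D: "AE \<omega> in \<mu>. \<bar>?F \<omega>\<bar> \<le> D" using F'(2) by blast
  have "(LINT \<omega>|\<mu>. F \<omega> * (\<Prod>j\<le>Suc k. f j (U (- t j) \<omega>))) = (LINT \<omega>|\<mu>. ?F \<omega> * (\<Prod>j\<le>k. f j (U (- t j) \<omega>)))"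
    by (simp add: ac_simps)
  also have "\<dots> = (LINT \<omega>|\<mu>. ?F \<omega> * backward_chain t f k (U (- t k) \<omega>))"
    using Suc.prems by (intro Suc.IH[OF tk0 _ _ past_mono[OF tk F'(1)] D]) auto
  also have "\<dots> = (LINT \<omega>|\<mu>. ?F \<omega> * transition_op (- t k - - t (Suc k)) (backward_chain t f k) (U (- t (Suc k)) \<omega>))"
    by (rule markov_product[OF bL t0 tk F'(1) D])
  finally show ?case by (simp add: mult.assoc)
qed

lemma backward_expectation:
  assumes "t k \<le> 0" "\<And>j. j < k \<Longrightarrow> t j \<le> t (Suc j)" "\<And>j. j \<le> k \<Longrightarrow> f j \<in> Linf"
  shows "(LINT \<omega>|\<mu>. (\<Prod>j\<le>k. f j (U (- t j) \<omega>))) = transition_op (- t k) (backward_chain t f k) x"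
proof -
  have "(LINT \<omega>|\<mu>. (\<Prod>j\<le>k. f j (U (- t j) \<omega>))) = (LINT \<omega>|\<mu>. 1 * backward_chain t f k (U (- t k) \<omega>))"
    using backward_product[OF assms, where F="\<lambda>_. 1" and C=1] by simp
  also have "\<dots> = transition_op (- t k) (backward_chain t f k) x"
    using expectation_U[OF backward_chain_Linf[of k t f], of "- t k"] assms by simp
  finally show ?thesis .
qed

end

section \<open>The intrinsic path measures\<close>

locale two_sided_process = reversible_transition N m + prob_space \<mu>
  for N :: "real \<Rightarrow> 'a::euclidean_space \<Rightarrow> 'a measure" and m and \<mu> :: "(real \<Rightarrow> 'a) measure" +
  fixes x :: 'a
  assumes space_\<mu>: "space \<mu> = cadlag_paths" and sets_\<mu>: "sets \<mu> = sets (path_sigma UNIV)"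
    and start: "measure \<mu> {w \<in> space \<mu>. w 0 = x} = 1"
    and independent: "indep_set (sets (path_sigma {0..})) (sets (path_sigma {..0}))"
    and forward_markov: "kernel_markov \<mu> (\<lambda>t w. w t) N"
    and backward_markov: "kernel_markov \<mu> (\<lambda>t w. w (- t)) N"
begin

lemma coordinate_measurable [measurable]: "(\<lambda>w. w t) \<in> borel_measurable \<mu>"
  using measurable_process_sigma_component[of t UNIV "\<lambda>t w. w t" cadlag_paths]
  by (simp add: path_sigma_def measurable_cong_sets[OF sets_\<mu> refl])

lemma AE_start: "AE w in \<mu>. w 0 = x"
proof -
  have "{w \<in> space \<mu>. w 0 = x} \<in> events" by measurable
  from prob_eq_1[OF this] start have "AE w in \<mu>. w \<in> {w \<in> space \<mu>. w 0 = x}" by simp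
  then show ?thesis by eventually_elim simp
qed

sublocale fwd: kernel_process N m \<mu> "\<lambda>t w. w t" x
  by unfold_locales (use forward_markov AE_start in auto)

sublocale bwd: kernel_process N m \<mu> "\<lambda>t w. w (- t)" x
  by unfold_locales (use backward_markov AE_start in auto)

lemma reflection: "distr \<mu> borel (\<lambda>w. w (- t)) = distr \<mu> borel (\<lambda>w. w t)"
  using fwd.law[of t] bwd.law[of t] fwd.law[of "- t"] bwd.law[of "- t"] by (cases "0 \<le> t") auto

lemma AE_coordinate_bounded:
  assumes "f \<in> Linf"
  shows "\<exists>C. AE w in \<mu>. \<bar>f (w t)\<bar> \<le> C"
  using fwd.Linf_AE_U[OF assms, of t] bwd.Linf_AE_U[OF assms, of "- t"] by (cases "0 \<le> t") auto

lemma integrable_product: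
  assumes "finite J" "\<And>j. j \<in> J \<Longrightarrow> f j \<in> Linf"
  shows "integrable \<mu> (\<lambda>w. \<Prod>j\<in>J. f j (w (t j)))"
proof -
  obtain C where "AE w in \<mu>. \<bar>\<Prod>j\<in>J. f j (w (t j))\<bar> \<le> C"
  proof (atomize_elim, use assms in \<open>induction J\<close>)
    case (insert i J)
    obtain C where C: "AE w in \<mu>. \<bar>\<Prod>j\<in>J. f j (w (t j))\<bar> \<le> C" using insert by auto
    obtain D where "AE w in \<mu>. \<bar>f i (w (t i))\<bar> \<le> D" using AE_coordinate_bounded[of "f i" "t i"] insert by auto
    with C have "AE w in \<mu>. \<bar>\<Prod>j\<in>insert i J. f j (w (t j))\<bar> \<le> D * C"
      by eventually_elim (use insert(1,2) in \<open>auto simp: abs_mult intro!: mult_mono intro: order_trans[OF abs_ge_zero]\<close>)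
    then show ?case by blast
  qed (auto intro!: exI[of _ 1])
  moreover have "(\<lambda>w. \<Prod>j\<in>J. f j (w (t j))) \<in> borel_measurable \<mu>"
    using assms by (intro borel_measurable_prod measurable_compose[OF coordinate_measurable Linf_measurable])
  ultimately show ?thesis by (intro integrable_const_bound[where B=C]) auto
qed

lemma expectation_mult:
  fixes a b :: "(real \<Rightarrow> 'a) \<Rightarrow> real"
  assumes a: "a \<in> borel_measurable (path_sigma {0..})" "integrable \<mu> a"
    and b: "b \<in> borel_measurable (path_sigma {..0})" "integrable \<mu> b"
  shows "(LINT w|\<mu>. a w * b w) = (LINT w|\<mu>. a w) * (LINT w|\<mu>. b w)"
proof (rule indep_var_lebesgue_integral[OF _ a(2) b(2)])
  have sub: "sigma_sets (space \<mu>) {X -` A \<inter> space \<mu> |A. A \<in> sets borel} \<subseteq> sets (path_sigma I)"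
    if "X \<in> borel_measurable (path_sigma I)" for X :: "(real \<Rightarrow> 'a) \<Rightarrow> real" and I
  proof -
    have "sigma_sets (space (path_sigma I)) {X -` A \<inter> space \<mu> |A. A \<in> sets borel} \<subseteq> sets (path_sigma I)"
      using measurable_sets[OF that] by (intro sets.sigma_sets_subset) (auto simp: space_\<mu>)
    then show ?thesis by (simp add: space_\<mu>)
  qed
  have "indep_set (sigma_sets (space \<mu>) {a -` A \<inter> space \<mu> |A. A \<in> sets borel})
      (sigma_sets (space \<mu>) {b -` A \<inter> space \<mu> |A. A \<in> sets borel})"
    using sub[OF a(1)] sub[OF b(1)] indep_setD_ev1[OF independent] indep_setD_ev2[OF independent]
    by (intro indep_setI indep_setD[OF independent]) auto
  then show "indep_var borel a borel b"
    using a b by (simp add: indep_var_eq borel_measurable_integrable)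
qed

lemma expectation_nonneg_times:
  assumes "0 \<le> t 0" "\<And>j. j < n \<Longrightarrow> t j \<le> t (Suc j)" "\<And>j. j \<le> n \<Longrightarrow> f j \<in> Linf"
  shows "(LINT w|\<mu>. (\<Prod>j\<le>n. f j (w (t j)))) = transition_op (t 0) (\<lambda>y. f 0 y * semigroup_chain transition_op t f 0 n y) x"
  using fwd.forward_expectation[of t 0 n f] assms by (simp add: atMost_atLeast0)

lemma expectation_nonpos_times:
  assumes "t n \<le> 0" "\<And>j. j < n \<Longrightarrow> t j \<le> t (Suc j)" "\<And>j. j \<le> n \<Longrightarrow> f j \<in> Linf"
  shows "(LINT w|\<mu>. (\<Prod>j\<le>n. f j (w (t j)))) = transition_op (- t n) (backward_chain t f n) x"
  using bwd.backward_expectation[of t n f] assms by simp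

text \<open>
The index \<open>k\<close> separates nonpositive and nonnegative times; the two groups are independent.
\<close>

lemma expectation_mixed_times:
  assumes k: "k < n" "t k \<le> 0" "0 \<le> t (Suc k)"
    and mono: "\<And>j. j < n \<Longrightarrow> t j \<le> t (Suc j)" and f: "\<And>j. j \<le> n \<Longrightarrow> f j \<in> Linf"
  shows "(LINT w|\<mu>. (\<Prod>j\<le>n. f j (w (t j)))) = transition_op (- t k) (backward_chain t f k) x *
    transition_op (t (Suc k)) (\<lambda>y. f (Suc k) y * semigroup_chain transition_op t f (Suc k) (n - Suc k) y) x"
proof -
  let ?a = "\<lambda>w. \<Prod>j\<in>{Suc k..n}. f j (w (t j))" and ?b = "\<lambda>w. \<Prod>j\<le>k. f j (w (t j))"
  have n: "Suc k + (n - Suc k) = n" using k by simp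
  have pos: "0 \<le> t j" if "Suc k \<le> j" "j \<le> n" for j
    using that
  proof (induction j rule: dec_induct)
    case (step i)
    then show ?case using mono[of i] by simp
  qed (rule k)
  have neg: "t j \<le> 0" if "j \<le> k" for j
    using that
  proof (induction j rule: inc_induct)
    case (step i)
    then show ?case using mono[of i] k by simp
  qed (rule k)
  have coord: "(\<lambda>w. w r) \<in> borel_measurable (path_sigma I)" if "r \<in> I" for r I
    unfolding path_sigma_def using that by (rule measurable_process_sigma_component[where Y="\<lambda>t w. w t"])
  have "{..n} = {..k} \<union> {Suc k..n}" "{..k} \<inter> {Suc k..n} = {}" using k by auto
  then have "(LINT w|\<mu>. (\<Prod>j\<le>n. f j (w (t j)))) = (LINT w|\<mu>. ?a w * ?b w)"
    by (simp add: prod.union_disjoint mult.commute)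
  also have "\<dots> = (LINT w|\<mu>. ?a w) * (LINT w|\<mu>. ?b w)"
  proof (rule expectation_mult)
    show "integrable \<mu> ?a" "integrable \<mu> ?b" using f k by (auto intro!: integrable_product)
    show "?a \<in> borel_measurable (path_sigma {0..})"
      using f pos by (intro borel_measurable_prod measurable_compose[OF coord Linf_measurable]) auto
    show "?b \<in> borel_measurable (path_sigma {..0})"
      using f neg k by (intro borel_measurable_prod measurable_compose[OF coord Linf_measurable]) auto
  qed
  also have "(LINT w|\<mu>. ?b w) = transition_op (- t k) (backward_chain t f k) x"
    using k mono f by (intro expectation_nonpos_times) auto
  also have "(LINT w|\<mu>. ?a w) = transition_op (t (Suc k)) (\<lambda>y. f (Suc k) y * semigroup_chain transition_op t f (Suc k) (n - Suc k) y) x"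
    using fwd.forward_expectation[of t "Suc k" "n - Suc k" f] k mono f unfolding n by simp
  finally show ?thesis by (simp add: mult.commute)
qed

end

context reversible_transition
begin

text \<open>
Three cases, according to whether all times are on one side of 0. On integration against the
stationary measure, symmetry and the semigroup property absorb the operators that lead
from time 0 to the nearest times.
\<close>

lemma stationary_path_formula:
  assumes \<mu>: "\<And>x. two_sided_process N m (\<mu> x) x"
    and mono: "\<And>j. j < n \<Longrightarrow> t j \<le> t (Suc j)" and f: "\<And>j. j \<le> n \<Longrightarrow> f j \<in> Linf"
  shows "integrable m (\<lambda>x. LINT w|\<mu> x. (\<Prod>j\<le>n. f j (w (t j))))" (is "integrable m ?E")
    and "(LINT x|m. (LINT w|\<mu> x. (\<Prod>j\<le>n. f j (w (t j))))) = (LINT x|m. f 0 x * semigroup_chain transition_op t f 0 n x)"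
proof -
  have one: "(\<lambda>_. 1) \<in> Linf" by (rule Linf_bounded[where C=1]) auto
  have "?E \<in> Linf \<and> (LINT x|m. ?E x) = (LINT x|m. f 0 x * semigroup_chain transition_op t f 0 n x)"
  proof -
    consider "0 \<le> t 0" | "t n \<le> 0" | k where "k < n" "t k \<le> 0" "0 \<le> t (Suc k)"
    proof -
      have "0 \<le> t 0 \<or> t n \<le> 0 \<or> (\<exists>k<n. t k \<le> 0 \<and> 0 \<le> t (Suc k))"
      proof (induction n)
        case (Suc n)
        then show ?case by (metis less_Suc_eq linorder_linear)
      qed auto
      then show thesis using that by blast
    qed
    then show ?thesis
    proof cases
      case 1
      let ?g = "\<lambda>y. f 0 y * semigroup_chain transition_op t f 0 n y"
      have g: "?g \<in> Linf" using mono f by (intro Linf_mult chain_Linf) auto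
      have E: "?E = transition_op (t 0) ?g"
        using two_sided_process.expectation_nonneg_times[OF \<mu> 1 mono f] by auto
      have "(LINT x|m. transition_op (t 0) ?g x) = (LINT x|m. 1 * transition_op (t 0) ?g x)" by simp
      also have "\<dots> = (LINT x|m. ?g x * transition_op (t 0) (\<lambda>_. 1) x)" by (rule transition_op_symmetric[OF one g 1])
      also have "\<dots> = (LINT x|m. ?g x)" using transition_op_one[OF 1] by simp
      finally show ?thesis using transition_op_Linf[OF g 1] by (simp add: E)
    next
      case 2
      have b: "backward_chain t f n \<in> Linf" using mono f by (intro backward_chain_Linf) auto
      have t: "0 \<le> - t n" using 2 by simp
      have E: "?E = transition_op (- t n) (backward_chain t f n)"
        using two_sided_process.expectation_nonpos_times[OF \<mu> 2 mono f] by auto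
      have "(LINT x|m. transition_op (- t n) (backward_chain t f n) x) = (LINT x|m. 1 * transition_op (- t n) (backward_chain t f n) x)" by simp
      also have "\<dots> = (LINT x|m. backward_chain t f n x * transition_op (- t n) (\<lambda>_. 1) x)" by (rule transition_op_symmetric[OF one b t])
      also have "\<dots> = (LINT x|m. backward_chain t f n x * semigroup_chain transition_op t f n (n - n) x)" using transition_op_one[OF t] by simp
      also have "\<dots> = (LINT x|m. f 0 x * semigroup_chain transition_op t f 0 n x)" using chain_pairing[of n t f n] mono f by simp
      finally show ?thesis using transition_op_Linf[OF b t] by (simp add: E)
    next
      case 3
      let ?b = "backward_chain t f k" and ?g = "\<lambda>y. f (Suc k) y * semigroup_chain transition_op t f (Suc k) (n - Suc k) y"
      have b: "?b \<in> Linf" using 3 mono f by (intro backward_chain_Linf) auto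
      have g: "?g \<in> Linf" using 3 mono f by (intro Linf_mult chain_Linf) auto
      have t: "0 \<le> - t k" "0 \<le> t (Suc k)" using 3 by auto
      have E: "?E = (\<lambda>x. transition_op (- t k) ?b x * transition_op (t (Suc k)) ?g x)"
        using two_sided_process.expectation_mixed_times[OF \<mu> 3 mono f] by auto
      have "(LINT x|m. transition_op (- t k) ?b x * transition_op (t (Suc k)) ?g x) = (LINT x|m. transition_op (t (Suc k)) ?g x * transition_op (- t k) ?b x)"
        by (simp add: mult.commute)
      also have "\<dots> = (LINT x|m. ?b x * transition_op (- t k) (transition_op (t (Suc k)) ?g) x)"
        by (rule transition_op_symmetric[OF transition_op_Linf[OF g t(2)] b t(1)])
      also have "transition_op (- t k) (transition_op (t (Suc k)) ?g) = transition_op (t (Suc k) - t k) ?g"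
        using transition_op_add[OF g t] by (auto simp: algebra_simps)
      also have "(LINT x|m. ?b x * transition_op (t (Suc k) - t k) ?g x) = (LINT x|m. ?b x * semigroup_chain transition_op t f k (n - k) x)"
      proof -
        have "n - k = Suc (n - Suc k)" using 3 by simp
        then show ?thesis by simp
      qed
      also have "\<dots> = (LINT x|m. f 0 x * semigroup_chain transition_op t f 0 n x)" using chain_pairing[of n t f k] 3 mono f by simp
      finally show ?thesis using Linf_mult[OF transition_op_Linf[OF b t(1)] transition_op_Linf[OF g t(2)]] by (simp add: E)
    qed
  qed
  then show "integrable m ?E" "(LINT x|m. ?E x) = (LINT x|m. f 0 x * semigroup_chain transition_op t f 0 n x)"
    using Linf_integrable_m by auto
qed

end

context fk_ground
begin

lemma AE_stationary: "(AE x in stationary_measure \<phi>. P x) \<longleftrightarrow> (AE x in lborel. P x)"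
proof -
  have "\<phi> x \<noteq> 0" for x using phi_pos[of x] by simp
  then show ?thesis unfolding stationary_measure_def by (subst AE_density) auto
qed

lemma reversible_transition: "reversible_transition transition (stationary_measure \<phi>)"
proof (rule reversible_transition.intro)
  fix t x assume t: "0 \<le> (t::real)"
  show "prob_space (transition t x)" by (rule prob_space_transition[OF t])
next
  fix t :: real and x show "sets (transition t x) = sets borel" by simp
next
  fix t :: real and f :: "'a \<Rightarrow> ennreal" assume "0 \<le> t" "f \<in> borel_measurable borel"
  then show "(\<lambda>x. \<integral>\<^sup>+y. f y \<partial>transition t x) \<in> borel_measurable borel"
    by (simp add: nn_integral_transition intrinsic_op_measurable)
next
  fix x show "transition 0 x = return borel x" by (simp add: transition_def)
next
  fix s t :: real and x and f :: "'a \<Rightarrow> ennreal" assume "0 \<le> s" "0 \<le> t" "f \<in> borel_measurable borel"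
  then show "(\<integral>\<^sup>+y. f y \<partial>transition (s + t) x) = (\<integral>\<^sup>+z. (\<integral>\<^sup>+y. f y \<partial>transition t z) \<partial>transition s x)"
    by (simp add: nn_integral_transition intrinsic_op_add intrinsic_op_measurable)
next
  fix t :: real and f g :: "'a \<Rightarrow> ennreal" assume "0 \<le> t" "f \<in> borel_measurable borel" "g \<in> borel_measurable borel"
  then show "(\<integral>\<^sup>+x. f x * (\<integral>\<^sup>+y. g y \<partial>transition t x) \<partial>stationary_measure \<phi>)
      = (\<integral>\<^sup>+x. g x * (\<integral>\<^sup>+y. f y \<partial>transition t x) \<partial>stationary_measure \<phi>)"
    by (simp add: nn_integral_transition intrinsic_op_symmetric[of t f g])
next
  show "prob_space (stationary_measure \<phi>)"
    using phi_norm by (intro prob_spaceI) (simp add: stationary_measure_def emeasure_density l2_norm_sq_def)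
  show "sets (stationary_measure \<phi>) = sets borel" by (simp add: stationary_measure_def)
next
  fix t :: real and x and P :: "'a \<Rightarrow> bool" assume t: "0 < t" and P: "AE y in stationary_measure \<phi>. P y"
  have [measurable]: "(\<lambda>y. ennreal (intrinsic_kernel l \<phi> u t x y * (\<phi> y)\<^sup>2)) \<in> borel_measurable lborel"
    unfolding intrinsic_kernel_def using u_measurable1[OF t] by measurable
  show "AE y in transition t x. P y"
  proof -
    have T: "transition t x = density lborel (\<lambda>y. ennreal (intrinsic_kernel l \<phi> u t x y * (\<phi> y)\<^sup>2))"
      using t by (simp add: transition_def)
    show ?thesis
      unfolding T using P[unfolded AE_stationary] by (subst AE_density) (auto elim: eventually_mono)
  qed
qed

sublocale kernels: reversible_transition transition "stationary_measure \<phi>"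
  by (rule reversible_transition)

lemma Linf_space_eq: "Linf_space = kernels.Linf"
  by (simp add: Linf_space_def kernels.Linf_def AE_stationary)

lemma intrinsic_semigroup_eq:
  assumes f: "f \<in> borel_measurable borel" and t: "0 \<le> t"
  shows "intrinsic_semigroup l \<phi> u t f = kernels.transition_op t f"
proof (cases "t = 0")
  case True
  then show ?thesis using f by (auto simp: intrinsic_semigroup_def kernels.transition_op_def kernels.N_zero integral_return)
next
  case False
  then have t': "0 < t" using t by simp
  note [measurable] = f u_measurable1[OF t']
  have "kernels.transition_op t f x = intrinsic_semigroup l \<phi> u t f x" for x
  proof -
    have "kernels.transition_op t f x = (LINT y|lborel. (intrinsic_kernel l \<phi> u t x y * (\<phi> y)\<^sup>2) *\<^sub>R f y)"
    proof -
      have [measurable]: "intrinsic_kernel l \<phi> u t x \<in> borel_measurable borel"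
        unfolding intrinsic_kernel_def[abs_def] by measurable
      have T: "transition t x = density lborel (\<lambda>y. ennreal (intrinsic_kernel l \<phi> u t x y * (\<phi> y)\<^sup>2))"
        using False by (simp add: transition_def)
      have "0 \<le> intrinsic_kernel l \<phi> u t x y" for y
        using phi_pos[of x] phi_pos[of y] u_pos[OF t', of x y] by (simp add: intrinsic_kernel_def)
      then show ?thesis unfolding kernels.transition_op_def T by (intro integral_density) auto
    qed
    then show ?thesis using False by (simp add: intrinsic_semigroup_def ac_simps)
  qed
  then show ?thesis by auto
qed

lemma semigroup_chain_eq:
  "(\<And>j. k \<le> j \<Longrightarrow> j < k + n \<Longrightarrow> t j \<le> t (Suc j)) \<Longrightarrow> (\<And>j. k < j \<Longrightarrow> j \<le> k + n \<Longrightarrow> f j \<in> kernels.Linf) \<Longrightarrow>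
    semigroup_chain (intrinsic_semigroup l \<phi> u) t f k n = semigroup_chain kernels.transition_op t f k n"
proof (induction n arbitrary: k)
  case (Suc n)
  have "semigroup_chain (intrinsic_semigroup l \<phi> u) t f (Suc k) n = semigroup_chain kernels.transition_op t f (Suc k) n"
    using Suc.prems by (intro Suc.IH) auto
  moreover have "(\<lambda>x. f (Suc k) x * semigroup_chain kernels.transition_op t f (Suc k) n x) \<in> kernels.Linf"
    using Suc.prems by (intro kernels.Linf_mult kernels.chain_Linf) auto
  ultimately show ?case
    using Suc.prems(1)[of k] by (simp add: intrinsic_semigroup_eq kernels.Linf_measurable)
qed simp

lemma two_sided_process_exists: "\<exists>\<mu>. two_sided_process transition (stationary_measure \<phi>) \<mu> x"
proof -
  obtain Q :: "(nat \<Rightarrow> 'w) measure" and Y where Q: "prob_space Q" "kernel_markov Q Y transition"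
     "\<And>\<omega>. \<omega> \<in> space Q \<Longrightarrow> cadlag_on {0..} (\<lambda>t. Y t \<omega>)" "\<And>\<omega>. \<omega> \<in> space Q \<Longrightarrow> Y 0 \<omega> = x"
     "\<And>t. 0 < t \<Longrightarrow> AE \<omega> in Q. left_lim (\<lambda>r. Y r \<omega>) t = Y t \<omega>"
    using one_sided_process[of x] by blast
  from two_sided_law_exists[OF this kernels.N_measurable]
  obtain \<mu> where \<mu>: "prob_space \<mu>" "space \<mu> = cadlag_paths" "sets \<mu> = sets (path_sigma UNIV)"
    "measure \<mu> {w \<in> space \<mu>. w 0 = x} = 1"
    "prob_space.indep_set \<mu> (sets (path_sigma {0..})) (sets (path_sigma {..0}))"
    "kernel_markov \<mu> (\<lambda>t w. w t) transition" "kernel_markov \<mu> (\<lambda>t w. w (- t)) transition" by blast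
  have "two_sided_process transition (stationary_measure \<phi>) \<mu> x"
    by (intro two_sided_process.intro two_sided_process_axioms.intro reversible_transition \<mu>)
  then show ?thesis by blast
qed

theorem intrinsic_path_measures:
  "\<exists>\<mu> :: 'a \<Rightarrow> (real \<Rightarrow> 'a) measure.
    (\<forall>x. prob_space (\<mu> x) \<and> space (\<mu> x) = cadlag_paths \<and> sets (\<mu> x) = sets (path_sigma UNIV)) \<and>
    (\<forall>x. measure (\<mu> x) {w \<in> space (\<mu> x). w 0 = x} = 1) \<and>
    (\<forall>x. prob_space.indep_set (\<mu> x) (sets (path_sigma {0..})) (sets (path_sigma {..0}))) \<and>
    (\<forall>x t. distr (\<mu> x) borel (\<lambda>w. w (- t)) = distr (\<mu> x) borel (\<lambda>w. w t)) \<and>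
    (\<forall>x. markov_process (\<mu> x) (\<lambda>t. path_sigma {0..t}) (\<lambda>t w. w t) \<and>
         markov_process (\<mu> x) (\<lambda>t. path_sigma {-t..0}) (\<lambda>t w. w (- t))) \<and>
    (\<forall>(n::nat) (t :: nat \<Rightarrow> real) (f :: nat \<Rightarrow> 'a \<Rightarrow> real).
       (\<forall>j<n. t j \<le> t (Suc j)) \<and> (\<forall>j\<le>n. f j \<in> Linf_space) \<longrightarrow>
       (\<forall>x. integrable (\<mu> x) (\<lambda>w. \<Prod>j\<le>n. f j (w (t j)))) \<and>
       integrable (stationary_measure \<phi>) (\<lambda>x. LINT w|\<mu> x. (\<Prod>j\<le>n. f j (w (t j)))) \<and>
       (LINT x|stationary_measure \<phi>. (LINT w|\<mu> x. (\<Prod>j\<le>n. f j (w (t j))))) =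
         (LINT x|stationary_measure \<phi>.
            f 0 x * semigroup_chain (intrinsic_semigroup l \<phi> u) t f 0 n x) \<and>
       (\<forall>s. (LINT x|stationary_measure \<phi>. (LINT w|\<mu> x. (\<Prod>j\<le>n. f j (w (t j))))) =
            (LINT x|stationary_measure \<phi>. (LINT w|\<mu> x. (\<Prod>j\<le>n. f j (w (t j + s)))))))"
proof -
  obtain \<mu> where \<mu>: "\<And>x. two_sided_process transition (stationary_measure \<phi>) (\<mu> x) x"
    using two_sided_process_exists by metis
  have markov: "markov_process (\<mu> x) (\<lambda>t. path_sigma {0..t}) (\<lambda>t w. w t)"
    "markov_process (\<mu> x) (\<lambda>t. path_sigma {-t..0}) (\<lambda>t w. w (- t))" for x
  proof -
    interpret P: two_sided_process transition "stationary_measure \<phi>" "\<mu> x" x by (rule \<mu>)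
    show "markov_process (\<mu> x) (\<lambda>t. path_sigma {0..t}) (\<lambda>t w. w t)"
      using P.fwd.markov_process_past by (simp add: P.space_\<mu> path_sigma_def)
    have im: "uminus ` {0..t} = {-t..0}" for t :: real by simp
    show "markov_process (\<mu> x) (\<lambda>t. path_sigma {-t..0}) (\<lambda>t w. w (- t))"
      using P.bwd.markov_process_past unfolding P.space_\<mu> process_sigma_reversed im .
  qed
  have formula: "(LINT x|stationary_measure \<phi>. (LINT w|\<mu> x. (\<Prod>j\<le>n. f j (w (t j))))) =
         (LINT x|stationary_measure \<phi>. f 0 x * semigroup_chain kernels.transition_op t f 0 n x)"
    "integrable (stationary_measure \<phi>) (\<lambda>x. LINT w|\<mu> x. (\<Prod>j\<le>n. f j (w (t j))))"
    if "\<forall>j<n. t j \<le> t (Suc j)" "\<forall>j\<le>n. f j \<in> kernels.Linf" for n t f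
    using kernels.stationary_path_formula[OF \<mu>, of n t f] that by auto
  have shift: "semigroup_chain kernels.transition_op (\<lambda>j. t j + s) f k n = semigroup_chain kernels.transition_op t f k n" for t s f k n
    by (induction n arbitrary: k) auto
  show ?thesis
  proof (intro exI[of _ \<mu>] conjI allI impI)
    fix x
    interpret P: two_sided_process transition "stationary_measure \<phi>" "\<mu> x" x by (rule \<mu>)
    show "prob_space (\<mu> x)" "space (\<mu> x) = cadlag_paths" "sets (\<mu> x) = sets (path_sigma UNIV)"
      "measure (\<mu> x) {w \<in> space (\<mu> x). w 0 = x} = 1"
      "prob_space.indep_set (\<mu> x) (sets (path_sigma {0..})) (sets (path_sigma {..0}))"
      by (rule P.prob_space_axioms P.space_\<mu> P.sets_\<mu> P.start P.independent)+
    show "distr (\<mu> x) borel (\<lambda>w. w (- t)) = distr (\<mu> x) borel (\<lambda>w. w t)" for t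
      by (rule P.reflection)
    show "markov_process (\<mu> x) (\<lambda>t. path_sigma {0..t}) (\<lambda>t w. w t)"
      "markov_process (\<mu> x) (\<lambda>t. path_sigma {-t..0}) (\<lambda>t w. w (- t))" by (rule markov)+
  next
    fix n :: nat and t :: "nat \<Rightarrow> real" and f :: "nat \<Rightarrow> 'a \<Rightarrow> real"
    assume *: "(\<forall>j<n. t j \<le> t (Suc j)) \<and> (\<forall>j\<le>n. f j \<in> Linf_space)"
    then have tf: "\<forall>j<n. t j \<le> t (Suc j)" "\<forall>j\<le>n. f j \<in> kernels.Linf" by (auto simp: Linf_space_eq)
    have ch: "semigroup_chain (intrinsic_semigroup l \<phi> u) t f 0 n = semigroup_chain kernels.transition_op t f 0 n"
      using tf by (intro semigroup_chain_eq) auto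
    show "integrable (stationary_measure \<phi>) (\<lambda>x. LINT w|\<mu> x. (\<Prod>j\<le>n. f j (w (t j))))"
      by (rule formula(2)[OF tf])
    show "(LINT x|stationary_measure \<phi>. (LINT w|\<mu> x. (\<Prod>j\<le>n. f j (w (t j))))) =
         (LINT x|stationary_measure \<phi>. f 0 x * semigroup_chain (intrinsic_semigroup l \<phi> u) t f 0 n x)"
      unfolding ch by (rule formula(1)[OF tf])
    fix s :: real and x
    interpret P: two_sided_process transition "stationary_measure \<phi>" "\<mu> x" x by (rule \<mu>)
    show "integrable (\<mu> x) (\<lambda>w. \<Prod>j\<le>n. f j (w (t j)))"
      using tf by (intro P.integrable_product) auto
    have "\<forall>j<n. t j + s \<le> t (Suc j) + s" using tf by simp
    from formula(1)[OF this tf(2)] formula(1)[OF tf]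
    show "(LINT x|stationary_measure \<phi>. (LINT w|\<mu> x. (\<Prod>j\<le>n. f j (w (t j))))) =
            (LINT x|stationary_measure \<phi>. (LINT w|\<mu> x. (\<Prod>j\<le>n. f j (w (t j + s)))))"
      by (simp add: shift)
  qed
qed

end

text \<open>
A Levy process starts at 0 only almost surely. Subtracting its initial value makes this exact and
changes neither its increments nor, up to a null set, its paths.
\<close>

lemma levy_process_start_zero:
  assumes "levy_process M X"
  shows "levy_process M (\<lambda>t \<omega>. X t \<omega> - X 0 \<omega>)"
proof -
  let ?Y = "\<lambda>t \<omega>. X t \<omega> - X 0 \<omega>"
  interpret prob_space M using assms by (simp add: levy_process_def)
  have Xm: "X t \<in> borel_measurable M" if "0 \<le> t" for t using assms that by (simp add: levy_process_def)
  have AE0: "AE \<omega> in M. X 0 \<omega> = 0" using assms by (simp add: levy_process_def)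
  have cad: "cadlag_on {0..} (\<lambda>t. X t \<omega>)" if "\<omega> \<in> space M" for \<omega> using assms that by (simp add: levy_process_def)
  have sub: "sets (process_sigma (space M) ?Y {0..s}) \<subseteq> sets (process_sigma (space M) X {0..s})" if "0 \<le> s" for s
    using that by (intro sets_process_sigma_subset borel_measurable_diff measurable_process_sigma_component) auto
  show ?thesis
    unfolding levy_process_def
  proof (intro conjI allI impI ballI)
    show "prob_space M" by unfold_locales
    show "?Y t \<in> borel_measurable M" if "0 \<le> t" for t
      using that by (intro borel_measurable_diff Xm) auto
    show "AE \<omega> in M. X 0 \<omega> - X 0 \<omega> = 0" by simp
    show "cadlag_on {0..} (\<lambda>t. X t \<omega> - X 0 \<omega>)" if "\<omega> \<in> space M" for \<omega>
      unfolding cadlag_on_def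
    proof (intro ballI conjI)
      fix t :: real assume t: "t \<in> {0..}"
      from cad[OF that] t obtain l where r: "((\<lambda>t. X t \<omega>) \<longlongrightarrow> X t \<omega>) (at t within {0..} \<inter> {t<..})"
        and l: "((\<lambda>t. X t \<omega>) \<longlongrightarrow> l) (at t within {0..} \<inter> {..<t})"
        unfolding cadlag_on_def by blast
      show "((\<lambda>t. X t \<omega> - X 0 \<omega>) \<longlongrightarrow> X t \<omega> - X 0 \<omega>) (at t within {0..} \<inter> {t<..})"
        by (intro tendsto_diff r tendsto_const)
      show "\<exists>l. ((\<lambda>t. X t \<omega> - X 0 \<omega>) \<longlongrightarrow> l) (at t within {0..} \<inter> {..<t})"
        by (intro exI[of _ "l - X 0 \<omega>"] tendsto_diff l tendsto_const)
    qed
    fix s t :: real assume st: "0 \<le> s \<and> s \<le> t"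
    have "distr M borel (\<lambda>\<omega>. X t \<omega> - X s \<omega>) = distr M borel (X (t - s))"
      using assms st by (simp add: levy_process_def)
    moreover have "distr M borel (X (t - s)) = distr M borel (?Y (t - s))"
      using st Xm AE0 by (intro distr_cong_AE) (auto elim: eventually_mono)
    ultimately show "distr M borel (\<lambda>\<omega>. ?Y t \<omega> - ?Y s \<omega>) = distr M borel (?Y (t - s))" by simp
    have "indep_set (sets (process_sigma (space M) X {0..s})) (sets (vimage_algebra (space M) (\<lambda>\<omega>. X t \<omega> - X s \<omega>) borel))"
      using assms st by (simp add: levy_process_def)
    then show "indep_set (sets (process_sigma (space M) ?Y {0..s})) (sets (vimage_algebra (space M) (\<lambda>\<omega>. ?Y t \<omega> - ?Y s \<omega>) borel))"
      using sub[of s] st by (intro indep_setI) (auto dest: indep_setD indep_setD_ev1 indep_setD_ev2)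
  qed
qed

lemma kato_class_cong_AE:
  assumes "AE \<omega> in M. \<forall>t. Y t \<omega> = X t \<omega>"
  shows "kato_class M Y W = kato_class M X W"
proof -
  have "(\<integral>\<^sup>+\<omega>. ennreal \<bar>W (x + Y s \<omega>)\<bar> \<partial>M) = (\<integral>\<^sup>+\<omega>. ennreal \<bar>W (x + X s \<omega>)\<bar> \<partial>M)" for x s
    using assms by (intro nn_integral_cong_AE) (auto elim: eventually_mono)
  then show ?thesis by (simp add: kato_class_def)
qed

lemma kato_decomposable_cong_AE:
  assumes "AE \<omega> in M. \<forall>t. Y t \<omega> = X t \<omega>"
  shows "kato_decomposable M Y V = kato_decomposable M X V"
  unfolding kato_decomposable_def kato_class_loc_def kato_class_cong_AE[OF assms] ..

text \<open>
Measurability of both integrands is used, as the measure need not be complete.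
\<close>

lemma fk_semigroup_cong_AE:
  assumes X: "levy_process M X" and Y: "levy_process M Y" and eq: "AE \<omega> in M. \<forall>t. Y t \<omega> = X t \<omega>"
    and V: "V \<in> borel_measurable borel" and f: "f \<in> borel_measurable borel" and t: "0 \<le> t"
  shows "fk_semigroup M Y V t f x = fk_semigroup M X V t f x"
proof -
  have m: "(\<lambda>\<omega>. exp (- (LINT s:{0..t}|lborel. V (x + Z s \<omega>))) * f (x + Z t \<omega>)) \<in> borel_measurable M"
    if Z: "levy_process M Z" for Z
  proof -
    have "(\<lambda>(x, \<omega>). action V t x (\<lambda>q. Z q \<omega>)) \<in> borel_measurable (borel \<Otimes>\<^sub>M M)"
      using Z t V by (intro measurable_action_process) (auto simp: levy_process_def intro: cadlag_right)
    from measurable_compose[OF _ this, of "\<lambda>\<omega>. (x, \<omega>)" M]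
    have [measurable]: "(\<lambda>\<omega>. action V t x (\<lambda>q. Z q \<omega>)) \<in> borel_measurable M" by simp
    have [measurable]: "Z t \<in> borel_measurable M" using Z t by (simp add: levy_process_def)
    note [measurable] = f
    have "(\<lambda>\<omega>. exp (- action V t x (\<lambda>q. Z q \<omega>)) * f (x + Z t \<omega>)) \<in> borel_measurable M" by measurable
    then show ?thesis by (simp add: action_def)
  qed
  show ?thesis
    unfolding fk_semigroup_def using eq by (intro integral_cong_AE m X Y) (auto elim: eventually_mono)
qed

theorem theorem5p1:
  fixes \<alpha> :: real
    and M :: "'w measure"
    and X :: "real \<Rightarrow> 'w \<Rightarrow> 'a::euclidean_space"
    and V :: "'a \<Rightarrow> real"
    and u :: "real \<Rightarrow> 'a \<Rightarrow> 'a \<Rightarrow> real"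
    and l\<^sub>0 :: real
    and \<phi>\<^sub>0 :: "'a \<Rightarrow> real"
  assumes "0 < \<alpha>" and "\<alpha> < 2"
    and "stable_process \<alpha> M X"
    and "kato_decomposable M X V"
    and "fk_kernel M X V u"
    and "l\<^sub>0 = Inf (op_spectrum (fk_hamiltonian M X V))"
    and "l\<^sub>0 isolated_in op_spectrum (fk_hamiltonian M X V)"
    and "ground_state (fk_hamiltonian M X V) l\<^sub>0 \<phi>\<^sub>0"
  shows "\<exists>\<mu> :: 'a \<Rightarrow> (real \<Rightarrow> 'a) measure.
    (\<forall>x. prob_space (\<mu> x) \<and> space (\<mu> x) = cadlag_paths \<and> sets (\<mu> x) = sets (path_sigma UNIV)) \<and>
    (\<forall>x. measure (\<mu> x) {w \<in> space (\<mu> x). w 0 = x} = 1) \<and>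
    (\<forall>x. prob_space.indep_set (\<mu> x) (sets (path_sigma {0..})) (sets (path_sigma {..0}))) \<and>
    (\<forall>x t. distr (\<mu> x) borel (\<lambda>w. w (- t)) = distr (\<mu> x) borel (\<lambda>w. w t)) \<and>
    (\<forall>x. markov_process (\<mu> x) (\<lambda>t. path_sigma {0..t}) (\<lambda>t w. w t) \<and>
         markov_process (\<mu> x) (\<lambda>t. path_sigma {-t..0}) (\<lambda>t w. w (- t))) \<and>
    (\<forall>(n::nat) (t :: nat \<Rightarrow> real) (f :: nat \<Rightarrow> 'a \<Rightarrow> real).
       (\<forall>j<n. t j \<le> t (Suc j)) \<and> (\<forall>j\<le>n. f j \<in> Linf_space) \<longrightarrow>
       (\<forall>x. integrable (\<mu> x) (\<lambda>w. \<Prod>j\<le>n. f j (w (t j)))) \<and>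
       integrable (stationary_measure \<phi>\<^sub>0) (\<lambda>x. LINT w|\<mu> x. (\<Prod>j\<le>n. f j (w (t j)))) \<and>
       (LINT x|stationary_measure \<phi>\<^sub>0. (LINT w|\<mu> x. (\<Prod>j\<le>n. f j (w (t j))))) =
         (LINT x|stationary_measure \<phi>\<^sub>0.
            f 0 x * semigroup_chain (intrinsic_semigroup l\<^sub>0 \<phi>\<^sub>0 u) t f 0 n x) \<and>
       (\<forall>s. (LINT x|stationary_measure \<phi>\<^sub>0. (LINT w|\<mu> x. (\<Prod>j\<le>n. f j (w (t j))))) =
            (LINT x|stationary_measure \<phi>\<^sub>0. (LINT w|\<mu> x. (\<Prod>j\<le>n. f j (w (t j + s)))))))"
proof -
  have X: "levy_process M X" using assms(3) by (simp add: stable_process_def)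
  define Y where "Y t \<omega> = X t \<omega> - X 0 \<omega>" for t \<omega>
  have Y: "levy_process M Y" using levy_process_start_zero[OF X] by (simp add: Y_def[abs_def])
  have "AE \<omega> in M. X 0 \<omega> = 0" using X by (simp add: levy_process_def)
  then have eq: "AE \<omega> in M. \<forall>t. Y t \<omega> = X t \<omega>" by eventually_elim (simp add: Y_def)
  have V: "V \<in> borel_measurable borel" using assms(4) by (simp add: kato_decomposable_def)
  note fk = fk_semigroup_cong_AE[OF X Y eq V]
  have kernel: "fk_kernel M Y V u"
    using assms(5) fk by (auto simp: fk_kernel_def L2_space_def)
  have \<phi>: "\<phi>\<^sub>0 \<in> borel_measurable borel"
    using assms(8) by (auto simp: ground_state_def fk_hamiltonian_def semigroup_hamiltonian_def L2_space_def)
  have "\<forall>\<^sub>F t in at_right 0. l2_norm_sq (\<lambda>x. (\<phi>\<^sub>0 x - fk_semigroup M X V t \<phi>\<^sub>0 x) / t - l\<^sub>0 * \<phi>\<^sub>0 x)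
      = l2_norm_sq (\<lambda>x. (\<phi>\<^sub>0 x - fk_semigroup M Y V t \<phi>\<^sub>0 x) / t - l\<^sub>0 * \<phi>\<^sub>0 x)"
    unfolding eventually_at_right_field using fk[OF \<phi>] by (intro exI[of _ 1]) simp
  then have ground: "ground_state (fk_hamiltonian M Y V) l\<^sub>0 \<phi>\<^sub>0"
    using assms(8) unfolding ground_state_def fk_hamiltonian_def semigroup_hamiltonian_def
    by (auto elim: Lim_transform_eventually)
  interpret fk_ground M Y V u l\<^sub>0 \<phi>\<^sub>0
  proof (intro fk_ground.intro fk_with_kernel.intro feynman_kac.intro levy.intro
      fk_ground_axioms.intro fk_with_kernel_axioms.intro feynman_kac_axioms.intro levy_axioms.intro)
    show "prob_space M" using Y by (simp add: levy_process_def)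
    show "levy_process M Y" by (rule Y)
    show "Y 0 \<omega> = 0" for \<omega> by (simp add: Y_def)
    show "kato_decomposable M Y V" using assms(4) kato_decomposable_cong_AE[OF eq] by simp
  qed (rule kernel ground)+
  show ?thesis by (rule intrinsic_path_measures)
qed

end
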